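(* Let $N\in\mathbb{N}$. The space $D^{log}(\mathbb{R}^N)$ is a Hilbert space with the inner product $\langle\cdot,\cdot\rangle$. Moreover: 1. $C_c^\infty(\mathbb{R}^N)$ is dense in $D^{log}(\mathbb{R}^N)$; 2. $D^{log}(\mathbb{R}^N)$ is compactly embedded in $L^2(\mathbb{R}^N)$; 3. there is $C>0$ such that, for every $v_1,v_2\in D^{log}(\mathbb{R}^N)$, each term in the definition $$\mathcal{E}_L(v_1,v_2):=\mathcal{E}(v_1,v_2)-c_N\iint_{|x-y|\ge1}\frac{v_1(x)v_2(y)}{|x-y|^N}\,dx\,dy+\rho_N\int_{\mathbb{R}^N}v_1v_2\,dx$$ is finite and $|\mathcal{E}_L(v_1,v_2)|\le C\|v_1\|\,\|v_2\|$.
   Context: Functions are real valued. $c_N=\pi^{-N/2}\Gamma(\tfrac N2)$, $\rho_N=2\ln2+\psi(\tfrac N2)-\gamma$, $\psi=\Gamma'/\Gamma$, $\gamma=-\Gamma'(1)$, and $B_1(x)$ is the open unit ball centered at $x\in\mathbb{R}^N$. Define $$\mathcal{E}(v_1,v_2)=\frac{c_N}{2}\int_{\mathbb{R}^N}\int_{B_1(x)}\frac{(v_1(x)-v_1(y))(v_2(x)-v_2(y))}{|x-y|^N}\,dy\,dx,$$ $$\langle v_1,v_2\rangle=\mathcal{E}(v_1,v_2)+\int_{\mathbb{R}^N}v_1(x)v_2(x)\ln(e+|x|^2)\,dx,\qquad\|v\|=\langle v,v\rangle^{1/2},$$ and $D^{log}(\mathbb{R}^N)=\{v\in L^2(\mathbb{R}^N):\|v\|<\infty\}$.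 *)

theory Defs
  imports "HOL-Analysis.Analysis"
begin

section \<open>Inner product spaces on a linear subspace\<close>

definition inner_product_on :: "'v::real_vector set \<Rightarrow> ('v \<Rightarrow> 'v \<Rightarrow> real) \<Rightarrow> bool" where
  "inner_product_on V ip \<longleftrightarrow>
     (\<forall>u\<in>V. \<forall>v\<in>V. ip u v = ip v u) \<and>
     (\<forall>u\<in>V. \<forall>v\<in>V. \<forall>w\<in>V. ip (u + v) w = ip u w + ip v w) \<and>
     (\<forall>c. \<forall>u\<in>V. \<forall>v\<in>V. ip (c *\<^sub>R u) v = c * ip u v) \<and>
     (\<forall>u\<in>V. 0 \<le> ip u u) \<and>
     (\<forall>u\<in>V. ip u u = 0 \<longrightarrow> u = 0)"

text \<open>The metric \<open>\<parallel>u - v\<parallel>\<close> of the inner product. The value \<open>0\<close> outside \<open>V\<close> is immaterial; it is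
  there because the locale \<^locale>\<open>Metric_space\<close> asks for symmetry and nonnegativity on the whole
  type.\<close>

definition ip_dist :: "'v::real_vector set \<Rightarrow> ('v \<Rightarrow> 'v \<Rightarrow> real) \<Rightarrow> 'v \<Rightarrow> 'v \<Rightarrow> real" where
  "ip_dist V ip u v = (if u \<in> V \<and> v \<in> V then sqrt (ip (u - v) (u - v)) else 0)"

abbreviation ip_topology :: "'v::real_vector set \<Rightarrow> ('v \<Rightarrow> 'v \<Rightarrow> real) \<Rightarrow> 'v topology" where
  "ip_topology V ip \<equiv> Metric_space.mtopology V (ip_dist V ip)"

definition hilbert_space_on :: "'v::real_vector set \<Rightarrow> ('v \<Rightarrow> 'v \<Rightarrow> real) \<Rightarrow> bool" where
  "hilbert_space_on V ip \<longleftrightarrow>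
     subspace V \<and> inner_product_on V ip \<and> Metric_space.mcomplete V (ip_dist V ip)"

text \<open>Compactness of the inclusion of \<open>V\<close>, with the norm of \<open>ip\<close>, into the ambient normed space:
  it is continuous and maps bounded sets to relatively compact sets.\<close>

definition compactly_embedded :: "'v::real_normed_vector set \<Rightarrow> ('v \<Rightarrow> 'v \<Rightarrow> real) \<Rightarrow> bool" where
  "compactly_embedded V ip \<longleftrightarrow>
     continuous_map (ip_topology V ip) euclidean (\<lambda>v. v) \<and>
     (\<forall>S. Metric_space.mbounded V (ip_dist V ip) S \<longrightarrow> compact (closure S))"

lemma Metric_space_ip_dist:
  assumes V: "subspace V" and ip: "inner_product_on V ip"
  shows "Metric_space V (ip_dist V ip)"
proof -
  have sym: "ip u v = ip v u" if "u \<in> V" "v \<in> V" for u v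
    using ip that by (auto simp: inner_product_on_def)
  have add: "ip (u + v) w = ip u w + ip v w" if "u \<in> V" "v \<in> V" "w \<in> V" for u v w
    using ip that by (auto simp: inner_product_on_def)
  have scale: "ip (c *\<^sub>R u) v = c * ip u v" if "u \<in> V" "v \<in> V" for c u v
    using ip that by (auto simp: inner_product_on_def)
  have pos: "0 \<le> ip u u" if "u \<in> V" for u
    using ip that by (auto simp: inner_product_on_def)
  have def0: "u = 0" if "u \<in> V" "ip u u = 0" for u
    using ip that by (auto simp: inner_product_on_def)
  have zero: "ip 0 u = 0" if "u \<in> V" for u
    using scale[of u u 0] that by simp
  have expand: "ip (s *\<^sub>R u + t *\<^sub>R v) (s *\<^sub>R u + t *\<^sub>R v)
      = s\<^sup>2 * ip u u + 2 * s * t * ip u v + t\<^sup>2 * ip v v" if uv: "u \<in> V" "v \<in> V" for s t u v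
  proof -
    have mem: "s *\<^sub>R u \<in> V" "t *\<^sub>R v \<in> V"
      using V uv by (auto simp: subspace_scale)
    then have mem': "s *\<^sub>R u + t *\<^sub>R v \<in> V"
      using V by (auto simp: subspace_add)
    have right: "ip w (s *\<^sub>R u + t *\<^sub>R v) = s * ip w u + t * ip w v" if "w \<in> V" for w
      using that uv mem mem' by (simp add: sym[of w] add scale)
    have "ip (s *\<^sub>R u + t *\<^sub>R v) (s *\<^sub>R u + t *\<^sub>R v)
        = s * ip u (s *\<^sub>R u + t *\<^sub>R v) + t * ip v (s *\<^sub>R u + t *\<^sub>R v)"
      using uv mem mem' by (simp add: add scale)
    also have "\<dots> = s * (s * ip u u + t * ip u v) + t * (s * ip u v + t * ip v v)"
      using uv by (simp add: right sym[of v u])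
    finally show ?thesis
      by (simp add: algebra_simps power2_eq_square)
  qed
  have cs: "ip u v \<le> sqrt (ip u u) * sqrt (ip v v)" if uv: "u \<in> V" "v \<in> V" for u v
  proof (cases "u = 0 \<or> v = 0")
    case True
    then have "ip u v = 0"
      using zero[of u] zero[of v] sym[OF uv] uv by auto
    then show ?thesis using pos uv by simp
  next
    case False
    define a b where "a = sqrt (ip u u)" and "b = sqrt (ip v v)"
    have ab: "a > 0" "b > 0" "ip u u = a\<^sup>2" "ip v v = b\<^sup>2"
      using False pos[OF uv(1)] pos[OF uv(2)] def0[OF uv(1)] def0[OF uv(2)]
      by (auto simp: a_def b_def less_le)
    have "b *\<^sub>R u + (- a) *\<^sub>R v \<in> V"
      using V uv by (intro subspace_add subspace_scale) auto
    then have "0 \<le> b\<^sup>2 * a\<^sup>2 + 2 * b * (- a) * ip u v + (- a)\<^sup>2 * b\<^sup>2"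
      using pos expand[OF uv, of b "- a"] ab by metis
    then have "(a * b) * ip u v \<le> (a * b) * (a * b)"
      by (simp add: power2_eq_square algebra_simps)
    then have "ip u v \<le> a * b"
      using ab by (simp add: mult_le_cancel_left_pos)
    then show ?thesis by (simp add: a_def b_def)
  qed
  have tri: "sqrt (ip (u + v) (u + v)) \<le> sqrt (ip u u) + sqrt (ip v v)"
    if uv: "u \<in> V" "v \<in> V" for u v
  proof (rule real_le_lsqrt)
    show "0 \<le> sqrt (ip u u) + sqrt (ip v v)" using pos uv by simp
    have "ip (u + v) (u + v) = ip u u + 2 * ip u v + ip v v"
      using expand[OF uv, of 1 1] by simp
    also have "\<dots> \<le> ip u u + 2 * (sqrt (ip u u) * sqrt (ip v v)) + ip v v"
      using cs[OF uv] by simp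
    also have "\<dots> = (sqrt (ip u u) + sqrt (ip v v))\<^sup>2"
      using pos uv by (simp add: power2_sum)
    finally show "ip (u + v) (u + v) \<le> (sqrt (ip u u) + sqrt (ip v v))\<^sup>2" .
  qed
  have minus: "ip (u - v) (u - v) = ip (v - u) (v - u)" if "u \<in> V" "v \<in> V" for u v
    using expand[OF that, of 1 "-1"] expand[OF that, of "-1" 1] by simp
  show ?thesis
  proof
    fix x y z
    show "0 \<le> ip_dist V ip x y"
      using V pos by (auto simp: ip_dist_def subspace_diff)
    show "ip_dist V ip x y = ip_dist V ip y x"
      using minus by (auto simp: ip_dist_def)
    show "(ip_dist V ip x y = 0) = (x = y)" if "x \<in> V" "y \<in> V"
      using that def0[of "x - y"] zero[of 0] V by (auto simp: ip_dist_def subspace_diff subspace_0)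
    show "ip_dist V ip x z \<le> ip_dist V ip x y + ip_dist V ip y z" if "x \<in> V" "y \<in> V" "z \<in> V"
      using tri[of "x - y" "y - z"] that V by (auto simp: ip_dist_def subspace_diff)
  qed
qed

section \<open>The space \<open>L\<^sup>2\<close>\<close>

text \<open>Representatives are taken Borel measurable: every Lebesgue measurable function agrees almost
  everywhere with a Borel one, so this gives the same space of equivalence classes.\<close>

definition sq_integrable :: "(real^'n \<Rightarrow> real) set" where
  "sq_integrable = {v \<in> borel_measurable lborel. integrable lborel (\<lambda>x. (v x)\<^sup>2)}"

definition l2_eq :: "(real^'n \<Rightarrow> real) \<Rightarrow> (real^'n \<Rightarrow> real) \<Rightarrow> bool" where
  "l2_eq v w \<longleftrightarrow> v \<in> sq_integrable \<and> w \<in> sq_integrable \<and> (AE x in lborel. v x = w x)"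

lemma l2_eqD:
  assumes "l2_eq v w"
  shows "v \<in> sq_integrable" "w \<in> sq_integrable" "AE x in lborel. v x = w x"
    "v \<in> borel_measurable lborel" "w \<in> borel_measurable lborel"
  using assms by (auto simp: l2_eq_def sq_integrable_def)

lemma zero_sq_integrable: "(\<lambda>_. 0) \<in> sq_integrable"
  by (simp add: sq_integrable_def)

lemma part_equivp_l2_eq: "part_equivp l2_eq"
proof (rule part_equivpI)
  show "\<exists>x. l2_eq x x"
    by (rule exI[of _ "\<lambda>_. 0"]) (simp add: l2_eq_def zero_sq_integrable)
  show "symp l2_eq"
    by (rule sympI) (auto simp: l2_eq_def elim: eventually_mono)
  show "transp l2_eq"
    by (rule transpI) (auto simp: l2_eq_def elim: eventually_elim2)
qed

quotient_type (overloaded) 'n l2 = "real^'n::finite \<Rightarrow> real" / partial: l2_eq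
  by (rule part_equivp_l2_eq)

lemma sq_integrable_mult:
  assumes "v \<in> sq_integrable" "w \<in> sq_integrable"
  shows "integrable lborel (\<lambda>x. v x * w x)"
proof (rule Bochner_Integration.integrable_bound)
  show "integrable lborel (\<lambda>x. (v x)\<^sup>2 + (w x)\<^sup>2)"
    using assms by (auto simp: sq_integrable_def)
  show "(\<lambda>x. v x * w x) \<in> borel_measurable lborel"
    using assms by (auto simp: sq_integrable_def)
  show "AE x in lborel. norm (v x * w x) \<le> norm ((v x)\<^sup>2 + (w x)\<^sup>2)"
  proof (rule AE_I2)
    fix x
    have "2 * (\<bar>v x\<bar> * \<bar>w x\<bar>) \<le> (v x)\<^sup>2 + (w x)\<^sup>2"
      using zero_le_power2[of "\<bar>v x\<bar> - \<bar>w x\<bar>"] by (simp add: power2_diff algebra_simps)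
    moreover have "0 \<le> \<bar>v x\<bar> * \<bar>w x\<bar>" by simp
    ultimately have "\<bar>v x\<bar> * \<bar>w x\<bar> \<le> (v x)\<^sup>2 + (w x)\<^sup>2" by linarith
    then show "norm (v x * w x) \<le> norm ((v x)\<^sup>2 + (w x)\<^sup>2)"
      by (simp add: abs_mult)
  qed
qed

lemma sq_integrable_add:
  assumes "v \<in> sq_integrable" "w \<in> sq_integrable"
  shows "(\<lambda>x. v x + w x) \<in> sq_integrable"
  using assms sq_integrable_mult[OF assms]
  by (auto simp: sq_integrable_def power2_sum mult.assoc)

lemma sq_integrable_scale:
  assumes "v \<in> sq_integrable"
  shows "(\<lambda>x. c * v x) \<in> sq_integrable"
  using assms by (auto simp: sq_integrable_def power_mult_distrib)

instantiation l2 :: (finite) real_inner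
begin

lift_definition zero_l2 :: "'a l2" is "\<lambda>_. 0"
  by (simp add: l2_eq_def zero_sq_integrable)

lift_definition plus_l2 :: "'a l2 \<Rightarrow> 'a l2 \<Rightarrow> 'a l2" is "\<lambda>v w x. v x + w x"
  by (auto simp: l2_eq_def sq_integrable_add elim: eventually_elim2)

lift_definition scaleR_l2 :: "real \<Rightarrow> 'a l2 \<Rightarrow> 'a l2" is "\<lambda>c v x. c * v x"
  by (auto simp: l2_eq_def sq_integrable_scale elim: eventually_mono)

lift_definition uminus_l2 :: "'a l2 \<Rightarrow> 'a l2" is "\<lambda>v x. - v x"
  using sq_integrable_scale[where c = "-1"]
  by (auto simp: l2_eq_def elim: eventually_mono)

definition minus_l2 :: "'a l2 \<Rightarrow> 'a l2 \<Rightarrow> 'a l2" where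
  "minus_l2 v w = v + (- w)"

lift_definition inner_l2 :: "'a l2 \<Rightarrow> 'a l2 \<Rightarrow> real" is "\<lambda>v w. \<integral>x. v x * w x \<partial>lborel"
proof -
  fix v v' w w' :: "real^'a \<Rightarrow> real"
  assume "l2_eq v v'" "l2_eq w w'"
  note l2_eqD[OF this(1), measurable] l2_eqD[OF this(2), measurable]
  then show "(\<integral>x. v x * w x \<partial>lborel) = (\<integral>x. v' x * w' x \<partial>lborel)"
    by (intro integral_cong_AE) (auto elim: eventually_elim2)
qed

definition norm_l2 :: "'a l2 \<Rightarrow> real" where
  "norm_l2 v = sqrt (inner v v)"

definition dist_l2 :: "'a l2 \<Rightarrow> 'a l2 \<Rightarrow> real" where
  "dist_l2 v w = norm (v - w)"

definition sgn_l2 :: "'a l2 \<Rightarrow> 'a l2" where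
  "sgn_l2 v = scaleR (inverse (norm v)) v"

definition uniformity_l2 :: "('a l2 \<times> 'a l2) filter" where
  "uniformity_l2 = (INF e\<in>{0<..}. principal {(x, y). dist x y < e})"

definition open_l2 :: "'a l2 set \<Rightarrow> bool" where
  "open_l2 U \<longleftrightarrow> (\<forall>x\<in>U. eventually (\<lambda>(x', y). x' = x \<longrightarrow> y \<in> U) uniformity)"

instance
proof
  fix u v w :: "'a l2" and a b :: real and U :: "'a l2 set"
  show "u + v + w = u + (v + w)"
    by transfer (auto simp: l2_eq_def sq_integrable_add add.assoc)
  show "u + v = v + u"
    by transfer (auto simp: l2_eq_def sq_integrable_add add.commute)
  show "0 + u = u"
    by transfer (auto simp: l2_eq_def)
  show "- u + u = 0"
    by transfer (auto simp: l2_eq_def zero_sq_integrable)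
  show "u - v = u + - v"
    by (rule minus_l2_def)
  show "a *\<^sub>R (u + v) = a *\<^sub>R u + a *\<^sub>R v"
    by transfer (auto simp: l2_eq_def sq_integrable_add sq_integrable_scale distrib_left)
  show "(a + b) *\<^sub>R u = a *\<^sub>R u + b *\<^sub>R u"
    by transfer (auto simp: l2_eq_def sq_integrable_add sq_integrable_scale distrib_right)
  show "a *\<^sub>R b *\<^sub>R u = (a * b) *\<^sub>R u"
    by transfer (auto simp: l2_eq_def sq_integrable_scale mult.assoc)
  show "1 *\<^sub>R u = u"
    by transfer (auto simp: l2_eq_def)
  show "dist u v = norm (u - v)"
    by (rule dist_l2_def)
  show "sgn u = scaleR (inverse (norm u)) u"
    by (rule sgn_l2_def)
  show "uniformity = (INF e\<in>{0<..}. principal {(x :: 'a l2, y). dist x y < e})"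
    by (rule uniformity_l2_def)
  show "open U \<longleftrightarrow> (\<forall>x\<in>U. eventually (\<lambda>(x', y). x' = x \<longrightarrow> y \<in> U) uniformity)"
    by (rule open_l2_def)
  show "inner u v = inner v u"
    by transfer (simp add: mult.commute)
  show "inner (u + v) w = inner u w + inner v w"
    by transfer (auto simp: l2_eq_def distrib_right sq_integrable_mult)
  show "inner (a *\<^sub>R u) v = a * inner u v"
    by transfer (simp add: mult.assoc)
  show "0 \<le> inner u u"
    by transfer simp
  show "inner u u = 0 \<longleftrightarrow> u = 0"
  proof transfer
    fix v :: "real^'a \<Rightarrow> real"
    assume "l2_eq v v"
    then have v: "v \<in> sq_integrable" by (simp add: l2_eq_def)
    then have "(\<integral>x. v x * v x \<partial>lborel) = 0 \<longleftrightarrow> (AE x in lborel. v x * v x = 0)"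
      by (intro integral_nonneg_eq_0_iff_AE sq_integrable_mult) auto
    then show "(\<integral>x. v x * v x \<partial>lborel) = 0 \<longleftrightarrow> l2_eq v (\<lambda>_. 0)"
      using v by (simp add: l2_eq_def zero_sq_integrable)
  qed
  show "norm u = sqrt (inner u u)"
    by (rule norm_l2_def)
qed

end

section \<open>Test functions\<close>

fun Ck :: "nat \<Rightarrow> (real^'n \<Rightarrow> real) \<Rightarrow> bool" where
  "Ck 0 f \<longleftrightarrow> continuous_on UNIV f"
| "Ck (Suc k) f \<longleftrightarrow>
     (\<forall>x. f differentiable (at x)) \<and> (\<forall>h. Ck k (\<lambda>x. frechet_derivative f (at x) h))"

definition Cc_infinity :: "(real^'n \<Rightarrow> real) set" where
  "Cc_infinity = {f. (\<forall>k. Ck k f) \<and> compact (closure {x. f x \<noteq> 0})}"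

section \<open>The logarithmic energy and the space \<open>D\<^sup>l\<^sup>o\<^sup>g\<close>\<close>

definition c_const :: "nat \<Rightarrow> real" where
  "c_const N = pi powr (- real N / 2) * Gamma (real N / 2)"

definition rho_const :: "nat \<Rightarrow> real" where
  "rho_const N = 2 * ln 2 + Digamma (real N / 2) - euler_mascheroni"

lemma Digamma_eq_deriv_Gamma:
  fixes x :: real
  assumes "x > 0"
  shows "Digamma x = deriv Gamma x / Gamma x"
proof -
  have x: "x \<notin> \<int>\<^sub>\<le>\<^sub>0" using assms by (auto elim!: nonpos_Ints_cases)
  have "deriv Gamma x = Gamma x * Digamma x"
    using x by (intro DERIV_imp_deriv has_field_derivative_Gamma)
  then show ?thesis using x by (simp add: Gamma_eq_zero_iff)
qed

lemma euler_mascheroni_eq_deriv_Gamma: "(euler_mascheroni :: real) = - deriv Gamma 1"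
  using Digamma_eq_deriv_Gamma[of 1] by simp

definition log_energy :: "(real^'n \<Rightarrow> real) \<Rightarrow> (real^'n \<Rightarrow> real) \<Rightarrow> real" where
  "log_energy v1 v2 = c_const CARD('n) / 2 *
     (\<integral>x. (\<integral>y\<in>ball x 1. (v1 x - v1 y) * (v2 x - v2 y) / norm (x - y) ^ CARD('n) \<partial>lborel) \<partial>lborel)"

definition log_energy_finite :: "(real^'n \<Rightarrow> real) \<Rightarrow> (real^'n \<Rightarrow> real) \<Rightarrow> bool" where
  "log_energy_finite v1 v2 \<longleftrightarrow>
     set_integrable (lborel \<Otimes>\<^sub>M lborel) {(x, y). y \<in> ball x 1}
       (\<lambda>(x, y). (v1 x - v1 y) * (v2 x - v2 y) / norm (x - y) ^ CARD('n))"

definition log_weight :: "real^'n \<Rightarrow> real" where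
  "log_weight x = ln (exp 1 + (norm x)\<^sup>2)"

definition dlog_ip :: "(real^'n \<Rightarrow> real) \<Rightarrow> (real^'n \<Rightarrow> real) \<Rightarrow> real" where
  "dlog_ip v1 v2 = log_energy v1 v2 + (\<integral>x. v1 x * v2 x * log_weight x \<partial>lborel)"

definition dlog_norm :: "(real^'n \<Rightarrow> real) \<Rightarrow> real" where
  "dlog_norm v = sqrt (dlog_ip v v)"

text \<open>\<open>\<parallel>v\<parallel>\<^sup>2\<close> with values in \<open>[0, \<infinity>]\<close>. The condition \<open>\<parallel>v\<parallel> < \<infinity>\<close> has to be stated with it, because
  Bochner integrals of non-integrable functions are \<open>0\<close>.\<close>

definition dlog_enorm2 :: "(real^'n \<Rightarrow> real) \<Rightarrow> ennreal" where
  "dlog_enorm2 v =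
     ennreal (c_const CARD('n) / 2) *
       (\<integral>\<^sup>+x. (\<integral>\<^sup>+y\<in>ball x 1. ennreal ((v x - v y)\<^sup>2 / norm (x - y) ^ CARD('n)) \<partial>lborel) \<partial>lborel)
     + (\<integral>\<^sup>+x. ennreal ((v x)\<^sup>2 * log_weight x) \<partial>lborel)"

definition dlog_fun :: "(real^'n \<Rightarrow> real) set" where
  "dlog_fun = {v \<in> sq_integrable. dlog_enorm2 v < \<infinity>}"

definition Dlog :: "'n::finite l2 set" where
  "Dlog = abs_l2 ` dlog_fun"

lemma dlog_enorm2_cong:
  assumes "AE x in lborel. v x = w x"
  shows "dlog_enorm2 v = dlog_enorm2 w"
proof -
  have "(\<integral>\<^sup>+y\<in>ball x 1. ennreal ((v x - v y)\<^sup>2 / norm (x - y) ^ CARD('a)) \<partial>lborel)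
      = (\<integral>\<^sup>+y\<in>ball x 1. ennreal ((w x - w y)\<^sup>2 / norm (x - y) ^ CARD('a)) \<partial>lborel)"
    if "v x = w x" for x
    using assms that by (intro nn_integral_cong_AE) (auto elim: eventually_mono)
  then have "(\<integral>\<^sup>+x. (\<integral>\<^sup>+y\<in>ball x 1. ennreal ((v x - v y)\<^sup>2 / norm (x - y) ^ CARD('a)) \<partial>lborel) \<partial>lborel)
      = (\<integral>\<^sup>+x. (\<integral>\<^sup>+y\<in>ball x 1. ennreal ((w x - w y)\<^sup>2 / norm (x - y) ^ CARD('a)) \<partial>lborel) \<partial>lborel)"
    using assms by (intro nn_integral_cong_AE) (auto elim: eventually_mono)
  moreover have "(\<integral>\<^sup>+x. ennreal ((v x)\<^sup>2 * log_weight x) \<partial>lborel)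
      = (\<integral>\<^sup>+x. ennreal ((w x)\<^sup>2 * log_weight x) \<partial>lborel)"
    using assms by (intro nn_integral_cong_AE) (auto elim: eventually_mono)
  ultimately show ?thesis by (simp add: dlog_enorm2_def)
qed

lemma abs_l2_in_Dlog_iff:
  assumes "v \<in> sq_integrable"
  shows "abs_l2 v \<in> Dlog \<longleftrightarrow> v \<in> dlog_fun"
proof
  assume "abs_l2 v \<in> Dlog"
  then obtain w where w: "w \<in> dlog_fun" "abs_l2 v = abs_l2 w" by (auto simp: Dlog_def)
  then have "l2_eq v w"
    using assms Quotient3_rel[OF Quotient3_l2, of v w] by (auto simp: dlog_fun_def l2_eq_def)
  then show "v \<in> dlog_fun"
    using w(1) assms dlog_enorm2_cong[of v w] by (auto simp: dlog_fun_def l2_eq_def)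
qed (auto simp: Dlog_def)

lift_definition dlog_inner :: "'n::finite l2 \<Rightarrow> 'n l2 \<Rightarrow> real" is dlog_ip
proof -
  fix v v' w w' :: "real^'n \<Rightarrow> real"
  assume eq: "l2_eq v v'" "l2_eq w w'"
  note [measurable] = l2_eqD(4,5)[OF eq(1)] l2_eqD(4,5)[OF eq(2)]
  have ae: "AE x in lborel. v x = v' x \<and> w x = w' x"
    using l2_eqD(3)[OF eq(1)] l2_eqD(3)[OF eq(2)] by auto
  have [measurable]: "Measurable.pred (lborel \<Otimes>\<^sub>M lborel) (\<lambda>z::(real^'n)\<times>(real^'n). dist (fst z) (snd z) < 1)"
    by measurable
  have meas: "(\<lambda>x. (\<integral>y\<in>ball x 1. (f x - f y) * (g x - g y) / norm (x - y) ^ CARD('n) \<partial>lborel))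
      \<in> borel_measurable lborel"
    if [measurable]: "f \<in> borel_measurable lborel" "g \<in> borel_measurable lborel"
    for f g :: "real^'n \<Rightarrow> real"
    unfolding set_lebesgue_integral_def mem_ball indicator_def by measurable
  have meas1: "(\<lambda>y. indicator (ball x 1) y *\<^sub>R ((f x - f y) * (g x - g y) / norm (x - y) ^ CARD('n)))
      \<in> borel_measurable lborel"
    if "f \<in> borel_measurable lborel" "g \<in> borel_measurable lborel"
    for f g :: "real^'n \<Rightarrow> real" and x
    using that
    by (intro borel_measurable_scaleR borel_measurable_indicator borel_measurable_divide
        borel_measurable_times borel_measurable_diff borel_measurable_const borel_measurable_power
        borel_measurable_norm) auto
  have inner: "(\<integral>y\<in>ball x 1. (v x - v y) * (w x - w y) / norm (x - y) ^ CARD('n) \<partial>lborel)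
      = (\<integral>y\<in>ball x 1. (v' x - v' y) * (w' x - w' y) / norm (x - y) ^ CARD('n) \<partial>lborel)"
    if "v x = v' x" "w x = w' x" for x
    unfolding set_lebesgue_integral_def
    using ae that by (intro integral_cong_AE meas1 l2_eqD(4,5)[OF eq(1)] l2_eqD(4,5)[OF eq(2)]) (auto elim: eventually_mono)
  have "log_energy v w = log_energy v' w'"
    unfolding log_energy_def
    using ae inner by (intro arg_cong2[of _ _ _ _ "(*)"] refl integral_cong_AE meas)
      (auto elim: eventually_mono)
  moreover have "(\<integral>x. v x * w x * log_weight x \<partial>lborel) = (\<integral>x. v' x * w' x * log_weight x \<partial>lborel)"
    using ae unfolding log_weight_def
    by (intro integral_cong_AE) (auto elim: eventually_mono)
  ultimately show "dlog_ip v w = dlog_ip v' w'"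
    by (simp add: dlog_ip_def)
qed

definition log_energy_L :: "(real^'n \<Rightarrow> real) \<Rightarrow> (real^'n \<Rightarrow> real) \<Rightarrow> real" where
  "log_energy_L v1 v2 =
     log_energy v1 v2
     - c_const CARD('n) *
         (\<integral>z\<in>{(x, y). norm (x - y) \<ge> 1}.
            (case z of (x, y) \<Rightarrow> v1 x * v2 y / norm (x - y) ^ CARD('n)) \<partial>(lborel \<Otimes>\<^sub>M lborel))
     + rho_const CARD('n) * (\<integral>x. v1 x * v2 x \<partial>lborel)"

end

theory Submission
  imports Defs "HOL-Complex_Analysis.Great_Picard"
begin

text \<open>
  Substituting \<open>y = x + z\<close>, the energy of \<open>v\<close> is the integral over \<open>\<bar>z\<bar> < 1\<close> of
  \<open>\<bar>z\<bar>\<^sup>-\<^sup>N\<close> times the squared \<open>L\<^sup>2\<close> norm of \<open>v(x + z) - v(x)\<close>. As \<open>\<bar>z\<bar>\<^sup>-\<^sup>N\<close> is not integrable at \<open>0\<close>,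
  there are smooth mollifiers \<open>j\<^sub>m\<close> with \<open>j\<^sub>m(z) \<le> (A/m) \<bar>z\<bar>\<^sup>-\<^sup>N\<close> on the unit ball, and Jensen's inequality
  bounds the squared \<open>L\<^sup>2\<close> distance from \<open>v\<close> to its mollification by \<open>A/m\<close> times the energy.

  On a bounded set of \<open>D\<^sup>l\<^sup>o\<^sup>g\<close> this approximation is uniform, the mollified functions are
  equicontinuous, and the logarithmic weight makes the tails uniformly small; Arzela--Ascoli then
  gives compactness in \<open>L\<^sup>2\<close>. Density follows by cutting off and mollifying, with
  dominated convergence in \<open>z\<close>. Completeness is Fatou's lemma along an almost everywhere convergent
  subsequence. The term over \<open>\<bar>x - y\<bar> \<ge> 1\<close> is treated by weighted arithmetic-geometric means, with
  weights depending on how \<open>\<bar>x\<bar>\<^sup>2\<close> and \<open>\<bar>y\<bar>\<^sup>2\<close> compare with \<open>\<bar>x - y\<bar>\<close>; scaling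
  \<open>(v\<^sub>1, v\<^sub>2)\<close> to \<open>(s v\<^sub>1, v\<^sub>2 / s)\<close> turns the resulting bound by \<open>\<parallel>v\<^sub>1\<parallel>\<^sup>2 + \<parallel>v\<^sub>2\<parallel>\<^sup>2\<close> into one by \<open>\<parallel>v\<^sub>1\<parallel> \<parallel>v\<^sub>2\<parallel>\<close>.
\<close>

section \<open>Quadratic functionals\<close>

text \<open>The functionals are squared and take values in [0, \<infinity>], so subadditivity with
  the constant 2 stands in for the triangle inequality; finiteness, boundedness and convergence to 0
  survive this loss. Near 0 the kernel fails to be integrable only logarithmically. A single
  rescaled bump of unit mass is comparable with it by a constant that does not depend on the scale,
  so a small constant can come only from averaging over many scales. The far term has the same
  defect at infinity: |z|^(-N) is not integrable there, and Young's inequality gives no bound in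
  L^2. Its integral over 1 \<le> |z| \<le> |x|^2, however, is of order log |x| for large |x|, which
  the weight pays for. Beyond that radius the two factors of the mean inequality carry powers of r
  whose exponents add up to 2N. The one used as decay in r must exceed N, so the other is less than
  N; comparing r with |x|^2, and not with |x|, doubles it and makes it integrable in x.\<close>

definition sing_kernel :: "real^'n \<Rightarrow> real" where
  "sing_kernel z = indicator (ball 0 1) z / norm z ^ CARD('n)"

definition shift_sq :: "(real^'n \<Rightarrow> real) \<Rightarrow> real^'n \<Rightarrow> ennreal" where
  "shift_sq v z = (\<integral>\<^sup>+x. ennreal ((v (x + z) - v x)\<^sup>2) \<partial>lborel)"

definition gagliardo :: "(real^'n \<Rightarrow> real) \<Rightarrow> ennreal" where
  "gagliardo v = (\<integral>\<^sup>+z. ennreal (sing_kernel z) * shift_sq v z \<partial>lborel)"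

definition weight_sq :: "(real^'n \<Rightarrow> real) \<Rightarrow> ennreal" where
  "weight_sq v = (\<integral>\<^sup>+x. ennreal ((v x)\<^sup>2 * log_weight x) \<partial>lborel)"

definition l2_sq :: "(real^'n \<Rightarrow> real) \<Rightarrow> ennreal" where
  "l2_sq v = (\<integral>\<^sup>+x. ennreal ((v x)\<^sup>2) \<partial>lborel)"

lemma sing_kernel_nonneg [simp]: "0 \<le> sing_kernel z"
  by (simp add: sing_kernel_def)

lemma sing_kernel_minus: "sing_kernel (- z) = sing_kernel z"
  by (simp add: sing_kernel_def indicator_def)

lemma sing_kernel_measurable [measurable]: "sing_kernel \<in> borel_measurable borel"
proof -
  have "(\<lambda>z::real^'n. indicator (ball 0 1) z / norm z ^ CARD('n)) \<in> borel_measurable borel"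
    by (intro borel_measurable_divide borel_measurable_indicator borel_measurable_power
        borel_measurable_norm) auto
  then show ?thesis by (simp add: sing_kernel_def[abs_def])
qed

lemma log_weight_measurable [measurable]: "log_weight \<in> borel_measurable borel"
  unfolding log_weight_def[abs_def] by measurable

lemma ln_exp_1_plus_sq_ge_1: "1 \<le> ln (exp 1 + r\<^sup>2)" for r :: real
proof -
  have "ln (exp 1) \<le> ln (exp 1 + r\<^sup>2)"
    by (subst ln_le_cancel_iff) (auto intro: add_pos_nonneg)
  then show ?thesis by simp
qed

lemma log_weight_ge_1: "1 \<le> log_weight x"
  unfolding log_weight_def by (rule ln_exp_1_plus_sq_ge_1)

lemma abs_le_1_plus_sq: "\<bar>a\<bar> \<le> 1 + a\<^sup>2" for a :: real
proof -
  have "0 \<le> (\<bar>a\<bar> - 1)\<^sup>2" by simp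
  then show ?thesis
    using zero_le_power2[of a] by (simp add: power2_diff)
qed

lemma log_weight_nonneg [simp]: "0 \<le> log_weight x"
  using log_weight_ge_1[of x] by simp


lemma nn_integral_lborel_shift:
  fixes f :: "'a::euclidean_space \<Rightarrow> ennreal"
  assumes [measurable]: "f \<in> borel_measurable borel"
  shows "(\<integral>\<^sup>+y. f (c + y) \<partial>lborel) = (\<integral>\<^sup>+y. f y \<partial>lborel)"
  by (subst (2) lborel_distr_plus[of c, symmetric]) (simp add: nn_integral_distr)


lemma shift_sq_measurable [measurable]:
  assumes [measurable]: "v \<in> borel_measurable borel"
  shows "shift_sq v \<in> borel_measurable borel"
  unfolding shift_sq_def[abs_def] by measurable

lemma gagliardo_eq:
  fixes v :: "real^'n \<Rightarrow> real"
  assumes [measurable]: "v \<in> borel_measurable borel"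
  shows "gagliardo v = (\<integral>\<^sup>+x. (\<integral>\<^sup>+y. ennreal (sing_kernel (x - y) * (v x - v y)\<^sup>2) \<partial>lborel) \<partial>lborel)"
proof -
  have "(\<integral>\<^sup>+x. (\<integral>\<^sup>+y. ennreal (sing_kernel (x - y) * (v x - v y)\<^sup>2) \<partial>lborel) \<partial>lborel)
     = (\<integral>\<^sup>+x. (\<integral>\<^sup>+z. ennreal (sing_kernel (x - (x + z)) * (v x - v (x + z))\<^sup>2) \<partial>lborel) \<partial>lborel)"
    by (intro nn_integral_cong nn_integral_lborel_shift[symmetric]) measurable
  also have "\<dots> = (\<integral>\<^sup>+x. (\<integral>\<^sup>+z. ennreal (sing_kernel z) * ennreal ((v (x + z) - v x)\<^sup>2) \<partial>lborel) \<partial>lborel)"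
    by (intro nn_integral_cong) (simp add: sing_kernel_minus ennreal_mult power2_commute)
  also have "\<dots> = (\<integral>\<^sup>+z. (\<integral>\<^sup>+x. ennreal (sing_kernel z) * ennreal ((v (x + z) - v x)\<^sup>2) \<partial>lborel) \<partial>lborel)"
    by (rule lborel_pair.Fubini') measurable
  also have "\<dots> = gagliardo v"
    unfolding gagliardo_def shift_sq_def
    by (intro nn_integral_cong nn_integral_cmult) measurable
  finally show ?thesis by simp
qed

text \<open>The pair form puts the energy on a single measure space, as Fatou's lemma and the
  integrability of products require.\<close>

lemma gagliardo_eq_pair:
  fixes v :: "real^'n \<Rightarrow> real"
  assumes [measurable]: "v \<in> borel_measurable borel"
  shows "gagliardo v = (\<integral>\<^sup>+p. ennreal (sing_kernel (fst p - snd p) * (v (fst p) - v (snd p))\<^sup>2) \<partial>(lborel \<Otimes>\<^sub>M lborel))"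
  unfolding gagliardo_eq[OF assms]
  by (subst lborel.nn_integral_fst[symmetric]) auto

lemma ball_kernel_eq:
  fixes x y :: "real^'n"
  shows "indicator (ball x 1) y * (a / norm (x - y) ^ CARD('n)) = sing_kernel (x - y) * a"
  by (auto simp: sing_kernel_def indicator_def dist_norm norm_minus_commute)

lemma dlog_enorm2_eq:
  fixes v :: "real^'n \<Rightarrow> real"
  assumes [measurable]: "v \<in> borel_measurable borel"
  shows "dlog_enorm2 v = ennreal (c_const CARD('n) / 2) * gagliardo v + weight_sq v"
proof -
  have "ennreal ((v x - v y)\<^sup>2 / norm (x - y) ^ CARD('n)) * indicator (ball x 1) y
     = ennreal (sing_kernel (x - y) * (v x - v y)\<^sup>2)" for x y
    by (subst ball_kernel_eq[symmetric]) (simp add: indicator_def)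
  then show ?thesis
    by (simp add: dlog_enorm2_def gagliardo_eq weight_sq_def)
qed

lemma c_const_pos: "0 < N \<Longrightarrow> 0 < c_const N"
  by (simp add: c_const_def Gamma_real_pos)

lemma l2_sq_le_weight_sq: "l2_sq v \<le> weight_sq v"
  unfolding l2_sq_def weight_sq_def
  using log_weight_ge_1 by (intro nn_integral_mono ennreal_leI) (auto simp: mult_le_cancel_left1)

lemma l2_sq_le_dlog_enorm2: "v \<in> borel_measurable borel \<Longrightarrow> l2_sq v \<le> dlog_enorm2 v"
  using l2_sq_le_weight_sq[of v] by (simp add: dlog_enorm2_eq add_increasing)

lemma sq_integrable_iff:
  "v \<in> sq_integrable \<longleftrightarrow> v \<in> borel_measurable borel \<and> l2_sq v < \<infinity>"
  by (auto simp: sq_integrable_def l2_sq_def integrable_iff_bounded)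

text \<open>Since c_N/2 is positive and finite, finiteness of the sum splits into finiteness of both
  terms; square integrability is implied because \<open>log_weight\<close> is at least 1.\<close>

lemma dlog_fun_iff:
  fixes v :: "real^'n \<Rightarrow> real"
  shows "v \<in> dlog_fun \<longleftrightarrow> v \<in> borel_measurable borel \<and> gagliardo v < \<infinity> \<and> weight_sq v < \<infinity>"
proof -
  have c: "ennreal (c_const CARD('n) / 2) \<noteq> 0" "ennreal (c_const CARD('n) / 2) < top"
    using c_const_pos[of "CARD('n)"] by auto
  show ?thesis
    using l2_sq_le_weight_sq[of v] c
    by (auto simp: dlog_fun_def sq_integrable_iff dlog_enorm2_eq ennreal_mult_less_top less_top[symmetric] ennreal_mult_eq_top_iff top_unique)
qed

lemma sq_sum_le: "((a::real) + b)\<^sup>2 \<le> 2 * a\<^sup>2 + 2 * b\<^sup>2"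
  using zero_le_power2[of "a - b"] by (simp add: power2_eq_square algebra_simps)

text \<open>The inequality (a + b)^2 \<le> 2 a^2 + 2 b^2, integrated once for all the functionals:
  \<open>g\<close> is 1 for \<open>shift_sq\<close> and \<open>l2_sq\<close>, and
  \<open>log_weight\<close> for \<open>weight_sq\<close>.\<close>

lemma nn_integral_sq_add_le:
  fixes u v g :: "'a \<Rightarrow> real"
  assumes [measurable]: "u \<in> borel_measurable M" "v \<in> borel_measurable M" "g \<in> borel_measurable M"
    and g: "\<And>x. 0 \<le> g x"
  shows "(\<integral>\<^sup>+x. ennreal ((u x + v x)\<^sup>2 * g x) \<partial>M) \<le> 2 * (\<integral>\<^sup>+x. ennreal ((u x)\<^sup>2 * g x) \<partial>M) + 2 * (\<integral>\<^sup>+x. ennreal ((v x)\<^sup>2 * g x) \<partial>M)"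
proof -
  have "(\<integral>\<^sup>+x. ennreal ((u x + v x)\<^sup>2 * g x) \<partial>M)
      \<le> (\<integral>\<^sup>+x. 2 * ennreal ((u x)\<^sup>2 * g x) + 2 * ennreal ((v x)\<^sup>2 * g x) \<partial>M)"
  proof (rule nn_integral_mono)
    fix x
    have "(u x + v x)\<^sup>2 * g x \<le> 2 * ((u x)\<^sup>2 * g x) + 2 * ((v x)\<^sup>2 * g x)"
      using mult_right_mono[OF sq_sum_le[of "u x" "v x"] g[of x]] by (simp add: algebra_simps)
    then have "ennreal ((u x + v x)\<^sup>2 * g x) \<le> ennreal (2 * ((u x)\<^sup>2 * g x) + 2 * ((v x)\<^sup>2 * g x))"
      by (rule ennreal_leI)
    then show "ennreal ((u x + v x)\<^sup>2 * g x) \<le> 2 * ennreal ((u x)\<^sup>2 * g x) + 2 * ennreal ((v x)\<^sup>2 * g x)"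
      using g[of x] by (simp add: ennreal_mult)
  qed
  also have "\<dots> = 2 * (\<integral>\<^sup>+x. ennreal ((u x)\<^sup>2 * g x) \<partial>M) + 2 * (\<integral>\<^sup>+x. ennreal ((v x)\<^sup>2 * g x) \<partial>M)"
    by (simp add: nn_integral_add nn_integral_cmult)
  finally show ?thesis .
qed

lemma shift_sq_add_le:
  assumes [measurable]: "u \<in> borel_measurable borel" "v \<in> borel_measurable borel"
  shows "shift_sq (\<lambda>x. u x + v x) z \<le> 2 * shift_sq u z + 2 * shift_sq v z"
  using nn_integral_sq_add_le[of "\<lambda>x. u (x + z) - u x" lborel "\<lambda>x. v (x + z) - v x" "\<lambda>_. 1"]
  by (simp add: shift_sq_def add_diff_add)

lemma gagliardo_add_le:
  assumes [measurable]: "u \<in> borel_measurable borel" "v \<in> borel_measurable borel"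
  shows "gagliardo (\<lambda>x. u x + v x) \<le> 2 * gagliardo u + 2 * gagliardo v"
proof -
  have "gagliardo (\<lambda>x. u x + v x) \<le> (\<integral>\<^sup>+z. ennreal (sing_kernel z) * (2 * shift_sq u z + 2 * shift_sq v z) \<partial>lborel)"
    unfolding gagliardo_def by (intro nn_integral_mono mult_left_mono shift_sq_add_le) auto
  also have "\<dots> = (\<integral>\<^sup>+z. 2 * (ennreal (sing_kernel z) * shift_sq u z) + 2 * (ennreal (sing_kernel z) * shift_sq v z) \<partial>lborel)"
    by (intro nn_integral_cong) (simp add: algebra_simps)
  also have "\<dots> = 2 * gagliardo u + 2 * gagliardo v"
    by (simp add: gagliardo_def nn_integral_add nn_integral_cmult)
  finally show ?thesis .
qed

lemma weight_sq_add_le: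
  assumes [measurable]: "u \<in> borel_measurable borel" "v \<in> borel_measurable borel"
  shows "weight_sq (\<lambda>x. u x + v x) \<le> 2 * weight_sq u + 2 * weight_sq v"
  unfolding weight_sq_def
  by (intro nn_integral_sq_add_le) auto

lemma l2_sq_add_le:
  assumes [measurable]: "u \<in> borel_measurable borel" "v \<in> borel_measurable borel"
  shows "l2_sq (\<lambda>x. u x + v x) \<le> 2 * l2_sq u + 2 * l2_sq v"
  using nn_integral_sq_add_le[of u lborel v "\<lambda>_. 1"] by (simp add: l2_sq_def)

lemma dlog_enorm2_add_le:
  assumes [measurable]: "u \<in> borel_measurable borel" "v \<in> borel_measurable borel"
  shows "dlog_enorm2 (\<lambda>x. u x + v x) \<le> 2 * dlog_enorm2 u + 2 * dlog_enorm2 v"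
proof -
  let ?c = "ennreal (c_const CARD('a) / 2)"
  have "dlog_enorm2 (\<lambda>x. u x + v x) \<le> ?c * (2 * gagliardo u + 2 * gagliardo v) + (2 * weight_sq u + 2 * weight_sq v)"
    unfolding dlog_enorm2_eq[OF borel_measurable_add[OF assms]]
    by (intro add_mono mult_left_mono gagliardo_add_le weight_sq_add_le) auto
  then show ?thesis by (simp add: dlog_enorm2_eq algebra_simps)
qed

lemma gagliardo_scale:
  assumes [measurable]: "v \<in> borel_measurable borel"
  shows "gagliardo (\<lambda>x. c * v x) = ennreal (c\<^sup>2) * gagliardo v"
proof -
  have "shift_sq (\<lambda>x. c * v x) z = ennreal (c\<^sup>2) * shift_sq v z" for z
    unfolding shift_sq_def
    by (subst nn_integral_cmult[symmetric])
      (auto simp: ennreal_mult[symmetric] power_mult_distrib[symmetric] right_diff_distrib)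
  then show ?thesis
    unfolding gagliardo_def
    by (subst nn_integral_cmult[symmetric]) (auto simp: algebra_simps)
qed

lemma weight_sq_scale:
  assumes [measurable]: "v \<in> borel_measurable borel"
  shows "weight_sq (\<lambda>x. c * v x) = ennreal (c\<^sup>2) * weight_sq v"
  unfolding weight_sq_def
  by (subst nn_integral_cmult[symmetric])
    (auto simp: ennreal_mult'[symmetric] power_mult_distrib algebra_simps)

lemma dlog_fun_add: "u \<in> dlog_fun \<Longrightarrow> v \<in> dlog_fun \<Longrightarrow> (\<lambda>x. u x + v x) \<in> dlog_fun"
  using gagliardo_add_le[of u v] weight_sq_add_le[of u v]
  by (auto simp: dlog_fun_iff ennreal_mult_less_top elim!: order.strict_trans1)

lemma dlog_fun_scale: "v \<in> dlog_fun \<Longrightarrow> (\<lambda>x. c * v x) \<in> dlog_fun"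
  by (auto simp: dlog_fun_iff gagliardo_scale weight_sq_scale ennreal_mult_less_top)

lemma dlog_fun_diff: "u \<in> dlog_fun \<Longrightarrow> v \<in> dlog_fun \<Longrightarrow> (\<lambda>x. u x - v x) \<in> dlog_fun"
  using dlog_fun_add[of u "\<lambda>x. (-1) * v x"] dlog_fun_scale[of v "-1"] by simp

lemma dlog_fun_zero: "(\<lambda>_. 0) \<in> dlog_fun"
  by (auto simp: dlog_fun_iff gagliardo_def shift_sq_def weight_sq_def)

section \<open>The inner product\<close>

text \<open>With \<open>kernel_pair\<close> as weight, the energy form is the integral of weight
  times f times g over the product space. The logarithmic term has the same shape, so
  \<open>integrable_weighted_prod\<close> serves both.\<close>

definition diff_pair :: "(real^'n \<Rightarrow> real) \<Rightarrow> (real^'n) \<times> (real^'n) \<Rightarrow> real" where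
  "diff_pair v p = v (fst p) - v (snd p)"

definition kernel_pair :: "(real^'n) \<times> (real^'n) \<Rightarrow> real" where
  "kernel_pair p = sing_kernel (fst p - snd p)"

lemma kernel_pair_nonneg [simp]: "0 \<le> kernel_pair p"
  by (simp add: kernel_pair_def)

lemma kernel_pair_measurable [measurable]: "kernel_pair \<in> borel_measurable (lborel \<Otimes>\<^sub>M lborel)"
  unfolding kernel_pair_def[abs_def] by measurable

lemma diff_pair_measurable [measurable]:
  assumes [measurable]: "v \<in> borel_measurable borel"
  shows "diff_pair v \<in> borel_measurable (lborel \<Otimes>\<^sub>M lborel)"
  unfolding diff_pair_def[abs_def] by measurable

text \<open>Pointwise |f g| \<le> (f^2 + g^2)/2. Bounds by sums of squares are carried along; the
  bound by a product of norms is recovered once, at the end, through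
  \<open>scaling_bound\<close>.\<close>

lemma integrable_weighted_prod:
  fixes f g w :: "'a \<Rightarrow> real"
  assumes [measurable]: "f \<in> borel_measurable M" "g \<in> borel_measurable M" "w \<in> borel_measurable M"
    and w: "\<And>x. 0 \<le> w x"
    and f: "(\<integral>\<^sup>+x. ennreal (w x * (f x)\<^sup>2) \<partial>M) < \<infinity>"
    and g: "(\<integral>\<^sup>+x. ennreal (w x * (g x)\<^sup>2) \<partial>M) < \<infinity>"
  shows "integrable M (\<lambda>x. w x * (f x * g x))"
    and "\<bar>\<integral>x. w x * (f x * g x) \<partial>M\<bar> \<le> (\<integral>x. w x * (f x)\<^sup>2 \<partial>M) / 2 + (\<integral>x. w x * (g x)\<^sup>2 \<partial>M) / 2"
proof -
  have int: "integrable M (\<lambda>x. w x * (f x)\<^sup>2)" "integrable M (\<lambda>x. w x * (g x)\<^sup>2)"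
    using f g w by (auto simp: integrable_iff_bounded)
  have le: "\<bar>w x * (f x * g x)\<bar> \<le> w x * (f x)\<^sup>2 / 2 + w x * (g x)\<^sup>2 / 2" for x
  proof -
    have "\<bar>f x * g x\<bar> \<le> (f x)\<^sup>2 / 2 + (g x)\<^sup>2 / 2"
      using zero_le_power2[of "\<bar>f x\<bar> - \<bar>g x\<bar>"] by (simp add: power2_diff abs_mult)
    from mult_left_mono[OF this w[of x]] show ?thesis
      using w[of x] by (simp add: abs_mult algebra_simps)
  qed
  have int': "integrable M (\<lambda>x. w x * (f x)\<^sup>2 / 2 + w x * (g x)\<^sup>2 / 2)"
    using int by auto
  show fg: "integrable M (\<lambda>x. w x * (f x * g x))"
  proof (rule Bochner_Integration.integrable_bound[OF int'])
    show "AE x in M. norm (w x * (f x * g x)) \<le> norm (w x * (f x)\<^sup>2 / 2 + w x * (g x)\<^sup>2 / 2)"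
    proof (rule AE_I2)
      fix x
      have "norm (w x * (f x * g x)) \<le> w x * (f x)\<^sup>2 / 2 + w x * (g x)\<^sup>2 / 2"
        using le[of x] by simp
      also have "\<dots> \<le> norm (w x * (f x)\<^sup>2 / 2 + w x * (g x)\<^sup>2 / 2)"
        by simp
      finally show "norm (w x * (f x * g x)) \<le> norm (w x * (f x)\<^sup>2 / 2 + w x * (g x)\<^sup>2 / 2)" .
    qed
  qed measurable
  have "\<bar>\<integral>x. w x * (f x * g x) \<partial>M\<bar> \<le> (\<integral>x. \<bar>w x * (f x * g x)\<bar> \<partial>M)"
    using integral_norm_bound[of M "\<lambda>x. w x * (f x * g x)"] by simp
  also have "\<dots> \<le> (\<integral>x. w x * (f x)\<^sup>2 / 2 + w x * (g x)\<^sup>2 / 2 \<partial>M)"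
    using fg int' le by (intro integral_mono) auto
  finally show "\<bar>\<integral>x. w x * (f x * g x) \<partial>M\<bar> \<le> (\<integral>x. w x * (f x)\<^sup>2 \<partial>M) / 2 + (\<integral>x. w x * (g x)\<^sup>2 \<partial>M) / 2"
    using int by simp
qed

context
  fixes u v :: "real^'n \<Rightarrow> real"
  assumes u: "u \<in> dlog_fun" and v: "v \<in> dlog_fun"
begin

lemma energy_integrable:
  "integrable (lborel \<Otimes>\<^sub>M lborel) (\<lambda>p. kernel_pair p * (diff_pair u p * diff_pair v p))"
  using u v by (intro integrable_weighted_prod)
    (auto simp: dlog_fun_iff gagliardo_eq_pair kernel_pair_def diff_pair_def)

lemma weight_integrable: "integrable lborel (\<lambda>x. log_weight x * (u x * v x))"
  using u v by (intro integrable_weighted_prod) (auto simp: dlog_fun_iff weight_sq_def mult.commute)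

lemma weight_integrable': "integrable lborel (\<lambda>x. u x * v x * log_weight x)"
  using weight_integrable by (simp add: mult.commute)

lemma log_energy_finite: "log_energy_finite u v"
proof -
  have "indicator {(x, y). y \<in> ball x 1} p *\<^sub>R
      (case p of (x, y) \<Rightarrow> (u x - u y) * (v x - v y) / norm (x - y) ^ CARD('n))
    = kernel_pair p * (diff_pair u p * diff_pair v p)" for p
    by (auto simp: kernel_pair_def diff_pair_def sing_kernel_def indicator_def dist_norm
        norm_minus_commute split: prod.splits)
  then show ?thesis
    using energy_integrable by (simp add: log_energy_finite_def set_integrable_def)
qed

text \<open>The definition is an iterated Bochner integral; Fubini identifies it with the integral
  over pairs because \<open>energy_integrable\<close> gives absolute integrability there.\<close>

lemma log_energy_eq:
  "log_energy u v = c_const CARD('n) / 2 *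
     (\<integral>p. kernel_pair p * (diff_pair u p * diff_pair v p) \<partial>(lborel \<Otimes>\<^sub>M lborel))"
proof -
  have "(\<integral>y\<in>ball x 1. (u x - u y) * (v x - v y) / norm (x - y) ^ CARD('n) \<partial>lborel)
      = (\<integral>y. kernel_pair (x, y) * (diff_pair u (x, y) * diff_pair v (x, y)) \<partial>lborel)" for x
    unfolding set_lebesgue_integral_def kernel_pair_def diff_pair_def real_scaleR_def ball_kernel_eq
    by simp
  then have "(\<integral>x. (\<integral>y\<in>ball x 1. (u x - u y) * (v x - v y) / norm (x - y) ^ CARD('n) \<partial>lborel) \<partial>lborel)
    = (\<integral>p. kernel_pair p * (diff_pair u p * diff_pair v p) \<partial>(lborel \<Otimes>\<^sub>M lborel))"
    using lborel_pair.integral_fst'[OF energy_integrable] by simp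
  then show ?thesis
    by (simp add: log_energy_def)
qed

lemma dlog_ip_eq:
  "dlog_ip u v = c_const CARD('n) / 2 *
     (\<integral>p. kernel_pair p * (diff_pair u p * diff_pair v p) \<partial>(lborel \<Otimes>\<^sub>M lborel))
     + (\<integral>x. log_weight x * (u x * v x) \<partial>lborel)"
proof -
  have "(\<integral>x. u x * v x * log_weight x \<partial>lborel) = (\<integral>x. log_weight x * (u x * v x) \<partial>lborel)"
    by (intro Bochner_Integration.integral_cong) auto
  then show ?thesis by (simp add: dlog_ip_def log_energy_eq)
qed

lemma dlog_ip_commute: "dlog_ip u v = dlog_ip v u"
  unfolding dlog_ip_def log_energy_def by (simp add: mult.commute)

end

lemma c_const_card_pos [simp]: "0 < c_const CARD('n::finite)"
  by (rule c_const_pos) simp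

lemma diff_pair_add: "diff_pair (\<lambda>x. u x + v x) p = diff_pair u p + diff_pair v p"
  by (simp add: diff_pair_def)


lemma dlog_ip_add:
  assumes "u \<in> dlog_fun" "v \<in> dlog_fun" "w \<in> dlog_fun"
  shows "dlog_ip (\<lambda>x. u x + v x) w = dlog_ip u w + dlog_ip v w"
proof -
  have 1: "(\<integral>p. kernel_pair p * (diff_pair (\<lambda>x. u x + v x) p * diff_pair w p) \<partial>(lborel \<Otimes>\<^sub>M lborel))
    = (\<integral>p. kernel_pair p * (diff_pair u p * diff_pair w p) \<partial>(lborel \<Otimes>\<^sub>M lborel))
    + (\<integral>p. kernel_pair p * (diff_pair v p * diff_pair w p) \<partial>(lborel \<Otimes>\<^sub>M lborel))"
    by (subst Bochner_Integration.integral_add[symmetric])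
      (use assms in \<open>auto simp: energy_integrable diff_pair_add algebra_simps\<close>)
  have 2: "(\<integral>x. log_weight x * ((u x + v x) * w x) \<partial>lborel)
    = (\<integral>x. log_weight x * (u x * w x) \<partial>lborel) + (\<integral>x. log_weight x * (v x * w x) \<partial>lborel)"
    by (subst Bochner_Integration.integral_add[symmetric])
      (use assms in \<open>auto simp: weight_integrable algebra_simps\<close>)
  show ?thesis
    unfolding dlog_ip_eq[OF dlog_fun_add[OF assms(1,2)] assms(3)] dlog_ip_eq[OF assms(1,3)]
      dlog_ip_eq[OF assms(2,3)] 1 2
    by (simp only: distrib_left add.assoc add.left_commute add.commute)
qed

text \<open>A constant passes through Bochner integrals even where the integrand is not integrable
  and the integral is 0.\<close>

lemma dlog_ip_scale:
  fixes u v :: "real^'n \<Rightarrow> real"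
  shows "dlog_ip (\<lambda>x. c * u x) v = c * dlog_ip u v"
proof -
  have "indicator (ball x 1) y *\<^sub>R ((c * u x - c * u y) * (v x - v y) / norm (x - y) ^ CARD('n))
    = c * (indicator (ball x 1) y *\<^sub>R ((u x - u y) * (v x - v y) / norm (x - y) ^ CARD('n)))" for x y
    unfolding right_diff_distrib[symmetric] by simp
  then have 1: "log_energy (\<lambda>x. c * u x) v = c * log_energy u v"
    unfolding log_energy_def set_lebesgue_integral_def
    by (simp only: integral_mult_right_zero mult.left_commute)
  show ?thesis
    by (simp add: dlog_ip_def 1 mult.assoc distrib_left)
qed

text \<open>Connects the [0, \<infinity>]-valued quantity with the inner product given by Bochner
  integrals. Estimates are carried out on \<open>dlog_enorm2\<close> and read back in the
  metric.\<close>

lemma dlog_enorm2_eq_ip: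
  fixes v :: "real^'n \<Rightarrow> real"
  assumes v: "v \<in> dlog_fun"
  shows "dlog_enorm2 v = ennreal (dlog_ip v v)" "0 \<le> dlog_ip v v"
proof -
  have [measurable]: "v \<in> borel_measurable borel"
    using v by (auto simp: dlog_fun_iff)
  let ?E = "(\<integral>p. kernel_pair p * (diff_pair v p * diff_pair v p) \<partial>(lborel \<Otimes>\<^sub>M lborel))"
  let ?W = "(\<integral>x. log_weight x * (v x * v x) \<partial>lborel)"
  have nn: "0 \<le> ?E" "0 \<le> ?W"
    by (intro Bochner_Integration.integral_nonneg mult_nonneg_nonneg zero_le_square; simp)+
  have "gagliardo v = (\<integral>\<^sup>+p. ennreal (kernel_pair p * (diff_pair v p * diff_pair v p)) \<partial>(lborel \<Otimes>\<^sub>M lborel))"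
    by (simp add: gagliardo_eq_pair kernel_pair_def diff_pair_def power2_eq_square)
  also have "\<dots> = ennreal ?E"
    by (intro nn_integral_eq_integral energy_integrable v) auto
  finally have 1: "gagliardo v = ennreal ?E" .
  have "weight_sq v = (\<integral>\<^sup>+x. ennreal (log_weight x * (v x * v x)) \<partial>lborel)"
    by (simp add: weight_sq_def power2_eq_square mult.commute)
  also have "\<dots> = ennreal ?W"
    by (intro nn_integral_eq_integral weight_integrable v) auto
  finally have 2: "weight_sq v = ennreal ?W" .
  have c: "0 \<le> c_const CARD('n) / 2" using c_const_card_pos[where 'n='n] by linarith
  have ip: "dlog_ip v v = c_const CARD('n) / 2 * ?E + ?W"
    by (simp add: dlog_ip_eq v)
  show "dlog_enorm2 v = ennreal (dlog_ip v v)"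
    unfolding dlog_enorm2_eq[OF \<open>v \<in> borel_measurable borel\<close>] 1 2 ip
    using nn c by (simp add: ennreal_mult[symmetric])
  show "0 \<le> dlog_ip v v"
    unfolding ip using nn c by simp
qed

section \<open>Lower semicontinuity under almost everywhere convergence\<close>

lemma liminf_ennreal_mult_left:
  fixes f :: "nat \<Rightarrow> ennreal"
  assumes "c \<noteq> top"
  shows "c * liminf f = liminf (\<lambda>n. c * f n)"
  using assms
  by (intro Liminf_compose_continuous_mono[symmetric] ennreal_continuous_on_cmult continuous_on_id)
    (auto simp: mono_def mult_left_mono less_top)

lemma liminf_add_ennreal_le:
  fixes f g :: "nat \<Rightarrow> ennreal"
  shows "liminf f + liminf g \<le> liminf (\<lambda>n. f n + g n)"
proof -
  have "liminf f + liminf g = (SUP n. INF m\<in>{n..}. f m) + (SUP n. INF m\<in>{n..}. g m)"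
    by (simp add: liminf_SUP_INF)
  also have "\<dots> = (SUP n. (INF m\<in>{n..}. f m) + (INF m\<in>{n..}. g m))"
    by (intro ennreal_SUP_add[symmetric]) (auto simp: incseq_def intro!: INF_superset_mono)
  also have "\<dots> \<le> (SUP n. INF m\<in>{n..}. f m + g m)"
    by (intro SUP_mono' INF_greatest add_mono INF_lower)
  finally show ?thesis by (simp add: liminf_SUP_INF)
qed

text \<open>The exceptional pairs lie in N \<times> UNIV or UNIV \<times> N, both null because 0 *
  \<infinity> = 0 in \<open>ennreal\<close>. This carries almost everywhere convergence of functions
  over to \<open>diff_pair\<close>.\<close>

lemma AE_lborel_pair:
  fixes P :: "'a::euclidean_space \<Rightarrow> bool"
  assumes "AE x in lborel. P x"
  shows "AE p in (lborel :: 'a measure) \<Otimes>\<^sub>M (lborel :: 'a measure). P (fst p) \<and> P (snd p)"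
proof -
  obtain N where N: "N \<in> null_sets (lborel :: 'a measure)" "{x. \<not> P x} \<subseteq> N"
    using assms by (auto simp: eventually_ae_filter)
  have "N \<times> UNIV \<union> UNIV \<times> N \<in> null_sets ((lborel :: 'a measure) \<Otimes>\<^sub>M (lborel :: 'a measure))"
    using N(1) by (intro null_sets.Un)
      (auto simp: null_sets_def lborel.emeasure_pair_measure_Times intro!: pair_measureI)
  moreover have "{p \<in> space (lborel \<Otimes>\<^sub>M lborel). \<not> (P (fst p) \<and> P (snd p))} \<subseteq> N \<times> UNIV \<union> UNIV \<times> N"
    using N(2) by (auto simp: space_pair_measure)
  ultimately show ?thesis by (rule AE_I')
qed

text \<open>The limit exists almost everywhere, so the integrand on the left is the pointwise liminf
  and Fatou's lemma applies. The weight \<open>w\<close> covers both halves of the norm.\<close>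

lemma nn_integral_Fatou_sq:
  fixes s :: "nat \<Rightarrow> 'a \<Rightarrow> real" and f w :: "'a \<Rightarrow> real"
  assumes [measurable]: "\<And>n. s n \<in> borel_measurable M" "w \<in> borel_measurable M"
    and lim: "AE x in M. (\<lambda>n. s n x) \<longlonglongrightarrow> f x"
  shows "(\<integral>\<^sup>+x. ennreal (w x * (f x)\<^sup>2) \<partial>M) \<le> liminf (\<lambda>n. \<integral>\<^sup>+x. ennreal (w x * (s n x)\<^sup>2) \<partial>M)"
proof -
  have "(\<integral>\<^sup>+x. ennreal (w x * (f x)\<^sup>2) \<partial>M) = (\<integral>\<^sup>+x. liminf (\<lambda>n. ennreal (w x * (s n x)\<^sup>2)) \<partial>M)"
  proof (rule nn_integral_cong_AE)
    show "AE x in M. ennreal (w x * (f x)\<^sup>2) = liminf (\<lambda>n. ennreal (w x * (s n x)\<^sup>2))"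
      using lim
    proof eventually_elim
      case (elim x)
      then have "(\<lambda>n. ennreal (w x * (s n x)\<^sup>2)) \<longlonglongrightarrow> ennreal (w x * (f x)\<^sup>2)"
        by (intro tendsto_ennrealI tendsto_intros)
      then show ?case
        by (simp add: lim_imp_Liminf)
    qed
  qed
  also have "\<dots> \<le> liminf (\<lambda>n. \<integral>\<^sup>+x. ennreal (w x * (s n x)\<^sup>2) \<partial>M)"
    by (rule nn_integral_liminf) measurable
  finally show ?thesis .
qed

lemma l2_sq_Fatou:
  assumes [measurable]: "\<And>n. s n \<in> borel_measurable borel"
    and lim: "AE x in lborel. (\<lambda>n. s n x) \<longlonglongrightarrow> f x"
  shows "l2_sq f \<le> liminf (\<lambda>n. l2_sq (s n))"
  using nn_integral_Fatou_sq[of s lborel "\<lambda>_. 1" f] lim by (simp add: l2_sq_def)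

lemma dlog_enorm2_Fatou:
  fixes f :: "real^'n \<Rightarrow> real"
  assumes [measurable]: "\<And>n. s n \<in> borel_measurable borel" "f \<in> borel_measurable borel"
    and lim: "AE x in lborel. (\<lambda>n. s n x) \<longlonglongrightarrow> f x"
  shows "dlog_enorm2 f \<le> liminf (\<lambda>n. dlog_enorm2 (s n))"
proof -
  have "AE p in lborel \<Otimes>\<^sub>M lborel. (\<lambda>n. diff_pair (s n) p) \<longlonglongrightarrow> diff_pair f p"
    using AE_lborel_pair[OF lim] by eventually_elim (auto simp: diff_pair_def intro!: tendsto_intros)
  then have 1: "gagliardo f \<le> liminf (\<lambda>n. gagliardo (s n))"
    using nn_integral_Fatou_sq[of "\<lambda>n. diff_pair (s n)" "lborel \<Otimes>\<^sub>M lborel" kernel_pair "diff_pair f"]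
    by (simp add: gagliardo_eq_pair kernel_pair_def diff_pair_def)
  have 2: "weight_sq f \<le> liminf (\<lambda>n. weight_sq (s n))"
    using nn_integral_Fatou_sq[of s lborel log_weight f] lim by (simp add: weight_sq_def mult.commute)
  let ?c = "ennreal (c_const CARD('n) / 2)"
  have "dlog_enorm2 f \<le> ?c * liminf (\<lambda>n. gagliardo (s n)) + liminf (\<lambda>n. weight_sq (s n))"
    by (simp add: dlog_enorm2_eq add_mono mult_left_mono 1 2)
  also have "\<dots> \<le> liminf (\<lambda>n. ?c * gagliardo (s n) + weight_sq (s n))"
    by (simp add: liminf_ennreal_mult_left liminf_add_ennreal_le)
  finally show ?thesis by (simp add: dlog_enorm2_eq)
qed

section \<open>Completeness\<close>

text \<open>Multiplying by a fixed positive square integrable function turns an \<open>L\<^sup>2\<close> Cauchy sequence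
  into an \<open>L\<^sup>1\<close> Cauchy sequence.\<close>

lemma l2_Cauchy_AE_subseq:
  fixes v :: "nat \<Rightarrow> real^'n \<Rightarrow> real"
  assumes v: "\<And>n. v n \<in> sq_integrable"
    and cauchy: "\<And>e. e > 0 \<Longrightarrow> \<exists>N. \<forall>i\<ge>N. \<forall>j\<ge>N. l2_sq (\<lambda>x. v i x - v j x) < ennreal e"
  obtains r f where "strict_mono r" "f \<in> borel_measurable borel"
    "AE x in lborel. (\<lambda>n. v (r n) x) \<longlonglongrightarrow> f x"
proof -
  have [measurable]: "\<And>n. v n \<in> borel_measurable borel"
    using v by (auto simp: sq_integrable_iff)
  obtain h :: "real^'n \<Rightarrow> ennreal" where h [measurable]: "h \<in> borel_measurable lborel"
    and hfin: "(\<integral>\<^sup>+x. h x \<partial>lborel) \<noteq> \<infinity>" and hpos: "\<And>x. 0 < h x \<and> h x < \<infinity>"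
    using sigma_finite_measure.Ex_finite_integrable_function[OF sigma_finite_lborel] by auto
  \<comment> \<open>The root of a positive integrable function, which exists by sigma-finiteness:
    \<open>g\<close> is positive everywhere and its square is integrable.\<close>
  define g where "g x = sqrt (enn2real (h x))" for x
  have gm [measurable]: "g \<in> borel_measurable borel"
    unfolding g_def[abs_def] using h by measurable
  have gpos: "0 < g x" for x
    using hpos[of x] by (auto simp: g_def enn2real_positive_iff)
  have g2: "ennreal ((g x)\<^sup>2) = h x" for x
    using hpos[of x] by (simp add: g_def)
  have gsq: "g \<in> sq_integrable"
    using hfin by (simp add: sq_integrable_iff l2_sq_def g2 less_top)
  define H where "H = (\<integral>x. (g x)\<^sup>2 \<partial>lborel)"
  have Hint: "integrable lborel (\<lambda>x. (g x)\<^sup>2)"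
    using gsq by (simp add: sq_integrable_def)
  have H0: "0 \<le> H" by (simp add: H_def)
  have int: "integrable lborel (\<lambda>x. v n x * g x)" for n
    by (rule sq_integrable_mult[OF v gsq])
  have L1: "\<exists>N. \<forall>i\<ge>N. \<forall>j\<ge>N. (\<integral>x. norm (v i x * g x - v j x * g x) \<partial>lborel) < e" if e: "e > 0" for e
  proof -
    \<comment> \<open>In |a| g \<le> a^2/(2 s) + s g^2/2 the second integral is then at most e/2,
      and keeping the squared distance below e s keeps the first below e/2.\<close>
    define s where "s = e / (H + 1)"
    have s: "s > 0" "s * H \<le> e"
      using e H0 by (auto simp: s_def divide_simps)
    obtain N where N: "\<And>i j. i \<ge> N \<Longrightarrow> j \<ge> N \<Longrightarrow> l2_sq (\<lambda>x. v i x - v j x) < ennreal (e * s)"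
      using cauchy[of "e * s"] e s by auto
    have "(\<integral>x. norm (v i x * g x - v j x * g x) \<partial>lborel) < e" if ij: "i \<ge> N" "j \<ge> N" for i j
    proof -
      let ?a = "\<lambda>x. v i x - v j x"
      have "?a \<in> sq_integrable"
        using N[OF ij] by (auto simp: sq_integrable_iff intro: order.strict_trans)
      then have aint: "integrable lborel (\<lambda>x. (?a x)\<^sup>2)"
        by (simp add: sq_integrable_def)
      have a2: "(\<integral>x. (?a x)\<^sup>2 \<partial>lborel) < e * s"
        using N[OF ij] nn_integral_eq_integral[OF aint] e s
        by (simp add: l2_sq_def ennreal_less_iff)
      have "(\<integral>x. norm (v i x * g x - v j x * g x) \<partial>lborel) \<le> (\<integral>x. (?a x)\<^sup>2 / (2 * s) + s / 2 * (g x)\<^sup>2 \<partial>lborel)"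
      proof (rule integral_mono)
        fix x
        have "0 \<le> (\<bar>?a x\<bar> - s * g x)\<^sup>2" by simp
        then have "2 * s * (\<bar>?a x\<bar> * g x) \<le> (?a x)\<^sup>2 + s * s * (g x)\<^sup>2"
          by (simp add: power2_eq_square algebra_simps)
        then have "\<bar>?a x\<bar> * g x \<le> (?a x)\<^sup>2 / (2 * s) + s / 2 * (g x)\<^sup>2"
          using s by (simp add: field_simps)
        then show "norm (v i x * g x - v j x * g x) \<le> (?a x)\<^sup>2 / (2 * s) + s / 2 * (g x)\<^sup>2"
          using gpos[of x] by (simp add: left_diff_distrib[symmetric] abs_mult)
      qed (use aint Hint int in auto)
      also have "\<dots> = (\<integral>x. (?a x)\<^sup>2 \<partial>lborel) / (2 * s) + s / 2 * H"
        using aint Hint by (simp add: H_def)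
      also have "\<dots> < e"
      proof -
        have "(\<integral>x. (?a x)\<^sup>2 \<partial>lborel) / (2 * s) < e / 2"
          using a2 s by (simp add: field_simps)
        moreover have "s / 2 * H \<le> e / 2"
          using s(2) by simp
        ultimately show ?thesis by linarith
      qed
      finally show ?thesis .
    qed
    then show ?thesis by blast
  qed
  obtain r where r: "strict_mono r" "AE x in lborel. Cauchy (\<lambda>n. v (r n) x * g x)"
    using cauchy_L1_AE_cauchy_subseq[of lborel "\<lambda>n x. v n x * g x"] int L1 by blast
  \<comment> \<open>As \<open>g\<close> is positive, dividing by it turns convergence of the
    products into convergence of the subsequence itself.\<close>
  have lim: "AE x in lborel. (\<lambda>n. v (r n) x) \<longlonglongrightarrow> lim (\<lambda>n. v (r n) x)"
    using r(2)
  proof eventually_elim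
    case (elim x)
    then obtain l where "(\<lambda>n. v (r n) x * g x) \<longlonglongrightarrow> l"
      by (auto simp: Cauchy_convergent_iff convergent_def)
    then have "(\<lambda>n. v (r n) x * g x / g x) \<longlonglongrightarrow> l / g x"
      using gpos[of x] by (intro tendsto_divide) auto
    then have "convergent (\<lambda>n. v (r n) x)"
      using gpos[of x] by (auto simp: convergent_def)
    then show ?case by (simp add: convergent_LIMSEQ_iff)
  qed
  have "(\<lambda>x. lim (\<lambda>n. v (r n) x)) \<in> borel_measurable borel"
    by measurable
  then show thesis
    using lim by (rule that[OF r(1)])
qed

text \<open>Stated for a lower semicontinuous \<open>Q\<close> that dominates \<open>l2_sq\<close>,
  so that it yields completeness of the whole space, with \<open>l2_sq\<close>, and of the
  logarithmic space, with \<open>dlog_enorm2\<close>.\<close>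

lemma l2_Cauchy_limit:
  fixes v :: "nat \<Rightarrow> real^'n \<Rightarrow> real" and Q :: "(real^'n \<Rightarrow> real) \<Rightarrow> ennreal"
  assumes v: "\<And>n. v n \<in> sq_integrable"
    and cauchy: "\<And>e. e > 0 \<Longrightarrow> \<exists>N. \<forall>i\<ge>N. \<forall>j\<ge>N. Q (\<lambda>x. v i x - v j x) < ennreal e"
    and le: "\<And>f. f \<in> borel_measurable borel \<Longrightarrow> l2_sq f \<le> Q f"
    and Fatou: "\<And>s f. (\<And>n. s n \<in> borel_measurable borel) \<Longrightarrow> f \<in> borel_measurable borel \<Longrightarrow>
        AE x in lborel. (\<lambda>n. s n x) \<longlonglongrightarrow> f x \<Longrightarrow> Q f \<le> liminf (\<lambda>n. Q (s n))"
  shows "\<exists>f\<in>borel_measurable borel. \<forall>e>0. \<exists>N. \<forall>n\<ge>N. Q (\<lambda>x. f x - v n x) \<le> ennreal e"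
proof -
  have [measurable]: "\<And>n. v n \<in> borel_measurable borel"
    using v by (auto simp: sq_integrable_iff)
  have L2: "\<exists>N. \<forall>i\<ge>N. \<forall>j\<ge>N. l2_sq (\<lambda>x. v i x - v j x) < ennreal e" if e: "e > 0" for e
  proof -
    obtain N where "\<forall>i\<ge>N. \<forall>j\<ge>N. Q (\<lambda>x. v i x - v j x) < ennreal e"
      using cauchy[OF e] by auto
    moreover have "l2_sq (\<lambda>x. v i x - v j x) \<le> Q (\<lambda>x. v i x - v j x)" for i j
      by (rule le) measurable
    ultimately show ?thesis by (meson order.strict_trans1)
  qed
  obtain r f where r: "strict_mono r" and f [measurable]: "f \<in> borel_measurable borel"
    and lim: "AE x in lborel. (\<lambda>n. v (r n) x) \<longlonglongrightarrow> f x"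
    by (rule l2_Cauchy_AE_subseq[of v, OF v L2])
  have "\<exists>N. \<forall>n\<ge>N. Q (\<lambda>x. f x - v n x) \<le> ennreal e" if e: "e > 0" for e
  proof -
    obtain N where N: "\<And>i j. i \<ge> N \<Longrightarrow> j \<ge> N \<Longrightarrow> Q (\<lambda>x. v i x - v j x) < ennreal e"
      using cauchy[OF e] by auto
    have "Q (\<lambda>x. f x - v n x) \<le> ennreal e" if n: "n \<ge> N" for n
    proof -
      \<comment> \<open>Fatou is applied in \<open>m\<close> with \<open>n\<close> fixed. The
        subsequence occurs only in the first term of the difference, so the bound holds for every
        \<open>n\<close> beyond \<open>N\<close> and not merely along \<open>r\<close>.\<close>
      have "Q (\<lambda>x. f x - v n x) \<le> liminf (\<lambda>m. Q (\<lambda>x. v (r m) x - v n x))"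
        using lim by (intro Fatou) (auto elim!: eventually_mono intro!: tendsto_intros)
      also have "\<dots> \<le> limsup (\<lambda>m. Q (\<lambda>x. v (r m) x - v n x))"
        by (rule Liminf_le_Limsup) simp
      also have "\<dots> \<le> ennreal e"
      proof (rule Limsup_bounded)
        show "\<forall>\<^sub>F m in sequentially. Q (\<lambda>x. v (r m) x - v n x) \<le> ennreal e"
          using eventually_ge_at_top[of N]
        proof eventually_elim
          case (elim m)
          then have "r m \<ge> N" using seq_suble[OF r, of m] by linarith
          then show ?case using N[OF _ n] by (simp add: less_imp_le)
        qed
      qed
      finally show ?thesis .
    qed
    then show ?thesis by blast
  qed
  then show ?thesis using f by blast
qed

section \<open>Representatives and equivalence classes\<close>

lemma l2_eq_refl: "v \<in> sq_integrable \<Longrightarrow> l2_eq v v"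
  by (simp add: l2_eq_def)

lemma l2_cases:
  fixes a :: "'n::finite l2"
  obtains v where "v \<in> sq_integrable" "a = abs_l2 v"
  using Quotient3_abs_rep[OF Quotient3_l2, of a] Quotient3_rep_reflp[OF Quotient3_l2, of a]
  by (metis l2_eq_def)

lemma dlog_fun_sq_integrable: "v \<in> dlog_fun \<Longrightarrow> v \<in> sq_integrable"
  by (simp add: dlog_fun_def)

lemma Dlog_cases:
  assumes "a \<in> Dlog"
  obtains v where "v \<in> dlog_fun" "a = abs_l2 v"
  using assms by (auto simp: Dlog_def)

lemma abs_l2_scale:
  assumes "u \<in> sq_integrable"
  shows "c *\<^sub>R abs_l2 u = abs_l2 (\<lambda>x. c * u x)"
  using assms by (simp add: scaleR_l2.abs_eq l2_eq_refl)

lemma norm_abs_l2: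
  assumes u: "u \<in> sq_integrable"
  shows "ennreal ((norm (abs_l2 u))\<^sup>2) = l2_sq u"
proof -
  have "(norm (abs_l2 u))\<^sup>2 = (\<integral>x. u x * u x \<partial>lborel)"
    unfolding power2_norm_eq_inner by (simp add: inner_l2.abs_eq l2_eq_refl u)
  moreover have "l2_sq u = ennreal (\<integral>x. (u x)\<^sup>2 \<partial>lborel)"
    unfolding l2_sq_def using u by (intro nn_integral_eq_integral) (auto simp: sq_integrable_def)
  ultimately show ?thesis by (simp add: power2_eq_square)
qed

lemma less_iff_ennreal_power2:
  "0 \<le> a \<Longrightarrow> 0 < e \<Longrightarrow> a < e \<longleftrightarrow> ennreal (a\<^sup>2) < ennreal (e\<^sup>2)" for a e :: real
  by (auto simp: ennreal_less_iff intro: power_strict_mono power2_less_imp_less)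

context
  fixes u v :: "real^'n \<Rightarrow> real"
  assumes u: "u \<in> sq_integrable" and v: "v \<in> sq_integrable"
begin

lemma abs_l2_add: "abs_l2 u + abs_l2 v = abs_l2 (\<lambda>x. u x + v x)"
  using u v by (simp add: plus_l2.abs_eq l2_eq_refl)

lemma abs_l2_diff: "abs_l2 u - abs_l2 v = abs_l2 (\<lambda>x. u x - v x)"
  using u v sq_integrable_scale[OF v, of "-1"]
  by (simp add: minus_l2_def uminus_l2.abs_eq plus_l2.abs_eq l2_eq_refl)

lemma dlog_inner_abs: "dlog_inner (abs_l2 u) (abs_l2 v) = dlog_ip u v"
  using u v by (simp add: dlog_inner.abs_eq l2_eq_refl)

end

lemma subspace_Dlog: "subspace (Dlog :: 'n::finite l2 set)"
proof (rule subspaceI)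
  show "(0 :: 'n l2) \<in> Dlog"
    unfolding zero_l2_def Dlog_def by (simp add: dlog_fun_zero)
  show "x + y \<in> Dlog" if "x \<in> Dlog" "y \<in> Dlog" for x y :: "'n l2"
    using that by (auto elim!: Dlog_cases simp: abs_l2_add dlog_fun_sq_integrable Dlog_def dlog_fun_add)
  show "c *\<^sub>R x \<in> Dlog" if "x \<in> Dlog" for c and x :: "'n l2"
    using that by (auto elim!: Dlog_cases simp: abs_l2_scale dlog_fun_sq_integrable Dlog_def dlog_fun_scale)
qed

lemma inner_product_on_Dlog: "inner_product_on (Dlog :: 'n::finite l2 set) dlog_inner"
  unfolding inner_product_on_def
proof (intro conjI ballI allI impI)
  fix a b c :: "'n l2" and t :: real
  assume "a \<in> Dlog"
  then obtain u where u: "u \<in> dlog_fun" "a = abs_l2 u" by (rule Dlog_cases)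
  note us = dlog_fun_sq_integrable[OF u(1)]
  show "0 \<le> dlog_inner a a"
    using dlog_enorm2_eq_ip(2)[OF u(1)] by (simp add: u dlog_inner_abs us)
  show "a = 0" if "dlog_inner a a = 0"
  proof -
    have "dlog_enorm2 u = 0"
      using that dlog_enorm2_eq_ip(1)[OF u(1)] by (simp add: u dlog_inner_abs us)
    then have "l2_sq u = 0"
      using l2_sq_le_dlog_enorm2[of u] u by (auto simp: dlog_fun_iff)
    then show ?thesis
      using norm_abs_l2[OF us] by (simp add: u)
  qed
  assume "b \<in> Dlog"
  then obtain v where v: "v \<in> dlog_fun" "b = abs_l2 v" by (rule Dlog_cases)
  note vs = dlog_fun_sq_integrable[OF v(1)]
  show "dlog_inner a b = dlog_inner b a"
    using u v by (simp add: dlog_inner_abs us vs dlog_ip_commute)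
  show "dlog_inner (t *\<^sub>R a) b = t * dlog_inner a b"
    using u v by (simp add: dlog_inner_abs us vs abs_l2_scale sq_integrable_scale dlog_ip_scale)
  assume "c \<in> Dlog"
  then obtain w where w: "w \<in> dlog_fun" "c = abs_l2 w" by (rule Dlog_cases)
  note ws = dlog_fun_sq_integrable[OF w(1)]
  show "dlog_inner (a + b) c = dlog_inner a c + dlog_inner b c"
    using u v w by (simp add: dlog_inner_abs us vs ws abs_l2_add sq_integrable_add dlog_ip_add)
qed

lemma Metric_space_Dlog: "Metric_space (Dlog :: 'n::finite l2 set) (ip_dist Dlog dlog_inner)"
  by (rule Metric_space_ip_dist[OF subspace_Dlog inner_product_on_Dlog])

lemma ip_dist_Dlog:
  assumes "u \<in> dlog_fun" "v \<in> dlog_fun"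
  shows "dlog_enorm2 (\<lambda>x. u x - v x) = ennreal ((ip_dist Dlog dlog_inner (abs_l2 u) (abs_l2 v))\<^sup>2)"
    and "0 \<le> ip_dist Dlog dlog_inner (abs_l2 u) (abs_l2 v)"
proof -
  have "(\<lambda>x. u x - v x) \<in> dlog_fun" using assms by (rule dlog_fun_diff)
  note d = dlog_enorm2_eq_ip[OF this] dlog_fun_sq_integrable[OF this]
  have *: "ip_dist Dlog dlog_inner (abs_l2 u) (abs_l2 v) = sqrt (dlog_ip (\<lambda>x. u x - v x) (\<lambda>x. u x - v x))"
    using assms d by (simp add: ip_dist_def Dlog_def abs_l2_diff dlog_fun_sq_integrable dlog_inner_abs)
  then show "dlog_enorm2 (\<lambda>x. u x - v x) = ennreal ((ip_dist Dlog dlog_inner (abs_l2 u) (abs_l2 v))\<^sup>2)"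
    using d by simp
  show "0 \<le> ip_dist Dlog dlog_inner (abs_l2 u) (abs_l2 v)"
    using * d by simp
qed

lemma ip_dist_Dlog_less:
  assumes "u \<in> dlog_fun" "v \<in> dlog_fun" "e > 0"
  shows "ip_dist Dlog dlog_inner (abs_l2 u) (abs_l2 v) < e \<longleftrightarrow> dlog_enorm2 (\<lambda>x. u x - v x) < ennreal (e\<^sup>2)"
  unfolding ip_dist_Dlog(1)[OF assms(1,2)]
  by (rule less_iff_ennreal_power2[OF ip_dist_Dlog(2)[OF assms(1,2)] assms(3)])

lemma mcomplete_Dlog: "Metric_space.mcomplete (Dlog :: 'n::finite l2 set) (ip_dist Dlog dlog_inner)"
proof -
  interpret Metric_space "Dlog :: 'n l2 set" "ip_dist Dlog dlog_inner"
    by (rule Metric_space_Dlog)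
  show ?thesis
    unfolding mcomplete_def
  proof (intro allI impI)
    fix s :: "nat \<Rightarrow> 'n l2"
    assume s: "MCauchy s"
    have "\<forall>n. \<exists>v. v \<in> dlog_fun \<and> s n = abs_l2 v"
      using s by (auto simp: MCauchy_def elim!: Dlog_cases dest!: range_subsetD)
    then obtain v where v: "\<And>n. v n \<in> dlog_fun" "\<And>n. s n = abs_l2 (v n)" by metis
    have cauchy: "\<exists>N. \<forall>i\<ge>N. \<forall>j\<ge>N. dlog_enorm2 (\<lambda>x. v i x - v j x) < ennreal e" if e: "e > 0" for e
    proof -
      obtain N where "\<forall>i j. N \<le> i \<longrightarrow> N \<le> j \<longrightarrow> ip_dist Dlog dlog_inner (s i) (s j) < sqrt e"
        using s e unfolding MCauchy_def by (meson real_sqrt_gt_zero)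
      then have "\<forall>i\<ge>N. \<forall>j\<ge>N. dlog_enorm2 (\<lambda>x. v i x - v j x) < ennreal ((sqrt e)\<^sup>2)"
        using e by (auto simp only: v ip_dist_Dlog_less real_sqrt_gt_zero)
      then show ?thesis using e by auto
    qed
    have "\<exists>f\<in>borel_measurable borel. \<forall>e>0. \<exists>N. \<forall>n\<ge>N. dlog_enorm2 (\<lambda>x. f x - v n x) \<le> ennreal e"
      by (rule l2_Cauchy_limit[OF dlog_fun_sq_integrable[OF v(1)] cauchy l2_sq_le_dlog_enorm2 dlog_enorm2_Fatou])
    then obtain f where f: "f \<in> borel_measurable borel"
      and lim: "\<And>e. e > 0 \<Longrightarrow> \<exists>N. \<forall>n\<ge>N. dlog_enorm2 (\<lambda>x. f x - v n x) \<le> ennreal e"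
      by blast
    \<comment> \<open>One index at finite distance is enough for membership: f - v N has finite
      norm, hence so has f.\<close>
    obtain N where "dlog_enorm2 (\<lambda>x. f x - v N x) \<le> ennreal 1"
      using lim[of 1] by auto
    then have "dlog_enorm2 (\<lambda>x. f x - v N x) < \<infinity>"
      by (rule order.strict_trans1) simp
    moreover have vN: "v N \<in> borel_measurable borel" using v(1)[of N] by (simp add: dlog_fun_iff)
    moreover have "l2_sq (\<lambda>x. f x - v N x) \<le> dlog_enorm2 (\<lambda>x. f x - v N x)"
      using f vN by (intro l2_sq_le_dlog_enorm2) measurable
    ultimately have "(\<lambda>x. f x - v N x) \<in> dlog_fun"
      using f by (auto simp: dlog_fun_def sq_integrable_iff)
    then have fd: "f \<in> dlog_fun"
      using dlog_fun_add[OF _ v(1)[of N]] by fastforce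
    have "limitin mtopology s (abs_l2 f) sequentially"
      unfolding limitin_metric
    proof (intro conjI allI impI)
      show fD: "abs_l2 f \<in> Dlog" using fd by (simp add: Dlog_def)
      fix e :: real assume e: "e > 0"
      \<comment> \<open>Half of e^2 leaves room for the strict inequality in the metric, since the
        limit is only known with \<le>.\<close>
      obtain N where N: "\<forall>n\<ge>N. dlog_enorm2 (\<lambda>x. f x - v n x) \<le> ennreal (e\<^sup>2 / 2)"
        using lim[of "e\<^sup>2 / 2"] e by auto
      have "ennreal (e\<^sup>2 / 2) < ennreal (e\<^sup>2)"
        using e by (simp add: ennreal_less_iff)
      then have "\<forall>n\<ge>N. ip_dist Dlog dlog_inner (abs_l2 f) (s n) < e"
        using N e fd v by (auto simp: ip_dist_Dlog_less intro: order.strict_trans1)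
      moreover have "s n \<in> Dlog" for n using v by (simp add: Dlog_def)
      ultimately have "\<forall>n\<ge>N. s n \<in> Dlog \<and> ip_dist Dlog dlog_inner (s n) (abs_l2 f) < e"
        by (simp add: commute)
      then show "\<forall>\<^sub>F n in sequentially. s n \<in> Dlog \<and> ip_dist Dlog dlog_inner (s n) (abs_l2 f) < e"
        by (auto simp: eventually_sequentially)
    qed
    then show "\<exists>x. limitin mtopology s x sequentially" by blast
  qed
qed

lemma norm_abs_l2_less:
  assumes "u \<in> sq_integrable" "e > 0"
  shows "norm (abs_l2 u) < e \<longleftrightarrow> l2_sq u < ennreal (e\<^sup>2)"
  unfolding norm_abs_l2[OF assms(1), symmetric]
  by (rule less_iff_ennreal_power2[OF norm_ge_zero assms(2)])

text \<open>Riesz-Fischer for the quotient type. Compactness depends on it: a totally bounded closed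
  set must also be complete.\<close>

lemma complete_l2: "complete (UNIV :: 'n::finite l2 set)"
  unfolding complete_def
proof (intro allI impI)
  fix s :: "nat \<Rightarrow> 'n l2"
  assume "(\<forall>n. s n \<in> UNIV) \<and> Cauchy s"
  then have s: "Cauchy s" by simp
  have "\<forall>n. \<exists>v. v \<in> sq_integrable \<and> s n = abs_l2 v"
    by (metis l2_cases)
  then obtain v where v: "\<And>n. v n \<in> sq_integrable" "\<And>n. s n = abs_l2 (v n)" by metis
  have dist: "dist (s i) (s j) < e \<longleftrightarrow> l2_sq (\<lambda>x. v i x - v j x) < ennreal (e\<^sup>2)" if "e > 0" for e i j
    using v that sq_integrable_add[OF v(1) sq_integrable_scale[OF v(1), where c = "-1"]]
    by (simp add: dist_norm abs_l2_diff norm_abs_l2_less)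
  have cauchy: "\<exists>N. \<forall>i\<ge>N. \<forall>j\<ge>N. l2_sq (\<lambda>x. v i x - v j x) < ennreal e" if e: "e > 0" for e
    using metric_CauchyD[OF s, of "sqrt e"] e by (auto simp: dist)
  have "\<exists>f\<in>borel_measurable borel. \<forall>e>0. \<exists>N. \<forall>n\<ge>N. l2_sq (\<lambda>x. f x - v n x) \<le> ennreal e"
    by (rule l2_Cauchy_limit[OF v(1) cauchy order_refl l2_sq_Fatou])
  then obtain f where f: "f \<in> borel_measurable borel"
    and lim: "\<And>e. e > 0 \<Longrightarrow> \<exists>N. \<forall>n\<ge>N. l2_sq (\<lambda>x. f x - v n x) \<le> ennreal e"
    by blast
  obtain N where "l2_sq (\<lambda>x. f x - v N x) \<le> ennreal 1"
    using lim[of 1] by auto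
  then have "l2_sq (\<lambda>x. f x - v N x) < \<infinity>"
    by (rule order.strict_trans1) simp
  then have "(\<lambda>x. f x - v N x) \<in> sq_integrable"
    using f v(1)[of N] by (auto simp: sq_integrable_iff intro: borel_measurable_diff)
  then have fs: "f \<in> sq_integrable"
    using sq_integrable_add[OF _ v(1)[of N]] by fastforce
  have "s \<longlonglongrightarrow> abs_l2 f"
  proof (rule metric_LIMSEQ_I)
    fix e :: real assume e: "e > 0"
    obtain N where N: "\<forall>n\<ge>N. l2_sq (\<lambda>x. f x - v n x) \<le> ennreal (e\<^sup>2 / 2)"
      using lim[of "e\<^sup>2 / 2"] e by auto
    have "ennreal (e\<^sup>2 / 2) < ennreal (e\<^sup>2)"
      using e by (simp add: ennreal_less_iff)
    then have "\<forall>n\<ge>N. dist (abs_l2 f) (s n) < e"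
      using N e v fs sq_integrable_add[OF fs sq_integrable_scale[OF v(1), where c = "-1"]]
      by (auto simp: dist_norm abs_l2_diff norm_abs_l2_less intro: order.strict_trans1)
    then show "\<exists>N. \<forall>n\<ge>N. dist (s n) (abs_l2 f) < e"
      by (auto simp: dist_commute)
  qed
  then show "\<exists>l\<in>UNIV. s \<longlonglongrightarrow> l" by blast
qed

section \<open>Mollifiers\<close>

lemma Ck_SucI:
  assumes "\<And>x. (f has_derivative D x) (at x)" "\<And>h. Ck k (\<lambda>x. D x h)"
  shows "Ck (Suc k) f"
proof -
  have "frechet_derivative f (at x) = D x" for x
    using frechet_derivative_at[OF assms(1)] by simp
  then show ?thesis
    using assms by (auto simp: differentiable_def)
qed

lemma Ck_SucD:
  assumes "Ck (Suc k) f"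
  shows "(f has_derivative frechet_derivative f (at x)) (at x)" "Ck k (\<lambda>x. frechet_derivative f (at x) h)"
  using assms by (auto simp: frechet_derivative_works[symmetric])

text \<open>The product rule pairs a derivative with an undifferentiated factor, whose order of
  smoothness has to be lowered by one; this makes the induction in \<open>Ck_mult\<close>
  close.\<close>

lemma Ck_Suc_imp: "Ck (Suc k) f \<Longrightarrow> Ck k f"
proof (induction k arbitrary: f)
  case 0
  then have "f differentiable (at x)" for x
    unfolding Ck.simps by blast
  then have "continuous_on UNIV f"
    by (intro continuous_at_imp_continuous_on ballI differentiable_imp_continuous_within)
  then show ?case by (simp only: Ck.simps)
next
  case (Suc k)
  show ?case
    by (rule Ck_SucI[OF Ck_SucD(1)[OF Suc.prems] Suc.IH[OF Ck_SucD(2)[OF Suc.prems]]])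
qed

lemma Ck_continuous: "Ck k f \<Longrightarrow> continuous_on UNIV f"
  by (induction k) (auto dest: Ck_Suc_imp simp del: Ck.simps(2))

lemma Ck_const: "Ck k (\<lambda>_. c)"
proof (induction k arbitrary: c)
  case (Suc k)
  show ?case by (rule Ck_SucI[where D = "\<lambda>_ _. 0"]) (auto intro: Suc)
qed simp

lemma Ck_add: "Ck k f \<Longrightarrow> Ck k g \<Longrightarrow> Ck k (\<lambda>x. f x + g x)"
proof (induction k arbitrary: f g)
  case (Suc k)
  show ?case
    by (rule Ck_SucI[OF has_derivative_add[OF Ck_SucD(1)[OF Suc.prems(1)] Ck_SucD(1)[OF Suc.prems(2)]]])
      (rule Suc.IH[OF Ck_SucD(2)[OF Suc.prems(1)] Ck_SucD(2)[OF Suc.prems(2)]])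
qed (auto intro: continuous_intros)

lemma Ck_mult: "Ck k f \<Longrightarrow> Ck k g \<Longrightarrow> Ck k (\<lambda>x. f x * g x)"
proof (induction k arbitrary: f g)
  case (Suc k)
  show ?case
    by (rule Ck_SucI[OF has_derivative_mult[OF Ck_SucD(1)[OF Suc.prems(1)] Ck_SucD(1)[OF Suc.prems(2)]]])
      (rule Ck_add[OF Suc.IH[OF Ck_Suc_imp[OF Suc.prems(1)] Ck_SucD(2)[OF Suc.prems(2)]]
          Suc.IH[OF Ck_SucD(2)[OF Suc.prems(1)] Ck_Suc_imp[OF Suc.prems(2)]]])
qed (auto intro: continuous_intros)

lemma Ck_sum: "(\<And>i. i \<in> I \<Longrightarrow> Ck k (f i)) \<Longrightarrow> Ck k (\<lambda>x. \<Sum>i\<in>I. f i x)"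
  by (induction I rule: infinite_finite_induct) (auto intro: Ck_const Ck_add)

lemma Ck_inner: "Ck k (\<lambda>x. x \<bullet> h)"
proof (cases k)
  case (Suc l)
  show ?thesis unfolding Suc
    by (rule Ck_SucI[where D = "\<lambda>_ y. y \<bullet> h"]) (auto intro: Ck_const derivative_eq_intros)
qed (auto intro: continuous_intros)

text \<open>The functions t^(-m) e^(-1/t), extended by 0. The power is a parameter because
  differentiation leads from m to m + 1 and m + 2, so smoothness is proved for the whole family at
  once.\<close>

definition exp_cutoff :: "nat \<Rightarrow> real \<Rightarrow> real" where
  "exp_cutoff m t = (if 0 < t then (1 / t) ^ m * exp (- (1 / t)) else 0)"

lemma exp_cutoff_tendsto_0: "(exp_cutoff m \<longlongrightarrow> 0) (at 0)"
proof -
  have "((\<lambda>t::real. t ^ m / exp t) \<longlongrightarrow> 0) at_top"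
    by (rule tendsto_power_div_exp_0)
  then have "((\<lambda>t::real. (inverse t) ^ m / exp (inverse t)) \<longlongrightarrow> 0) (at_right 0)"
    by (rule filterlim_compose[OF _ filterlim_inverse_at_top_right])
  moreover have "\<forall>\<^sub>F t::real in at_right 0. (inverse t) ^ m / exp (inverse t) = exp_cutoff m t"
    by (auto simp: eventually_at_filter exp_cutoff_def inverse_eq_divide exp_minus field_simps)
  ultimately have 1: "(exp_cutoff m \<longlongrightarrow> 0) (at_right 0)"
    by (rule Lim_transform_eventually)
  have "\<forall>\<^sub>F t::real in at_left 0. 0 = exp_cutoff m t"
    by (auto simp: eventually_at_filter exp_cutoff_def)
  then have "(exp_cutoff m \<longlongrightarrow> 0) (at_left 0)"
    by (rule Lim_transform_eventually[OF tendsto_const])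
  with 1 show ?thesis by (simp add: filterlim_split_at)
qed

lemma exp_cutoff_deriv:
  "(exp_cutoff m has_real_derivative exp_cutoff (m + 2) t - real m * exp_cutoff (m + 1) t) (at t)"
proof -
  consider "t < 0" | "0 < t" | "t = 0" by linarith
  then show ?thesis
  proof cases
    case 1
    have "((\<lambda>_. 0) has_real_derivative 0) (at t)" by simp
    then have "(exp_cutoff m has_real_derivative 0) (at t)"
      by (rule has_field_derivative_transform_within_open[of _ _ _ "{..<0}"])
        (use 1 in \<open>auto simp: exp_cutoff_def\<close>)
    then show ?thesis using 1 by (simp add: exp_cutoff_def)
  next
    case 2
    have "((\<lambda>t. (1 / t) ^ m * exp (- (1 / t))) has_real_derivative
       exp_cutoff (m + 2) t - real m * exp_cutoff (m + 1) t) (at t)"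
      using 2 by (auto intro!: derivative_eq_intros simp: exp_cutoff_def field_simps power2_eq_square)
        (cases m; simp add: field_simps)+
    then show ?thesis
      by (rule has_field_derivative_transform_within_open[of _ _ _ "{0<..}"])
        (use 2 in \<open>auto simp: exp_cutoff_def\<close>)
  next
    case 3
    \<comment> \<open>At 0 the difference quotient of the function with index m is exactly the
      function with index m + 1, so differentiability there reduces to the limit already
      known.\<close>
    have "(\<lambda>h. (exp_cutoff m (0 + h) - exp_cutoff m 0) / h) = exp_cutoff (m + 1)"
      by (auto simp: exp_cutoff_def fun_eq_iff)
    then have "(exp_cutoff m has_real_derivative 0) (at 0)"
      using exp_cutoff_tendsto_0[of "m + 1"] by (simp add: DERIV_def)
    then show ?thesis using 3 by (simp add: exp_cutoff_def)
  qed
qed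

definition bump :: "nat \<Rightarrow> real \<Rightarrow> real^'n \<Rightarrow> real" where
  "bump m b x = exp_cutoff m (1 - b * (x \<bullet> x))"

text \<open>The derivative is again a combination of bumps, with indices m + 1 and m + 2, times a
  linear function; hence the induction over k runs for all m simultaneously.\<close>

lemma Ck_bump: "Ck k (bump m b)"
proof (induction k arbitrary: m)
  case 0
  have "isCont (exp_cutoff m) t" for t
    using exp_cutoff_deriv by (rule DERIV_isCont)
  then have "continuous_on UNIV (exp_cutoff m)"
    by (simp add: continuous_at_imp_continuous_on)
  then have "continuous_on UNIV (\<lambda>x::real^'a. exp_cutoff m (1 - b * (x \<bullet> x)))"
    by (rule continuous_on_compose2) (auto intro!: continuous_intros)
  then show ?case by (simp add: bump_def[abs_def])
next
  case (Suc k)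
  show ?case
  proof (rule Ck_SucI)
    fix x :: "real^'a"
    have "((\<lambda>x. 1 - b * (x \<bullet> x)) has_derivative (\<lambda>h. - (2 * b) * (x \<bullet> h))) (at x)"
      by (auto intro!: derivative_eq_intros simp: inner_commute)
    moreover have "(exp_cutoff m has_derivative
        (\<lambda>h. (exp_cutoff (m + 2) (1 - b * (x \<bullet> x)) - real m * exp_cutoff (m + 1) (1 - b * (x \<bullet> x))) * h)) (at (1 - b * (x \<bullet> x)))"
      using exp_cutoff_deriv[of m] by (simp add: has_field_derivative_def)
    ultimately show "(bump m b has_derivative
        (\<lambda>h. (bump (m + 2) b x + (- real m) * bump (m + 1) b x) * (- (2 * b) * (x \<bullet> h)))) (at x)"
      using has_derivative_compose by (fastforce simp: bump_def[abs_def])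
  next
    fix h :: "real^'a"
    show "Ck k (\<lambda>x. (bump (m + 2) b x + (- real m) * bump (m + 1) b x) * (- (2 * b) * (x \<bullet> h)))"
      by (intro Ck_mult Ck_add Ck_const Suc.IH Ck_inner)
  qed
qed

lemma bump_nonneg [simp]: "0 \<le> bump 0 b x"
  by (simp add: bump_def exp_cutoff_def)

lemma bump_le_1: "bump 0 b x \<le> 1"
  by (auto simp: bump_def exp_cutoff_def)

text \<open>As \<open>b\<close> multiplies |x|^2, the parameter 4^k amounts to a dilation by
  2^k.\<close>

lemma bump_scale: "bump 0 (4 ^ k) x = bump 0 1 ((2 ^ k) *\<^sub>R x)"
  by (simp add: bump_def power_mult_distrib[symmetric] mult.assoc[symmetric])

lemma bump_eq_0: "1 \<le> norm x \<Longrightarrow> bump 0 1 x = 0"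
  by (simp add: bump_def exp_cutoff_def dot_square_norm one_le_power not_less)

lemma bump_measurable [measurable]: "bump m b \<in> borel_measurable borel"
  using Ck_continuous[OF Ck_bump[of 0]] by (rule borel_measurable_continuous_onI)

lemma nn_integral_lborel_scale:
  fixes f :: "real^'n \<Rightarrow> ennreal"
  assumes [measurable]: "f \<in> borel_measurable borel" and c: "c \<noteq> 0"
  shows "(\<integral>\<^sup>+x. ennreal (\<bar>c\<bar> ^ CARD('n)) * f (c *\<^sub>R x) \<partial>lborel) = (\<integral>\<^sup>+x. f x \<partial>lborel)"
  by (subst (2) lborel_affine[OF c, of 0])
    (simp add: nn_integral_density nn_integral_distr)

text \<open>The value is never computed; the constant of the mollifiers only needs it positive and
  finite.\<close>

lemma bump_integral:
  obtains a where "0 < a" "(\<integral>\<^sup>+x. ennreal (bump 0 1 x) \<partial>(lborel :: (real^'n) measure)) = ennreal a"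
proof -
  let ?I = "\<integral>\<^sup>+x. ennreal (bump 0 1 x) \<partial>(lborel :: (real^'n) measure)"
  have "?I \<le> (\<integral>\<^sup>+x. indicator (ball 0 1) x \<partial>(lborel :: (real^'n) measure))"
    by (intro nn_integral_mono) (auto simp: indicator_def not_less bump_le_1 bump_eq_0)
  also have "\<dots> < \<infinity>"
    using emeasure_lborel_ball_finite[of "0::real^'n" 1] by simp
  finally have fin: "?I < \<infinity>" .
  have "?I \<noteq> 0"
  proof
    assume "?I = 0"
    then have "AE x in (lborel :: (real^'n) measure). ennreal (bump 0 1 x) = 0"
      by (subst (asm) nn_integral_0_iff_AE) auto
    then have "AE x in (lborel :: (real^'n) measure). x \<notin> ball 0 1"
    proof eventually_elim
      case (elim x)
      then have "bump 0 1 x = 0" using bump_nonneg[of 1 x] by simp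
      then show ?case
        by (auto simp: bump_def exp_cutoff_def dot_square_norm power_less_one_iff split: if_splits)
    qed
    then have "emeasure (lborel :: (real^'n) measure) (ball 0 1) = 0"
      using AE_iff_measurable[of "ball 0 1" "lborel :: (real^'n) measure" "\<lambda>x. x \<notin> ball 0 1"]
      by (auto simp: ball_def)
    then show False
      using unit_ball_vol_pos[of "real CARD('n)"] by (simp add: emeasure_ball)
  qed
  then have "0 < enn2real ?I" using fin by (simp add: enn2real_positive_iff zero_less_iff_neq_zero)
  then show thesis using fin by (intro that[of "enn2real ?I"]) auto
qed

text \<open>A geometric sum is at most twice its last term.\<close>

lemma geometric_cutoff_sum:
  fixes q s :: real
  assumes q: "2 \<le> q" and s: "0 \<le> s"
  shows "(\<Sum>k<m. if q ^ k * s < 1 then q ^ k else 0) * s \<le> 2"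
proof (induction m)
  case (Suc m)
  show ?case
  \<comment> \<open>If the new summand is switched on, the whole sum is at most 2 q^m while q^m s <
    1; otherwise the sum does not change and the induction hypothesis applies.\<close>
  proof (cases "q ^ m * s < 1")
    case True
    have "(\<Sum>k<Suc m. if q ^ k * s < 1 then q ^ k else 0) \<le> (\<Sum>k<Suc m. q ^ k)"
      using q by (intro sum_mono) auto
    also have "\<dots> \<le> 2 * q ^ m"
    proof (induction m)
      case (Suc m)
      have "2 * q ^ m \<le> q * q ^ m" using q by (intro mult_right_mono) auto
      then show ?case using Suc by simp
    qed simp
    finally have "(\<Sum>k<Suc m. if q ^ k * s < 1 then q ^ k else 0) * s \<le> 2 * q ^ m * s"
      using s by (rule mult_right_mono)
    then show ?thesis using True by linarith
  next
    case False
    then show ?thesis using Suc by simp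
  qed
qed simp

text \<open>Vanishing beyond some radius is the form of compact support that the estimates
  use.\<close>

lemma Cc_infinity_iff: "f \<in> Cc_infinity \<longleftrightarrow> (\<forall>k. Ck k f) \<and> (\<exists>R. \<forall>x. R \<le> norm x \<longrightarrow> f x = 0)"
proof -
  have "bounded {x. f x \<noteq> 0} \<longleftrightarrow> (\<exists>R. \<forall>x. R \<le> norm x \<longrightarrow> f x = 0)"
  proof
    assume "bounded {x. f x \<noteq> 0}"
    then obtain R where R: "\<And>x. f x \<noteq> 0 \<Longrightarrow> norm x \<le> R" by (auto simp: bounded_iff)
    have "\<forall>x. R + 1 \<le> norm x \<longrightarrow> f x = 0" using R by force
    then show "\<exists>R. \<forall>x. R \<le> norm x \<longrightarrow> f x = 0" ..
  next
    assume "\<exists>R. \<forall>x. R \<le> norm x \<longrightarrow> f x = 0"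
    then obtain R where "\<forall>x. R \<le> norm x \<longrightarrow> f x = 0" ..
    then show "bounded {x. f x \<noteq> 0}"
      unfolding bounded_iff by (metis (mono_tags) linear mem_Collect_eq)
  qed
  then show ?thesis by (simp add: Cc_infinity_def compact_closure)
qed

text \<open>The mass is a nonnegative integral, so that integrability is part of the
  condition.\<close>

definition mollifier :: "(real^'n \<Rightarrow> real) \<Rightarrow> bool" where
  "mollifier j \<longleftrightarrow> j \<in> Cc_infinity \<and> (\<forall>z. 0 \<le> j z) \<and> (\<integral>\<^sup>+z. ennreal (j z) \<partial>lborel) = 1"

text \<open>Averaging rescaled bumps over \<open>m\<close> dyadic scales gives mollifiers dominated by a small multiple
  of the singular kernel, because that kernel is not integrable at \<open>0\<close>.\<close>

lemma mollifier_exists: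
  "\<exists>A>0. \<forall>m>0. \<exists>j :: real^'n \<Rightarrow> real.
    mollifier j \<and> (\<forall>z. z \<noteq> 0 \<longrightarrow> j z \<le> A / real m * sing_kernel z)"
proof -
  obtain a where a: "0 < a" "(\<integral>\<^sup>+x. ennreal (bump 0 1 x) \<partial>(lborel :: (real^'n) measure)) = ennreal a"
    by (rule bump_integral)
  let ?q = "(2::real) ^ CARD('n)"
  have q2: "2 \<le> ?q" using power_increasing[of 1 "CARD('n)" "2::real"] by simp
  have "\<exists>j :: real^'n \<Rightarrow> real. mollifier j \<and> (\<forall>z. z \<noteq> 0 \<longrightarrow> j z \<le> (2 / a) / real m * sing_kernel z)"
    if m: "0 < m" for m
  proof -
    \<comment> \<open>Each summand is the standard bump shrunk by 2^k and multiplied so as to keep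
      its mass \<open>a\<close>; the sum has mass m a.\<close>
    define w :: "real^'n \<Rightarrow> real" where "w = (\<lambda>z. \<Sum>k<m. ?q ^ k * bump 0 (4 ^ k) z)"
    define j where "j = (\<lambda>z. (1 / (real m * a)) * w z)"
    have zero: "bump 0 (4 ^ k) z = 0" if "1 \<le> 2 ^ k * norm z" for k and z :: "real^'n"
      unfolding bump_scale using that by (intro bump_eq_0) simp
    have far: "w z = 0" if "1 \<le> norm z" for z
    proof -
      have "bump 0 (4 ^ k) z = 0" for k
        using that mult_mono[of 1 "2 ^ k" 1 "norm z"] by (intro zero) auto
      then show ?thesis by (simp add: w_def)
    qed
    have w0: "0 \<le> w z" for z
      unfolding w_def by (intro sum_nonneg mult_nonneg_nonneg bump_nonneg) auto
    have wm [measurable]: "w \<in> borel_measurable borel"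
      unfolding w_def by measurable
    have "(\<integral>\<^sup>+z. ennreal (w z) \<partial>lborel) = (\<Sum>k<m. (\<integral>\<^sup>+z. ennreal (?q ^ k * bump 0 (4 ^ k) (z :: real^'n)) \<partial>lborel))"
      unfolding w_def by (subst nn_integral_sum[symmetric]) (auto simp: sum_ennreal)
    also have "\<dots> = (\<Sum>k<m. ennreal a)"
    proof (rule sum.cong[OF refl])
      fix k
      have "?q ^ k = \<bar>2 ^ k\<bar> ^ CARD('n)" by (simp add: power_mult[symmetric] mult.commute)
      then have "(\<integral>\<^sup>+z. ennreal (?q ^ k * bump 0 (4 ^ k) (z :: real^'n)) \<partial>lborel)
          = (\<integral>\<^sup>+z. ennreal (\<bar>2 ^ k\<bar> ^ CARD('n)) * ennreal (bump 0 1 ((2 ^ k) *\<^sub>R z :: real^'n)) \<partial>lborel)"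
        by (intro nn_integral_cong) (simp only: bump_scale, subst ennreal_mult, auto)
      also have "\<dots> = (\<integral>\<^sup>+z. ennreal (bump 0 1 (z :: real^'n)) \<partial>lborel)"
        by (rule nn_integral_lborel_scale) auto
      finally show "(\<integral>\<^sup>+z. ennreal (?q ^ k * bump 0 (4 ^ k) (z :: real^'n)) \<partial>lborel) = ennreal a"
        using a by simp
    qed
    also have "\<dots> = ennreal (real m * a)"
      using a by (simp add: ennreal_mult ennreal_of_nat_eq_real_of_nat)
    finally have wint: "(\<integral>\<^sup>+z. ennreal (w z) \<partial>lborel) = ennreal (real m * a)" .
    have ma: "0 < real m * a" using m a by simp
    have "(\<integral>\<^sup>+z. ennreal (j z) \<partial>lborel) = ennreal (1 / (real m * a)) * ennreal (real m * a)"
      unfolding j_def wint[symmetric] using ma w0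
      by (subst nn_integral_cmult[symmetric]) (auto simp: ennreal_mult[symmetric])
    also have "\<dots> = ennreal (1 / (real m * a) * (real m * a))"
      using ma by (subst ennreal_mult) auto
    also have "\<dots> = 1"
      using m a by simp
    finally have jint: "(\<integral>\<^sup>+z. ennreal (j z) \<partial>lborel) = 1" .
    have "Ck k j" for k
      unfolding j_def w_def by (intro Ck_mult Ck_sum Ck_const Ck_bump)
    then have "j \<in> Cc_infinity"
      using far by (auto simp: Cc_infinity_iff j_def intro!: exI[of _ 1])
    then have "mollifier j"
      using jint w0 ma by (auto simp: mollifier_def j_def)
    moreover have "j z \<le> (2 / a) / real m * sing_kernel z" if z: "z \<noteq> 0" for z
    proof (cases "1 \<le> norm z")
      case True
      then show ?thesis using far[OF True] a by (simp add: j_def)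
    next
      case False
      let ?s = "norm z ^ CARD('n)"
      have s: "0 < ?s" using z by simp
      \<comment> \<open>The k-th bump vanishes at z unless 2^k |z| < 1, that is q^k |z|^N < 1, so
        only a truncated geometric series survives. Its bound 2 and the mass \<open>a\<close> make
        up the constant 2/a.\<close>
      have "w z \<le> (\<Sum>k<m. if ?q ^ k * ?s < 1 then ?q ^ k else 0)"
        unfolding w_def
      proof (rule sum_mono)
        fix k
        show "?q ^ k * bump 0 (4 ^ k) z \<le> (if ?q ^ k * ?s < 1 then ?q ^ k else 0)"
        proof (cases "?q ^ k * ?s < 1")
          case True
          then show ?thesis using bump_le_1[of "4 ^ k" z] by (simp add: mult_left_le)
        next
          case False
          have eq: "?q ^ k * ?s = (2 ^ k * norm z) ^ CARD('n)"
            by (simp add: power_mult_distrib power_mult[symmetric] mult.commute)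
          have "1 \<le> 2 ^ k * norm z"
          proof (rule ccontr)
            assume "\<not> 1 \<le> 2 ^ k * norm z"
            then have "(2 ^ k * norm z) ^ CARD('n) < 1" by (simp add: power_less_one_iff)
            then show False using False eq by simp
          qed
          then show ?thesis using zero[of k z] False by simp
        qed
      qed
      then have "w z * ?s \<le> (\<Sum>k<m. if ?q ^ k * ?s < 1 then ?q ^ k else 0) * ?s"
        using s by (intro mult_right_mono) auto
      also have "\<dots> \<le> 2"
        using q2 s by (intro geometric_cutoff_sum) auto
      finally have "w z \<le> 2 / ?s" using s by (simp add: field_simps)
      then have "j z \<le> (1 / (real m * a)) * (2 / ?s)"
        unfolding j_def using ma by (intro mult_left_mono) auto
      then show ?thesis using False by (simp add: sing_kernel_def mult.commute)
    qed
    ultimately show ?thesis by blast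
  qed
  then show ?thesis using a by (intro exI[of _ "2 / a"]) auto
qed

section \<open>Correlation with a mollifier\<close>

lemma Cc_infinity_bounded:
  assumes "f \<in> Cc_infinity"
  shows "\<exists>B\<ge>0. \<forall>x. \<bar>f x\<bar> \<le> B"
proof -
  obtain R where R: "\<And>x. R \<le> norm x \<Longrightarrow> f x = 0" and c: "continuous_on UNIV f"
    using assms by (auto simp: Cc_infinity_iff intro: Ck_continuous)
  have "compact (f ` cball 0 R)"
    using c by (intro compact_continuous_image) (auto intro: continuous_on_subset)
  then have "\<exists>B. \<forall>x\<in>cball 0 R. \<bar>f x\<bar> \<le> B"
    by (auto dest!: compact_imp_bounded simp: bounded_iff)
  then obtain B where B: "\<And>x. x \<in> cball 0 R \<Longrightarrow> \<bar>f x\<bar> \<le> B"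
    by blast
  have "\<bar>f x\<bar> \<le> max 0 B" for x
    using B[of x] R[of x] by (cases "norm x \<le> R") auto
  then show ?thesis by (intro exI[of _ "max 0 B"]) auto
qed

lemma Cc_infinity_deriv:
  assumes "f \<in> Cc_infinity"
  shows "(f has_derivative frechet_derivative f (at x)) (at x)"
    and "(\<lambda>x. frechet_derivative f (at x) h) \<in> Cc_infinity"
proof -
  obtain R where R: "\<And>x. R \<le> norm x \<Longrightarrow> f x = 0" and k: "\<And>k. Ck k f"
    using assms by (auto simp: Cc_infinity_iff)
  show "(f has_derivative frechet_derivative f (at x)) (at x)"
    by (rule Ck_SucD(1)[OF k])
  \<comment> \<open>The extra 1 puts y inside the open set where f vanishes, so the derivative there
    is that of the zero function.\<close>
  have "frechet_derivative f (at y) h = 0" if y: "R + 1 \<le> norm y" for y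
  proof -
    have "open {x::real^'a. R < norm x}"
      by (rule open_Collect_less) (auto intro: continuous_intros)
    then have "(f has_derivative (\<lambda>_. 0)) (at y)"
      using R y by (intro has_derivative_transform_within_open[OF has_derivative_const[of 0]]) auto
    then have "(\<lambda>_. 0) = frechet_derivative f (at y)"
      by (rule frechet_derivative_at)
    then show ?thesis by (metis)
  qed
  then show "(\<lambda>x. frechet_derivative f (at x) h) \<in> Cc_infinity"
    using Ck_SucD(2)[OF k] by (auto simp: Cc_infinity_iff simp del: Ck.simps)
qed

lemma Cc_infinity_measurable: "f \<in> Cc_infinity \<Longrightarrow> f \<in> borel_measurable borel"
  unfolding Cc_infinity_iff by (intro borel_measurable_continuous_onI Ck_continuous[of 0]) blast

text \<open>Bounds for the finitely many coordinate derivatives give one for every direction, and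
  the mean value inequality gives the Lipschitz estimate. The common \<open>L\<close> will dominate
  difference quotients together with their linear part.\<close>

lemma Cc_infinity_lipschitz:
  fixes f :: "real^'n \<Rightarrow> real"
  assumes "f \<in> Cc_infinity"
  shows "\<exists>L\<ge>0. (\<forall>x y. \<bar>f x - f y\<bar> \<le> L * norm (x - y)) \<and>
    (\<forall>x h. \<bar>frechet_derivative f (at x) h\<bar> \<le> L * norm h)"
proof -
  have "\<exists>B. \<forall>b::real^'n. 0 \<le> B b \<and> (\<forall>x. \<bar>frechet_derivative f (at x) b\<bar> \<le> B b)"
    by (intro choice allI) (metis Cc_infinity_bounded[OF Cc_infinity_deriv(2)[OF assms]])
  then obtain B where B: "\<And>b::real^'n. 0 \<le> B b" "\<And>x b. \<bar>frechet_derivative f (at x) b\<bar> \<le> B b"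
    by blast
  define L where "L = (\<Sum>b\<in>Basis. B (b :: real^'n))"
  have L0: "0 \<le> L" unfolding L_def by (intro sum_nonneg B)
  have D: "\<bar>frechet_derivative f (at x) h\<bar> \<le> L * norm h" for x h
  proof -
    interpret bounded_linear "frechet_derivative f (at x)"
      using Cc_infinity_deriv(1)[OF assms] by (rule has_derivative_bounded_linear)
    have "frechet_derivative f (at x) h = frechet_derivative f (at x) (\<Sum>b\<in>Basis. (h \<bullet> b) *\<^sub>R b)"
      by (simp add: euclidean_representation)
    also have "\<dots> = (\<Sum>b\<in>Basis. (h \<bullet> b) * frechet_derivative f (at x) b)"
      by (simp add: sum scaleR)
    finally have "\<bar>frechet_derivative f (at x) h\<bar> \<le> (\<Sum>b\<in>Basis. \<bar>(h \<bullet> b) * frechet_derivative f (at x) b\<bar>)"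
      by (simp add: sum_abs)
    also have "\<dots> \<le> (\<Sum>b\<in>Basis. norm h * B b)"
      unfolding abs_mult by (intro sum_mono mult_mono B Basis_le_norm) auto
    also have "\<dots> = L * norm h" by (simp add: L_def sum_distrib_left mult.commute)
    finally show ?thesis .
  qed
  have "norm (f x - f y) \<le> L * norm (x - y)" for x y
  proof (rule differentiable_bound[of UNIV f "\<lambda>x. frechet_derivative f (at x)"])
    show "(f has_derivative frechet_derivative f (at x)) (at x within UNIV)" for x
      using Cc_infinity_deriv(1)[OF assms] by simp
    show "onorm (frechet_derivative f (at x)) \<le> L" for x
      using D by (intro onorm_bound L0) auto
  qed auto
  then show ?thesis using L0 D by auto
qed

section \<open>Smoothness of correlations\<close>

lemma integral_lborel_shift:
  fixes f :: "'a::euclidean_space \<Rightarrow> real"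
  assumes [measurable]: "f \<in> borel_measurable borel"
  shows "(\<integral>y. f (c + y) \<partial>lborel) = (\<integral>y. f y \<partial>lborel)"
  by (subst (2) lborel_distr_plus[of c, symmetric]) (simp add: integral_distr)


text \<open>Convolution with the reflected kernel. Here x occurs in \<open>j\<close> alone, which
  suits differentiation; substituting y = x + z gives the integral of u(x + z) against j(z), which
  fits \<open>shift_sq\<close>.\<close>

definition correlate :: "(real^'n \<Rightarrow> real) \<Rightarrow> (real^'n \<Rightarrow> real) \<Rightarrow> real^'n \<Rightarrow> real" where
  "correlate u j x = (\<integral>y. u y * j (y - x) \<partial>lborel)"

text \<open>Differentiation under the integral by dominated convergence along sequences: the
  remainder quotient is at most 2 L, so 2 L |u| dominates. The derivative in direction h is again a
  correlation with a test function, which lets \<open>Ck_correlate\<close> iterate.\<close>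

lemma correlate_deriv:
  fixes u j :: "real^'n \<Rightarrow> real"
  assumes u: "integrable lborel u" and j: "j \<in> Cc_infinity"
  shows "(correlate u j has_derivative
    (\<lambda>h. correlate u (\<lambda>z. - frechet_derivative j (at z) h) x)) (at x)"
proof -
  let ?D = "\<lambda>z h. frechet_derivative j (at z) h"
  obtain L where L: "0 \<le> L" "\<And>x y. \<bar>j x - j y\<bar> \<le> L * norm (x - y)" "\<And>x h. \<bar>?D x h\<bar> \<le> L * norm h"
    using Cc_infinity_lipschitz[OF j] by blast
  have [measurable]: "u \<in> borel_measurable borel" "j \<in> borel_measurable borel"
    using u j by (auto dest: borel_measurable_integrable Cc_infinity_measurable)
  have Dm [measurable]: "(\<lambda>z. ?D z h) \<in> borel_measurable borel" for h
    by (rule Cc_infinity_measurable[OF Cc_infinity_deriv(2)[OF j]])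
  obtain B where B: "0 \<le> B" "\<And>x. \<bar>j x\<bar> \<le> B"
    using Cc_infinity_bounded[OF j] by blast
  have bd: "integrable lborel (\<lambda>y. u y * g y)"
    if "g \<in> borel_measurable borel" "\<And>y. \<bar>g y\<bar> \<le> M" for g M
  proof (rule Bochner_Integration.integrable_bound)
    show "integrable lborel (\<lambda>y. \<bar>M\<bar> * u y)" using u by simp
    have "\<bar>u y\<bar> * \<bar>g y\<bar> \<le> \<bar>M\<bar> * \<bar>u y\<bar>" for y
      using that(2)[of y] by (subst mult.commute) (intro mult_right_mono, auto)
    then show "AE y in lborel. norm (u y * g y) \<le> norm (\<bar>M\<bar> * u y)"
      by (intro AE_I2) (simp add: abs_mult)
  qed (use that in measurable)
  have i1: "integrable lborel (\<lambda>y. u y * j (y - z))" for z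
    by (rule bd[OF _ B(2)]) measurable
  have i2: "integrable lborel (\<lambda>y. u y * ?D (y - z) h)" for z h
    by (rule bd[OF _ L(3)]) measurable
  have lin: "linear (?D z)" for z
    using Cc_infinity_deriv(1)[OF j] by (intro bounded_linear.linear has_derivative_bounded_linear)
  have neg: "correlate u (\<lambda>z. - ?D z h) x = - (\<integral>y. u y * ?D (y - x) h \<partial>lborel)" for h
    by (simp add: correlate_def)
  have "linear (\<lambda>h. correlate u (\<lambda>z. - ?D z h) x)"
    unfolding neg
  proof (rule linearI)
    fix a b :: "real^'n" and c :: real
    show "- (\<integral>y. u y * ?D (y - x) (a + b) \<partial>lborel)
      = - (\<integral>y. u y * ?D (y - x) a \<partial>lborel) + - (\<integral>y. u y * ?D (y - x) b \<partial>lborel)"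
      using i2 by (simp add: linear_add[OF lin] distrib_left)
    show "- (\<integral>y. u y * ?D (y - x) (c *\<^sub>R a) \<partial>lborel) = c *\<^sub>R - (\<integral>y. u y * ?D (y - x) a \<partial>lborel)"
      by (simp add: linear_cmul[OF lin] mult.left_commute)
  qed
  then have bl: "bounded_linear (\<lambda>h. correlate u (\<lambda>z. - ?D z h) x)"
    by (simp add: linear_conv_bounded_linear)
  have "((\<lambda>y. norm ((correlate u j y - correlate u j x) - correlate u (\<lambda>z. - ?D z (y - x)) x) / norm (y - x)) \<longlongrightarrow> 0) (at x)"
    unfolding tendsto_at_iff_sequentially
  proof (intro allI impI)
    fix X :: "nat \<Rightarrow> real^'n"
    assume X: "\<forall>i. X i \<in> UNIV - {x}" and lim: "X \<longlonglongrightarrow> x"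
    \<comment> \<open>Remainder quotient of the first order expansion of \<open>j\<close> at y - x.
      The argument moves by -(X i - x), whence the plus sign before the derivative.\<close>
    define q where "q = (\<lambda>i y. (j (y - X i) - j (y - x) + ?D (y - x) (X i - x)) / norm (X i - x))"
    have Xn: "0 < norm (X i - x)" for i using X by auto
    have qm [measurable]: "q i \<in> borel_measurable borel" for i
      unfolding q_def by measurable
    have qb: "\<bar>q i y\<bar> \<le> 2 * L" for i y
    proof -
      have "\<bar>j (y - X i) - j (y - x) + ?D (y - x) (X i - x)\<bar> \<le> L * norm (X i - x) + L * norm (X i - x)"
        using L(2)[of "y - X i" "y - x"] L(3)[of "y - x" "X i - x"]
        by (simp add: norm_minus_commute)
      then show ?thesis using Xn[of i] by (simp add: q_def field_simps)
    qed
    have q0: "(\<lambda>i. q i y) \<longlonglongrightarrow> 0" for y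
    proof -
      have "((\<lambda>x'. j (y - x')) has_derivative (\<lambda>h. ?D (y - x) (0 - h))) (at x)"
        by (rule has_derivative_compose[OF has_derivative_diff[OF has_derivative_const has_derivative_ident]
            Cc_infinity_deriv(1)[OF j]])
      then have "((\<lambda>x'. norm (j (y - x') - j (y - x) - ?D (y - x) (0 - (x' - x))) / norm (x' - x)) \<longlongrightarrow> 0) (at x)"
        by (simp add: has_derivative_iff_norm)
      then have "((\<lambda>x'. norm (j (y - x') - j (y - x) - ?D (y - x) (0 - (x' - x))) / norm (x' - x)) \<circ> X) \<longlonglongrightarrow> 0"
        using X lim unfolding tendsto_at_iff_sequentially by blast
      moreover have "?D (y - x) (0 - h) = - ?D (y - x) h" for h
        using linear_neg[OF lin] by simp
      then have "(\<lambda>x'. norm (j (y - x') - j (y - x) - ?D (y - x) (0 - (x' - x))) / norm (x' - x)) \<circ> X = (\<lambda>i. \<bar>q i y\<bar>)"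
        by (simp only: q_def comp_def diff_minus_eq_add abs_divide real_norm_def abs_norm_cancel)
      ultimately have "(\<lambda>i. \<bar>q i y\<bar>) \<longlonglongrightarrow> 0"
        by simp
      then show ?thesis by (rule tendsto_rabs_zero_cancel)
    qed
    have "(\<lambda>i. \<integral>y. u y * q i y \<partial>lborel) \<longlonglongrightarrow> (\<integral>y. u y * 0 \<partial>lborel)"
    proof (rule integral_dominated_convergence)
      show "integrable lborel (\<lambda>y. 2 * L * \<bar>u y\<bar>)" using u by simp
      show "AE y in lborel. norm (u y * q i y) \<le> 2 * L * \<bar>u y\<bar>" for i
        using qb[of i] by (intro AE_I2) (simp add: abs_mult mult.commute mult_left_mono)
      show "AE y in lborel. (\<lambda>i. u y * q i y) \<longlonglongrightarrow> u y * 0"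
        by (intro AE_I2 tendsto_mult tendsto_const q0)
    qed measurable
    then have "(\<lambda>i. norm (\<integral>y. u y * q i y \<partial>lborel)) \<longlonglongrightarrow> 0"
      by (simp add: tendsto_rabs_zero)
    moreover have "norm (\<integral>y. u y * q i y \<partial>lborel)
        = norm ((correlate u j (X i) - correlate u j x) - correlate u (\<lambda>z. - ?D z (X i - x)) x) / norm (X i - x)" for i
    proof -
      have "(\<integral>y. u y * q i y \<partial>lborel) = (\<integral>y. (u y * j (y - X i) - u y * j (y - x) + u y * ?D (y - x) (X i - x)) / norm (X i - x) \<partial>lborel)"
        by (simp add: q_def algebra_simps)
      also have "\<dots> = (correlate u j (X i) - correlate u j x - correlate u (\<lambda>z. - ?D z (X i - x)) x) / norm (X i - x)"
        using i1 i2 by (simp add: neg correlate_def)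
      finally show ?thesis by simp
    qed
    ultimately show "((\<lambda>y. norm ((correlate u j y - correlate u j x) - correlate u (\<lambda>z. - ?D z (y - x)) x) / norm (y - x)) \<circ> X) \<longlonglongrightarrow> 0"
      by (simp add: comp_def)
  qed
  with bl show ?thesis by (simp add: has_derivative_iff_norm)
qed

lemma Cc_infinity_uminus: "f \<in> Cc_infinity \<Longrightarrow> (\<lambda>x. - f x) \<in> Cc_infinity"
  using Ck_mult[OF Ck_const[of _ "-1"], of _ f] by (auto simp: Cc_infinity_iff)

lemma Ck_correlate:
  assumes "integrable lborel u" "j \<in> Cc_infinity"
  shows "Ck k (correlate u j)"
  using assms(2)
proof (induction k arbitrary: j)
  case 0
  have "isCont (correlate u j) x" for x
    using correlate_deriv[OF assms(1) 0] by (rule has_derivative_continuous)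
  then show ?case by (simp add: continuous_at_imp_continuous_on)
next
  case (Suc k)
  show ?case
    by (rule Ck_SucI[OF correlate_deriv[OF assms(1) Suc.prems]
        Suc.IH[OF Cc_infinity_uminus[OF Cc_infinity_deriv(2)[OF Suc.prems]]]])
qed

lemma correlate_eq_0:
  fixes u j :: "real^'n \<Rightarrow> real"
  assumes u: "\<And>y. R \<le> norm y \<Longrightarrow> u y = 0" and j: "\<And>z. S \<le> norm z \<Longrightarrow> j z = 0"
    and x: "R + S \<le> norm x"
  shows "correlate u j x = 0"
proof -
  have "u y * j (y - x) = 0" for y
  proof (cases "R \<le> norm y")
    case False
    then have "S \<le> norm (y - x)"
      using x norm_triangle_ineq2[of x y] by (simp add: norm_minus_commute)
    then show ?thesis by (simp add: j)
  qed (simp add: u)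
  then have "correlate u j x = (\<integral>y. 0 \<partial>(lborel :: (real^'n) measure))"
    unfolding correlate_def by (intro Bochner_Integration.integral_cong) auto
  then show ?thesis by simp
qed

lemma correlate_Cc_infinity:
  assumes u: "integrable lborel u" "\<And>y. R \<le> norm y \<Longrightarrow> u y = 0" and j: "j \<in> Cc_infinity"
  shows "correlate u j \<in> Cc_infinity"
proof -
  obtain S where "\<And>z. S \<le> norm z \<Longrightarrow> j z = 0"
    using j by (auto simp: Cc_infinity_iff)
  then show ?thesis
    using Ck_correlate[OF u(1) j] correlate_eq_0[of R u S j] u(2)
    unfolding Cc_infinity_iff by blast
qed

lemma correlate_shift:
  assumes [measurable]: "u \<in> borel_measurable borel" "j \<in> borel_measurable borel"
  shows "correlate u j x = (\<integral>z. u (x + z) * j z \<partial>lborel)"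
  unfolding correlate_def
  by (subst integral_lborel_shift[of _ x, symmetric]) auto

section \<open>Estimates of correlations in the mean square\<close>

lemma Cc_infinity_sq_integrable:
  fixes j :: "real^'n \<Rightarrow> real"
  assumes j: "j \<in> Cc_infinity"
  shows "j \<in> sq_integrable"
proof -
  from j have [measurable]: "j \<in> borel_measurable borel" by (rule Cc_infinity_measurable)
  obtain B where B: "0 \<le> B" "\<And>x. \<bar>j x\<bar> \<le> B" using Cc_infinity_bounded[OF j] by blast
  obtain R where R: "\<And>x. R \<le> norm x \<Longrightarrow> j x = 0" using j by (auto simp: Cc_infinity_iff)
  have "l2_sq j \<le> (\<integral>\<^sup>+x. ennreal (B\<^sup>2) * indicator (ball (0::real^'n) R) x \<partial>lborel)"
    unfolding l2_sq_def
  proof (rule nn_integral_mono)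
    fix x
    have "(j x)\<^sup>2 \<le> B\<^sup>2" using power_mono[OF B(2)[of x], of 2] by simp
    then show "ennreal ((j x)\<^sup>2) \<le> ennreal (B\<^sup>2) * indicator (ball 0 R) x"
      using R[of x] by (auto simp: indicator_def not_less ennreal_leI)
  qed
  also have "\<dots> = ennreal (B\<^sup>2) * emeasure lborel (ball (0::real^'n) R)"
    by (simp add: nn_integral_cmult_indicator)
  also have "\<dots> < \<infinity>"
    using emeasure_lborel_ball_finite[of "0::real^'n" R] by (simp add: ennreal_mult_less_top)
  finally show ?thesis by (simp add: sq_integrable_iff)
qed

lemma sq_integrable_shift: "u \<in> sq_integrable \<Longrightarrow> (\<lambda>z. u (x + z)) \<in> sq_integrable"
proof -
  assume u: "u \<in> sq_integrable"
  then have [measurable]: "u \<in> borel_measurable borel" by (simp add: sq_integrable_iff)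
  have "l2_sq (\<lambda>z. u (x + z)) = l2_sq u"
    unfolding l2_sq_def by (rule nn_integral_lborel_shift[where f = "\<lambda>y. ennreal ((u y)\<^sup>2)"]) measurable
  then show ?thesis using u by (simp add: sq_integrable_iff)
qed

text \<open>The variance is nonnegative: expand the integral of w (f - c)^2 with c the mean. If the
  right-hand side is infinite there is nothing to prove.\<close>

lemma jensen_sq:
  fixes f w :: "'a \<Rightarrow> real"
  assumes [measurable]: "f \<in> borel_measurable M" "w \<in> borel_measurable M"
    and w: "\<And>x. 0 \<le> w x" "(\<integral>\<^sup>+x. ennreal (w x) \<partial>M) = 1"
  shows "ennreal ((\<integral>x. f x * w x \<partial>M)\<^sup>2) \<le> (\<integral>\<^sup>+x. ennreal (w x * (f x)\<^sup>2) \<partial>M)"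
proof (cases "(\<integral>\<^sup>+x. ennreal (w x * (f x)\<^sup>2) \<partial>M) < \<infinity>")
  case True
  have wi: "integrable M w" "(\<integral>x. w x \<partial>M) = 1"
    using w by (auto intro: integrableI_nn_integral_finite[where x = 1] simp: integral_eq_nn_integral)
  have f2: "integrable M (\<lambda>x. w x * (f x)\<^sup>2)"
    using True w by (auto simp: integrable_iff_bounded)
  \<comment> \<open>Writing f as f * 1, integrability of w f follows from that of w f^2 and of
    w.\<close>
  have fi: "integrable M (\<lambda>x. w x * (f x * 1))"
    using True w by (intro integrable_weighted_prod) auto
  define c where "c = (\<integral>x. w x * f x \<partial>M)"
  have "0 \<le> (\<integral>x. w x * (f x - c)\<^sup>2 \<partial>M)"
    using w by (intro Bochner_Integration.integral_nonneg) auto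
  also have "\<dots> = (\<integral>x. w x * (f x)\<^sup>2 - 2 * c * (w x * f x) + c\<^sup>2 * w x \<partial>M)"
    by (intro Bochner_Integration.integral_cong) (auto simp: power2_eq_square algebra_simps)
  also have "\<dots> = (\<integral>x. w x * (f x)\<^sup>2 \<partial>M) - 2 * c * c + c\<^sup>2"
    using wi f2 fi by (simp add: c_def)
  finally have "c\<^sup>2 \<le> (\<integral>x. w x * (f x)\<^sup>2 \<partial>M)"
    by (simp add: power2_eq_square)
  then have "ennreal (c\<^sup>2) \<le> ennreal (\<integral>x. w x * (f x)\<^sup>2 \<partial>M)"
    by (rule ennreal_leI)
  also have "\<dots> = (\<integral>\<^sup>+x. ennreal (w x * (f x)\<^sup>2) \<partial>M)"
    using f2 w by (intro nn_integral_eq_integral[symmetric]) auto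
  finally show ?thesis by (simp add: c_def mult.commute)
qed (simp add: not_less top_unique)

lemma mollifierD:
  assumes "mollifier j"
  shows "j \<in> Cc_infinity" "0 \<le> j z" "(\<integral>\<^sup>+z. ennreal (j z) \<partial>lborel) = 1" "j \<in> borel_measurable borel"
    "integrable lborel j" "(\<integral>z. j z \<partial>lborel) = 1"
proof -
  show *: "j \<in> Cc_infinity" "0 \<le> j z" "(\<integral>\<^sup>+z. ennreal (j z) \<partial>lborel) = 1" for z
    using assms by (auto simp: mollifier_def)
  show m: "j \<in> borel_measurable borel" using *(1) by (rule Cc_infinity_measurable)
  show "integrable lborel j" "(\<integral>z. j z \<partial>lborel) = 1"
    using * m by (auto intro: integrableI_nn_integral_finite[where x = 1] simp: integral_eq_nn_integral)
qed

lemma correlate_measurable [measurable]: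
  assumes [measurable]: "u \<in> borel_measurable borel" "j \<in> borel_measurable borel"
  shows "correlate u j \<in> borel_measurable borel"
  unfolding correlate_def[abs_def] by measurable

lemma l2_sq_correlate_diff_le:
  fixes u j :: "real^'n \<Rightarrow> real"
  assumes j: "mollifier j" and u: "u \<in> sq_integrable"
  shows "l2_sq (\<lambda>x. correlate u j x - u x) \<le> (\<integral>\<^sup>+z. ennreal (j z) * shift_sq u z \<partial>lborel)"
proof -
  note j' = mollifierD[OF j]
  note [measurable] = j'(4)
  have [measurable]: "u \<in> borel_measurable borel" using u by (simp add: sq_integrable_iff)
  \<comment> \<open>Mass 1 of \<open>j\<close> turns the difference into an average of increments of
    \<open>u\<close>.\<close>
  have eq: "correlate u j x - u x = (\<integral>z. (u (x + z) - u x) * j z \<partial>lborel)" for x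
  proof -
    have "integrable lborel (\<lambda>z. u (x + z) * j z)"
      by (intro sq_integrable_mult sq_integrable_shift u Cc_infinity_sq_integrable j')
    then show ?thesis
      using j' by (simp add: correlate_shift left_diff_distrib)
  qed
  have "l2_sq (\<lambda>x. correlate u j x - u x) \<le> (\<integral>\<^sup>+x. \<integral>\<^sup>+z. ennreal (j z * (u (x + z) - u x)\<^sup>2) \<partial>lborel \<partial>lborel)"
    unfolding l2_sq_def eq using j' by (intro nn_integral_mono jensen_sq) auto
  also have "\<dots> = (\<integral>\<^sup>+z. \<integral>\<^sup>+x. ennreal (j z * (u (x + z) - u x)\<^sup>2) \<partial>lborel \<partial>lborel)"
    by (rule lborel_pair.Fubini') measurable
  also have "\<dots> = (\<integral>\<^sup>+z. ennreal (j z) * shift_sq u z \<partial>lborel)"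
    unfolding shift_sq_def using j'
    by (intro nn_integral_cong) (simp add: ennreal_mult nn_integral_cmult)
  finally show ?thesis .
qed

text \<open>Jensen's inequality and translation invariance make the correlation a contraction. It is
  used to dominate the mollification error uniformly in the scale.\<close>

lemma l2_sq_correlate_le:
  fixes u j :: "real^'n \<Rightarrow> real"
  assumes j: "mollifier j" and u: "u \<in> sq_integrable"
  shows "l2_sq (correlate u j) \<le> l2_sq u"
proof -
  note j' = mollifierD[OF j]
  note [measurable] = j'(4)
  have [measurable]: "u \<in> borel_measurable borel" using u by (simp add: sq_integrable_iff)
  have "l2_sq (correlate u j) \<le> (\<integral>\<^sup>+x. \<integral>\<^sup>+z. ennreal (j z * (u (x + z))\<^sup>2) \<partial>lborel \<partial>lborel)"
    unfolding l2_sq_def using j' by (intro nn_integral_mono) (subst correlate_shift; auto intro!: jensen_sq)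
  also have "\<dots> = (\<integral>\<^sup>+z. \<integral>\<^sup>+x. ennreal (j z * (u (x + z))\<^sup>2) \<partial>lborel \<partial>lborel)"
    by (rule lborel_pair.Fubini') measurable
  also have "\<dots> = (\<integral>\<^sup>+z. ennreal (j z) * l2_sq u \<partial>lborel)"
  proof (rule nn_integral_cong)
    fix z
    have "(\<integral>\<^sup>+x. ennreal (j z * (u (x + z))\<^sup>2) \<partial>lborel) = ennreal (j z) * (\<integral>\<^sup>+x. ennreal ((u (z + x))\<^sup>2) \<partial>lborel)"
      using j' by (simp add: ennreal_mult nn_integral_cmult add.commute)
    also have "(\<integral>\<^sup>+x. ennreal ((u (z + x))\<^sup>2) \<partial>lborel) = l2_sq u"
      unfolding l2_sq_def by (rule nn_integral_lborel_shift[where f = "\<lambda>y. ennreal ((u y)\<^sup>2)"]) measurable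
    finally show "(\<integral>\<^sup>+x. ennreal (j z * (u (x + z))\<^sup>2) \<partial>lborel) = ennreal (j z) * l2_sq u" .
  qed
  also have "\<dots> = l2_sq u"
    using j' by (simp add: nn_integral_multc)
  finally show ?thesis .
qed

lemma l2_sq_correlate_diff_le_gagliardo:
  fixes u j :: "real^'n \<Rightarrow> real"
  assumes j: "mollifier j" and u: "u \<in> sq_integrable"
    and le: "\<And>z. z \<noteq> 0 \<Longrightarrow> j z \<le> d * sing_kernel z" and d: "0 \<le> d"
  shows "l2_sq (\<lambda>x. correlate u j x - u x) \<le> ennreal d * gagliardo u"
proof -
  have [measurable]: "u \<in> borel_measurable borel" using u by (simp add: sq_integrable_iff)
  have "l2_sq (\<lambda>x. correlate u j x - u x) \<le> (\<integral>\<^sup>+z. ennreal (j z) * shift_sq u z \<partial>lborel)"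
    by (rule l2_sq_correlate_diff_le[OF j u])
  also have "\<dots> \<le> (\<integral>\<^sup>+z. ennreal d * (ennreal (sing_kernel z) * shift_sq u z) \<partial>lborel)"
  proof (rule nn_integral_mono)
    fix z
    show "ennreal (j z) * shift_sq u z \<le> ennreal d * (ennreal (sing_kernel z) * shift_sq u z)"
    \<comment> \<open>Division by zero gives \<open>sing_kernel 0 = 0\<close>, so no kernel bound is
      available at 0; there \<open>shift_sq\<close> vanishes instead.\<close>
    proof (cases "z = 0")
      case True
      then show ?thesis by (simp add: shift_sq_def)
    next
      case False
      have "ennreal (j z) \<le> ennreal d * ennreal (sing_kernel z)"
        using le[OF False] d by (simp add: ennreal_mult[symmetric] ennreal_leI)
      then show ?thesis
        by (simp add: mult.assoc[symmetric] mult_right_mono)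
    qed
  qed
  also have "\<dots> = ennreal d * gagliardo u"
    unfolding gagliardo_def by (rule nn_integral_cmult) measurable
  finally show ?thesis .
qed

section \<open>Compactness\<close>

text \<open>The estimate |u| \<le> 1 + u^2 controls the product where \<open>g\<close> lives. Two
  balls occur since \<open>g\<close> will be a difference of two translates of a test function;
  their indicators add up to at most 2, hence the factor 2.\<close>

lemma integral_prod_bound:
  fixes u g :: "real^'n \<Rightarrow> real"
  assumes u: "u \<in> sq_integrable" "l2_sq u \<le> ennreal M" and M: "0 \<le> M" and S: "0 \<le> S"
    and [measurable]: "g \<in> borel_measurable borel" and K: "0 \<le> K"
    and g: "\<And>y. \<bar>g y\<bar> \<le> K * indicator (ball a S) y + K * indicator (ball b S) y"
  shows "\<bar>\<integral>y. u y * g y \<partial>lborel\<bar> \<le> K * (2 * (unit_ball_vol (real CARD('n)) * S ^ CARD('n) + M))"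
proof -
  let ?V = "unit_ball_vol (real CARD('n)) * S ^ CARD('n)"
  let ?h = "\<lambda>y. K * indicator (ball a S) y + K * indicator (ball b S) y + 2 * K * (u y)\<^sup>2"
  have [measurable]: "u \<in> borel_measurable borel" using u by (simp add: sq_integrable_iff)
  have u2: "integrable lborel (\<lambda>y. (u y)\<^sup>2)" using u(1) by (simp add: sq_integrable_def)
  have "ennreal (\<integral>y. (u y)\<^sup>2 \<partial>lborel) = l2_sq u"
    unfolding l2_sq_def using u2 by (intro nn_integral_eq_integral[symmetric]) auto
  then have uM: "(\<integral>y. (u y)\<^sup>2 \<partial>lborel) \<le> M"
    using u(2) M by (metis ennreal_le_iff)
  have ball: "integrable lborel (indicator (ball c S) :: real^'n \<Rightarrow> real)" for c
    using emeasure_lborel_ball_finite[of c S] by (intro integrable_real_indicator) (auto simp: less_top)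
  have hi: "integrable lborel ?h"
    using ball u2 by auto
  have le: "norm (u y * g y) \<le> ?h y" for y
  proof -
    have "\<bar>u y\<bar> * \<bar>g y\<bar> \<le> (1 + (u y)\<^sup>2) * (K * indicator (ball a S) y + K * indicator (ball b S) y)"
      by (intro mult_mono abs_le_1_plus_sq g) auto
    also have "\<dots> \<le> ?h y"
      using K by (auto simp: indicator_def algebra_simps)
    finally show ?thesis by (simp add: abs_mult)
  qed
  have "\<bar>\<integral>y. u y * g y \<partial>lborel\<bar> \<le> (\<integral>y. norm (u y * g y) \<partial>lborel)"
    using integral_norm_bound[of lborel "\<lambda>y. u y * g y"] by simp
  also have "\<dots> \<le> (\<integral>y. ?h y \<partial>lborel)"
    using le hi K by (intro integral_mono_AE') (auto intro!: add_nonneg_nonneg)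
  also have "\<dots> = K * measure lborel (ball a S) + K * measure lborel (ball b S) + 2 * K * (\<integral>y. (u y)\<^sup>2 \<partial>lborel)"
    using ball u2 by simp
  also have "\<dots> = K * (2 * (?V + (\<integral>y. (u y)\<^sup>2 \<partial>lborel)))"
    using S by (simp add: content_ball algebra_simps)
  also have "\<dots> \<le> K * (2 * (?V + M))"
    using uM K by (intro mult_left_mono) auto
  finally show ?thesis .
qed

text \<open>\<open>u\<close> enters only through its mean square, so one \<open>C\<close> serves the
  whole bounded set, both as a uniform bound and as a Lipschitz constant, as Arzela-Ascoli
  requires.\<close>

lemma correlate_equicontinuous:
  fixes j :: "real^'n \<Rightarrow> real"
  assumes j: "j \<in> Cc_infinity" and M: "0 \<le> M"
  shows "\<exists>C\<ge>0. \<forall>u\<in>sq_integrable. l2_sq u \<le> ennreal M \<longrightarrow>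
    (\<forall>x. \<bar>correlate u j x\<bar> \<le> C) \<and> (\<forall>x y. \<bar>correlate u j x - correlate u j y\<bar> \<le> C * norm (x - y))"
proof -
  obtain S' where S': "\<And>z. S' \<le> norm z \<Longrightarrow> j z = 0" using j by (auto simp: Cc_infinity_iff)
  define S where "S = max 0 S'"
  have S: "\<And>z. S \<le> norm z \<Longrightarrow> j z = 0" "0 \<le> S" using S' by (auto simp: S_def)
  obtain B where B: "0 \<le> B" "\<And>x. \<bar>j x\<bar> \<le> B" using Cc_infinity_bounded[OF j] by blast
  obtain L where L: "0 \<le> L" "\<And>x y. \<bar>j x - j y\<bar> \<le> L * norm (x - y)"
    using Cc_infinity_lipschitz[OF j] by blast
  define V where "V = 2 * (unit_ball_vol (real CARD('n)) * S ^ CARD('n) + M)"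
  have V: "0 \<le> V" using S M by (simp add: V_def)
  have [measurable]: "j \<in> borel_measurable borel" using j by (rule Cc_infinity_measurable)
  define C where "C = max B L * V"
  have "(\<forall>x. \<bar>correlate u j x\<bar> \<le> C) \<and> (\<forall>x y. \<bar>correlate u j x - correlate u j y\<bar> \<le> C * norm (x - y))"
    if u: "u \<in> sq_integrable" "l2_sq u \<le> ennreal M" for u
  proof (intro conjI allI)
    fix x y
    have "\<bar>j (z - x)\<bar> \<le> B * indicator (ball x S) z + B * indicator (ball x S) z" for z
      using B(1) B(2)[of "z - x"] S(1)[of "z - x"] by (auto simp: indicator_def dist_norm norm_minus_commute)
    then have "\<bar>correlate u j x\<bar> \<le> B * V"
      unfolding correlate_def V_def using B S M u by (intro integral_prod_bound[where a = x and b = x]) auto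
    also have "\<dots> \<le> C" using V by (auto simp: C_def intro: mult_right_mono)
    finally show "\<bar>correlate u j x\<bar> \<le> C" .
    have i: "integrable lborel (\<lambda>z. u z * j (z - x))" for x
      using sq_integrable_shift[OF Cc_infinity_sq_integrable[OF j], of "- x"] u(1)
      by (intro sq_integrable_mult) auto
    have "\<bar>j (z - x) - j (z - y)\<bar> \<le> (L * norm (x - y)) * indicator (ball x S) z + (L * norm (x - y)) * indicator (ball y S) z" for z
    proof (cases "z \<in> ball x S \<or> z \<in> ball y S")
      case True
      have "\<bar>j (z - x) - j (z - y)\<bar> \<le> L * norm (x - y)"
        using L(2)[of "z - x" "z - y"] by (simp add: norm_minus_commute)
      moreover have "0 \<le> L * norm (x - y)" using L by simp
      ultimately show ?thesis using True by (auto simp: indicator_def)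
    next
      case False
      then show ?thesis using S(1)[of "z - x"] S(1)[of "z - y"] by (auto simp: dist_norm norm_minus_commute)
    qed
    then have "\<bar>\<integral>z. u z * (j (z - x) - j (z - y)) \<partial>lborel\<bar> \<le> (L * norm (x - y)) * V"
      unfolding V_def using L S M u by (intro integral_prod_bound[where a = x and b = y]) auto
    also have "(\<integral>z. u z * (j (z - x) - j (z - y)) \<partial>lborel) = correlate u j x - correlate u j y"
      using i by (simp add: correlate_def right_diff_distrib)
    finally have "\<bar>correlate u j x - correlate u j y\<bar> \<le> (L * V) * norm (x - y)"
      by (simp add: mult.commute mult.left_commute)
    also have "\<dots> \<le> C * norm (x - y)"
      using V by (auto simp: C_def intro!: mult_right_mono)
    finally show "\<bar>correlate u j x - correlate u j y\<bar> \<le> C * norm (x - y)" .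
  qed
  moreover have "0 \<le> C" using B V by (simp add: C_def)
  ultimately show ?thesis by blast
qed

section \<open>Tails and the splitting of distances\<close>

definition tail_sq :: "real \<Rightarrow> (real^'n \<Rightarrow> real) \<Rightarrow> ennreal" where
  "tail_sq R v = (\<integral>\<^sup>+x. ennreal ((v x)\<^sup>2 * indicator (- cball 0 R) x) \<partial>lborel)"

text \<open>Chebyshev's inequality: outside the ball of radius R the weight is at least ln(e + R^2),
  which tends to infinity with R.\<close>

lemma tail_sq_le:
  fixes v :: "real^'n \<Rightarrow> real"
  assumes [measurable]: "v \<in> borel_measurable borel" and R: "0 \<le> R"
  shows "tail_sq R v \<le> ennreal (1 / ln (exp 1 + R\<^sup>2)) * weight_sq v"
proof -
  let ?W = "ln (exp 1 + R\<^sup>2)"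
  have W: "0 < ?W" using ln_exp_1_plus_sq_ge_1[of R] by linarith
  have "tail_sq R v \<le> (\<integral>\<^sup>+x. ennreal (1 / ?W) * ennreal ((v x)\<^sup>2 * log_weight x) \<partial>lborel)"
    unfolding tail_sq_def
  proof (rule nn_integral_mono)
    fix x :: "real^'n"
    have "(v x)\<^sup>2 * indicator (- cball 0 R) x \<le> (1 / ?W) * ((v x)\<^sup>2 * log_weight x)"
    proof (cases "norm x \<le> R")
      case True
      then show ?thesis using W by simp
    next
      case False
      then have "R\<^sup>2 \<le> (norm x)\<^sup>2" using R by (intro power_mono) auto
      then have "?W \<le> log_weight x"
        unfolding log_weight_def by (subst ln_le_cancel_iff) (auto intro: add_pos_nonneg)
      then have "(v x)\<^sup>2 * ?W \<le> (v x)\<^sup>2 * log_weight x" by (intro mult_left_mono) auto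
      then show ?thesis using False W by (simp add: field_simps)
    qed
    then show "ennreal ((v x)\<^sup>2 * indicator (- cball 0 R) x) \<le> ennreal (1 / ?W) * ennreal ((v x)\<^sup>2 * log_weight x)"
      using W by (subst ennreal_mult[symmetric]) (auto intro: ennreal_leI)
  qed
  also have "\<dots> = ennreal (1 / ?W) * weight_sq v"
    unfolding weight_sq_def by (rule nn_integral_cmult) measurable
  finally show ?thesis .
qed

lemma sq_sum3_le: "((a::real) + b + c)\<^sup>2 \<le> 3 * a\<^sup>2 + 3 * b\<^sup>2 + 3 * c\<^sup>2"
proof -
  have "0 \<le> (a - b)\<^sup>2 + (b - c)\<^sup>2 + (a - c)\<^sup>2" by simp
  then show ?thesis by (simp add: power2_eq_square algebra_simps)
qed

text \<open>Inside the ball the difference passes through \<open>f\<close> and \<open>g\<close>,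
  three summands and so a factor 3; outside, \<open>u\<close> and \<open>v\<close> are estimated
  separately with a factor 2. The approximants have to be close only inside.\<close>

lemma l2_sq_diff_le:
  fixes u v :: "real^'n \<Rightarrow> real"
  assumes [measurable]: "u \<in> borel_measurable borel" "v \<in> borel_measurable borel"
      "f \<in> borel_measurable borel" "g \<in> borel_measurable borel"
    and fg: "\<And>x. norm x \<le> R \<Longrightarrow> \<bar>f x - g x\<bar> \<le> t"
  shows "l2_sq (\<lambda>x. u x - v x) \<le> 3 * l2_sq (\<lambda>x. f x - u x) + 3 * l2_sq (\<lambda>x. g x - v x)
    + 2 * tail_sq R u + 2 * tail_sq R v + ennreal (3 * t\<^sup>2) * emeasure lborel (cball (0::real^'n) R)"
proof -
  have [measurable]: "cball (0::real^'n) R \<in> sets borel" "- cball (0::real^'n) R \<in> sets borel"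
    by auto
  let ?h = "\<lambda>x. 3 * ennreal ((f x - u x)\<^sup>2) + 3 * ennreal ((g x - v x)\<^sup>2)
      + 2 * ennreal ((u x)\<^sup>2 * indicator (- cball 0 R) x) + 2 * ennreal ((v x)\<^sup>2 * indicator (- cball 0 R) x)
      + ennreal (3 * t\<^sup>2) * indicator (cball 0 R) x"
  have "l2_sq (\<lambda>x. u x - v x) \<le> (\<integral>\<^sup>+x. ?h x \<partial>lborel)"
    unfolding l2_sq_def
  proof (rule nn_integral_mono)
    fix x :: "real^'n"
    let ?b = "3 * (f x - u x)\<^sup>2 + 3 * (g x - v x)\<^sup>2 + 2 * ((u x)\<^sup>2 * indicator (- cball 0 R) x)
      + 2 * ((v x)\<^sup>2 * indicator (- cball 0 R) x) + 3 * t\<^sup>2 * indicator (cball 0 R) x"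
    have "(u x - v x)\<^sup>2 \<le> ?b"
    proof (cases "norm x \<le> R")
      case True
      have "(u x - v x)\<^sup>2 \<le> 3 * (f x - u x)\<^sup>2 + 3 * (f x - g x)\<^sup>2 + 3 * (g x - v x)\<^sup>2"
        using sq_sum3_le[of "u x - f x" "f x - g x" "g x - v x"] by (simp add: power2_commute[of "u x"])
      moreover have "(f x - g x)\<^sup>2 \<le> t\<^sup>2"
        using power_mono[OF fg[OF True], of 2] by simp
      ultimately show ?thesis using True by simp
    next
      case False
      have "(u x - v x)\<^sup>2 \<le> 2 * (u x)\<^sup>2 + 2 * (v x)\<^sup>2"
        using sq_sum_le[of "u x" "- v x"] by simp
      moreover have "?b = 3 * (f x - u x)\<^sup>2 + 3 * (g x - v x)\<^sup>2 + 2 * (u x)\<^sup>2 + 2 * (v x)\<^sup>2"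
        using False by simp
      ultimately show ?thesis
        using zero_le_power2[of "f x - u x"] zero_le_power2[of "g x - v x"] by linarith
    qed
    then have "ennreal ((u x - v x)\<^sup>2) \<le> ennreal ?b" by (rule ennreal_leI)
    also have "\<dots> = ?h x"
      by (simp add: ennreal_mult indicator_def)
    finally show "ennreal ((u x - v x)\<^sup>2) \<le> ?h x" .
  qed
  also have "\<dots> = 3 * l2_sq (\<lambda>x. f x - u x) + 3 * l2_sq (\<lambda>x. g x - v x)
    + 2 * tail_sq R u + 2 * tail_sq R v + ennreal (3 * t\<^sup>2) * emeasure lborel (cball (0::real^'n) R)"
    by (simp add: l2_sq_def tail_sq_def nn_integral_add nn_integral_cmult nn_integral_cmult_indicator)
  finally show ?thesis .
qed

text \<open>Two close members in every bounded sequence already give total boundedness, so no limit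
  in the mean square has to be constructed.\<close>

lemma Dlog_bounded_close_pair:
  fixes v :: "nat \<Rightarrow> real^'n \<Rightarrow> real"
  assumes v: "\<And>n. v n \<in> dlog_fun" and bd: "\<And>n. dlog_enorm2 (v n) \<le> ennreal M" and M: "0 \<le> M"
    and e: "0 < e"
  shows "\<exists>i k. i < k \<and> l2_sq (\<lambda>x. v i x - v k x) < ennreal e"
proof -
  have vm [measurable]: "v n \<in> borel_measurable borel" and vs: "v n \<in> sq_integrable" for n
    using v by (auto simp: dlog_fun_iff dlog_fun_sq_integrable)
  define c where "c = c_const CARD('n) / 2"
  have c: "0 < c" using c_const_card_pos[where 'n='n] by (simp add: c_def)
  have wM: "weight_sq (v n) \<le> ennreal M" for n
    using bd[of n] by (auto simp: dlog_enorm2_eq intro: order_trans[rotated])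
  have lM: "l2_sq (v n) \<le> ennreal M" for n
    using l2_sq_le_weight_sq wM by (rule order_trans)
  have gM: "gagliardo (v n) \<le> ennreal (M / c)" for n
  proof -
    have "ennreal c * gagliardo (v n) \<le> ennreal M"
      using bd[of n] by (auto simp: dlog_enorm2_eq c_def intro: order_trans[rotated])
    then have "ennreal (1 / c) * (ennreal c * gagliardo (v n)) \<le> ennreal (1 / c) * ennreal M"
      by (rule mult_left_mono) simp
    also have "ennreal (1 / c) * (ennreal c * gagliardo (v n)) = gagliardo (v n)"
      using c by (simp add: mult.assoc[symmetric] ennreal_mult[symmetric])
    also have "ennreal (1 / c) * ennreal M = ennreal (M / c)"
      using c M by (simp add: ennreal_mult[symmetric])
    finally show ?thesis .
  qed
  \<comment> \<open>The final estimate adds 3 + 3 + 2 + 2 + 3 = 13 multiples of \<open>d\<close>; 40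
    is a generous divisor.\<close>
  define d where "d = e / 40"
  have d: "0 < d" using e by (simp add: d_def)
  obtain A where A: "0 < A"
    "\<forall>m>0. \<exists>j :: real^'n \<Rightarrow> real. mollifier j \<and> (\<forall>z. z \<noteq> 0 \<longrightarrow> j z \<le> A / real m * sing_kernel z)"
    using mollifier_exists[where 'n='n] by blast
  \<comment> \<open>Large enough for (A/m) (M/c) \<le> d, where M/c bounds the energies.\<close>
  obtain m where m: "A * (M / c) / d < real m" using reals_Archimedean2 by blast
  have m0: "0 < real m"
  proof -
    have "0 \<le> A * (M / c) / d" using A M c d by simp
    then show ?thesis using m by linarith
  qed
  then have "0 < m" by simp
  with A(2) have "\<exists>j :: real^'n \<Rightarrow> real. mollifier j \<and> (\<forall>z. z \<noteq> 0 \<longrightarrow> j z \<le> A / real m * sing_kernel z)"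
    by simp
  then obtain j :: "real^'n \<Rightarrow> real" where j: "mollifier j" "\<And>z. z \<noteq> 0 \<Longrightarrow> j z \<le> A / real m * sing_kernel z"
    by blast
  note jC = mollifierD(1)[OF j(1)]
  have [measurable]: "j \<in> borel_measurable borel" by (rule mollifierD(4)[OF j(1)])
  let ?F = "\<lambda>n. correlate (v n) j"
  have Fd: "l2_sq (\<lambda>x. ?F n x - v n x) \<le> ennreal d" for n
  proof -
    have "l2_sq (\<lambda>x. ?F n x - v n x) \<le> ennreal (A / real m) * gagliardo (v n)"
      using A m0 by (intro l2_sq_correlate_diff_le_gagliardo j vs) auto
    also have "\<dots> \<le> ennreal (A / real m) * ennreal (M / c)"
      by (intro mult_left_mono gM) simp
    also have "\<dots> = ennreal (A / real m * (M / c))"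
      using A M c by (simp add: ennreal_mult[symmetric])
    also have "\<dots> \<le> ennreal d"
    proof (rule ennreal_leI)
      have "A * (M / c) < real m * d" using m d by (simp only: pos_divide_less_eq)
      then have "A * (M / c) / real m \<le> d"
        using m0 by (simp only: pos_divide_le_eq mult.commute less_imp_le)
      then show "A / real m * (M / c) \<le> d" by (simp add: mult.commute)
    qed
    finally show ?thesis .
  qed
  \<comment> \<open>R^2 = exp(M/d) makes the weight beyond R at least M/d, so that the tails are at
    most d.\<close>
  define R where "R = sqrt (exp (M / d))"
  have R: "0 \<le> R" by (simp add: R_def)
  have W: "M / d \<le> ln (exp 1 + R\<^sup>2)"
  proof -
    have "ln (exp (M / d)) \<le> ln (exp 1 + R\<^sup>2)"
      by (subst ln_le_cancel_iff) (auto simp: R_def intro: add_pos_pos)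
    then show ?thesis by simp
  qed
  have W1: "0 < ln (exp 1 + R\<^sup>2)" using ln_exp_1_plus_sq_ge_1[of R] by linarith
  have tail: "tail_sq R (v n) \<le> ennreal d" for n
  proof -
    have "tail_sq R (v n) \<le> ennreal (1 / ln (exp 1 + R\<^sup>2)) * weight_sq (v n)"
      by (intro tail_sq_le vm R)
    also have "\<dots> \<le> ennreal (1 / ln (exp 1 + R\<^sup>2)) * ennreal M"
      by (intro mult_left_mono wM) simp
    also have "\<dots> = ennreal (1 / ln (exp 1 + R\<^sup>2) * M)"
      using W1 M by (subst ennreal_mult) auto
    also have "\<dots> \<le> ennreal d"
    proof (rule ennreal_leI)
      have "M \<le> ln (exp 1 + R\<^sup>2) * d" using W d by (simp only: pos_divide_le_eq)
      then have "M / ln (exp 1 + R\<^sup>2) \<le> d"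
        using W1 by (simp only: pos_divide_le_eq mult.commute)
      then show "1 / ln (exp 1 + R\<^sup>2) * M \<le> d" by simp
    qed
    finally show ?thesis .
  qed
  obtain C where C: "0 \<le> C" "\<And>u x. u \<in> sq_integrable \<Longrightarrow> l2_sq u \<le> ennreal M \<Longrightarrow> \<bar>correlate u j x\<bar> \<le> C"
      "\<And>u x y. u \<in> sq_integrable \<Longrightarrow> l2_sq u \<le> ennreal M \<Longrightarrow> \<bar>correlate u j x - correlate u j y\<bar> \<le> C * norm (x - y)"
    using correlate_equicontinuous[OF jC M] by blast
  obtain vol where vol: "0 \<le> vol" "emeasure lborel (cball (0::real^'n) R) = ennreal vol"
    using emeasure_lborel_cball_finite[of "0::real^'n" R] by (metis ennreal_cases less_irrefl infinity_ennreal_def)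
  \<comment> \<open>A uniform error \<open>t\<close> costs t^2 vol \<le> d on the ball; adding 1
    keeps the denominator positive.\<close>
  define t where "t = sqrt (d / (vol + 1))"
  have t: "0 < t" "t\<^sup>2 * vol \<le> d"
    using d vol by (auto simp: t_def field_simps)
  have "\<exists>g k. strict_mono (k :: nat \<Rightarrow> nat) \<and>
    (\<forall>e>0. \<exists>N. \<forall>n x. n \<ge> N \<and> x \<in> cball 0 R \<longrightarrow> norm (?F (k n) x - g x) < e)"
  proof (rule Arzela_Ascoli[of "cball 0 R" ?F C])
    show "norm (?F n x) \<le> C" for n x using C(2)[OF vs lM] by simp
    show "\<exists>d>0. \<forall>n y. y \<in> cball 0 R \<and> norm (x - y) < d \<longrightarrow> norm (?F n x - ?F n y) < e"
      if "0 < e" for x and e :: real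
    proof (intro exI[of _ "e / (C + 1)"] conjI allI impI)
      show "0 < e / (C + 1)" using that C by simp
      fix n y assume y: "y \<in> cball 0 R \<and> norm (x - y) < e / (C + 1)"
      have "norm (?F n x - ?F n y) \<le> C * norm (x - y)" using C(3)[OF vs lM] by simp
      also have "\<dots> \<le> (C + 1) * norm (x - y)" by (intro mult_right_mono) auto
      also have "\<dots> < e" using y C(1) by (simp add: field_simps)
      finally show "norm (?F n x - ?F n y) < e" .
    qed
    \<comment> \<open>\<open>Arzela_Ascoli\<close> eliminates into an arbitrary conclusion; its
      limit and subsequence are repackaged here as the existential statement.\<close>
    show "\<exists>g k. strict_mono (k :: nat \<Rightarrow> nat) \<and>
        (\<forall>e>0. \<exists>N. \<forall>n x. n \<ge> N \<and> x \<in> cball 0 R \<longrightarrow> norm (?F (k n) x - g x) < e)"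
      if "strict_mono k" "\<And>e. 0 < e \<Longrightarrow> \<exists>N. \<forall>n x. n \<ge> N \<and> x \<in> cball 0 R \<longrightarrow> norm (?F (k n) x - g x) < e"
      for g and k :: "nat \<Rightarrow> nat"
      using that by (intro exI[of _ g] exI[of _ k]) blast
  qed simp
  then obtain g k where k: "strict_mono (k :: nat \<Rightarrow> nat)"
    and g: "\<And>e. 0 < e \<Longrightarrow> \<exists>N. \<forall>n x. n \<ge> N \<and> x \<in> cball 0 R \<longrightarrow> norm (?F (k n) x - g x) < e"
    by blast
  obtain N where N: "\<And>n x. n \<ge> N \<Longrightarrow> norm x \<le> R \<Longrightarrow> \<bar>?F (k n) x - g x\<bar> < t / 2"
    using g[of "t / 2"] t by auto
  \<comment> \<open>Both terms are within t/2 of the common limit; two consecutive late indices are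
    as good as any.\<close>
  have close: "\<bar>?F (k N) x - ?F (k (Suc N)) x\<bar> \<le> t" if "norm x \<le> R" for x
    using N[of N x] N[of "Suc N" x] that by linarith
  have "l2_sq (\<lambda>x. v (k N) x - v (k (Suc N)) x) \<le> 3 * l2_sq (\<lambda>x. ?F (k N) x - v (k N) x) + 3 * l2_sq (\<lambda>x. ?F (k (Suc N)) x - v (k (Suc N)) x)
    + 2 * tail_sq R (v (k N)) + 2 * tail_sq R (v (k (Suc N))) + ennreal (3 * t\<^sup>2) * emeasure lborel (cball (0::real^'n) R)"
    using close by (intro l2_sq_diff_le) auto
  also have "\<dots> \<le> 3 * ennreal d + 3 * ennreal d + 2 * ennreal d + 2 * ennreal d + ennreal (3 * t\<^sup>2) * ennreal vol"
    unfolding vol(2) by (intro add_mono mult_left_mono Fd tail) auto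
  also have "\<dots> = ennreal (3 * d + 3 * d + 2 * d + 2 * d + 3 * t\<^sup>2 * vol)"
  proof -
    have "3 * ennreal d = ennreal (3 * d)" "2 * ennreal d = ennreal (2 * d)"
      using d by (simp_all add: ennreal_mult)
    moreover have "ennreal (3 * t\<^sup>2) * ennreal vol = ennreal (3 * t\<^sup>2 * vol)"
      using vol by (intro ennreal_mult[symmetric]) auto
    moreover have "0 \<le> 3 * t\<^sup>2 * vol" using vol by simp
    ultimately show ?thesis
      using d by (simp only: ennreal_plus[symmetric] add_nonneg_nonneg mult_nonneg_nonneg less_imp_le zero_le_numeral)
  qed
  also have "\<dots> < ennreal e"
    using t(2) d by (intro ennreal_lessI) (auto simp: d_def)
  finally show ?thesis
    using k by (intro exI[of _ "k N"] exI[of _ "k (Suc N)"]) (auto simp: strict_mono_def)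
qed

section \<open>Total boundedness and the compact embedding\<close>

lemma infinite_separated_sequence:
  fixes S :: "'a::metric_space set"
  assumes "\<not> (\<exists>K. finite K \<and> S \<subseteq> (\<Union>x\<in>K. ball x e))"
  shows "\<exists>s :: nat \<Rightarrow> 'a. (\<forall>n. s n \<in> S) \<and> (\<forall>m n. m < n \<longrightarrow> e \<le> dist (s m) (s n))"
proof -
  have "\<exists>y. finite K \<longrightarrow> y \<in> S \<and> (\<forall>x\<in>K. e \<le> dist x y)" for K
    using assms by (fastforce simp: not_less)
  then obtain c where c: "\<And>K. finite K \<Longrightarrow> c K \<in> S" "\<And>K x. finite K \<Longrightarrow> x \<in> K \<Longrightarrow> e \<le> dist x (c K)"
    by metis
  \<comment> \<open>\<open>T n\<close> collects the first n chosen points, and \<open>c\<close>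
    picks a new one at distance at least e from all of them. The recursion runs on sets because each
    choice depends on every earlier one.\<close>
  define T where "T = rec_nat {} (\<lambda>_ K. insert (c K) K)"
  have T: "T 0 = {}" "T (Suc n) = insert (c (T n)) (T n)" for n
    by (simp_all add: T_def)
  have fin: "finite (T n)" for n by (induction n) (auto simp: T)
  have mem: "c (T m) \<in> T n" if "m < n" for m n
    using that by (induction n) (auto simp: T less_Suc_eq)
  show ?thesis
    by (rule exI[of _ "\<lambda>n. c (T n)"]) (auto intro: c fin mem)
qed

text \<open>The weight is at least 1, so the inclusion is Lipschitz with constant 1; its continuity
  follows.\<close>

lemma norm_diff_le_ip_dist:
  assumes "a \<in> Dlog" "b \<in> (Dlog :: 'n::finite l2 set)"
  shows "dist a b \<le> ip_dist Dlog dlog_inner a b"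
proof -
  obtain u v where uv: "u \<in> dlog_fun" "v \<in> dlog_fun" "a = abs_l2 u" "b = abs_l2 v"
    using assms by (auto elim!: Dlog_cases)
  have d: "(\<lambda>x. u x - v x) \<in> dlog_fun" using uv by (intro dlog_fun_diff)
  have "ennreal ((dist a b)\<^sup>2) = l2_sq (\<lambda>x. u x - v x)"
    using uv d by (simp add: dist_norm abs_l2_diff norm_abs_l2 dlog_fun_sq_integrable)
  also have "\<dots> \<le> dlog_enorm2 (\<lambda>x. u x - v x)"
    using d by (intro l2_sq_le_dlog_enorm2) (simp add: dlog_fun_iff)
  also have "\<dots> = ennreal ((ip_dist Dlog dlog_inner a b)\<^sup>2)"
    using ip_dist_Dlog(1)[OF uv(1,2)] uv by simp
  finally have "(dist a b)\<^sup>2 \<le> (ip_dist Dlog dlog_inner a b)\<^sup>2"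
    by (simp add: ennreal_le_iff)
  then show ?thesis
    using ip_dist_Dlog(2)[OF uv(1,2)] uv by (auto intro: power2_le_imp_le)
qed

lemma compactly_embedded_Dlog: "compactly_embedded (Dlog :: 'n::finite l2 set) dlog_inner"
proof -
  interpret Metric_space "Dlog :: 'n l2 set" "ip_dist Dlog dlog_inner"
    by (rule Metric_space_Dlog)
  have "continuous_map mtopology euclidean (\<lambda>v. v)"
    unfolding continuous_map_def
  proof (intro conjI allI impI)
    fix U :: "'n l2 set" assume "openin euclidean U"
    then have U: "open U" by simp
    show "openin mtopology {x \<in> topspace mtopology. x \<in> U}"
      unfolding openin_mtopology
    proof (intro conjI allI impI)
      fix x assume "x \<in> {x \<in> topspace mtopology. x \<in> U}"
      then have x: "x \<in> Dlog" "x \<in> U" by auto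
      then obtain r where r: "0 < r" "\<And>y. dist y x < r \<Longrightarrow> y \<in> U"
        using U by (auto simp: open_dist)
      have "mball x r \<subseteq> {x \<in> topspace mtopology. x \<in> U}"
      proof
        fix y assume "y \<in> mball x r"
        then have y: "y \<in> Dlog" "ip_dist Dlog dlog_inner x y < r" by auto
        then have "dist y x < r"
          using norm_diff_le_ip_dist[OF x(1) y(1)] by (simp add: dist_commute)
        then show "y \<in> {x \<in> topspace mtopology. x \<in> U}" using y r by auto
      qed
      then show "\<exists>r>0. mball x r \<subseteq> {x \<in> topspace mtopology. x \<in> U}" using r by blast
    qed auto
  qed auto
  moreover have "compact (closure S)" if S: "mbounded S" for S
  proof -
    obtain a B where aB: "S \<subseteq> mcball a B" using S by (auto simp: mbounded_def)
    have tb: "\<exists>K. finite K \<and> S \<subseteq> (\<Union>x\<in>K. ball x e)" if e: "0 < e" for e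
    proof (rule ccontr)
      assume "\<not> ?thesis"
      from infinite_separated_sequence[OF this] obtain s :: "nat \<Rightarrow> 'n l2"
        where s': "(\<forall>n. s n \<in> S) \<and> (\<forall>m n. m < n \<longrightarrow> e \<le> dist (s m) (s n))" ..
      then have s: "\<And>n. s n \<in> S" and sep: "\<And>m n. m < n \<Longrightarrow> e \<le> dist (s m) (s n)"
        by auto
      have sb: "s n \<in> Dlog" "ip_dist Dlog dlog_inner a (s n) \<le> B" "a \<in> Dlog" for n
        using s[of n] aB by auto
      obtain w where w: "w \<in> dlog_fun" "a = abs_l2 w" using sb(3) by (rule Dlog_cases)
      have "\<forall>n. \<exists>v. v \<in> dlog_fun \<and> s n = abs_l2 v" using sb(1) by (metis Dlog_cases)
      then obtain v where v: "\<And>n. v n \<in> dlog_fun" "\<And>n. s n = abs_l2 (v n)" by metis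
      \<comment> \<open>From v = w + (v - w), with \<open>w\<close> the centre of the bounding ball
        and \<open>B\<close> its radius.\<close>
      define M where "M = 2 * dlog_ip w w + 2 * B\<^sup>2"
      have M: "0 \<le> M" using dlog_enorm2_eq_ip(2)[OF w(1)] by (simp add: M_def)
      have "dlog_enorm2 (v n) \<le> ennreal M" for n
      proof -
        have [measurable]: "w \<in> borel_measurable borel" "v n \<in> borel_measurable borel"
          using w v by (auto simp: dlog_fun_iff)
        have "0 \<le> ip_dist Dlog dlog_inner a (s n)" by simp
        then have "(ip_dist Dlog dlog_inner (s n) a)\<^sup>2 \<le> B\<^sup>2"
          using sb(2)[of n] by (simp add: commute power_mono)
        then have 1: "dlog_enorm2 (\<lambda>x. v n x - w x) \<le> ennreal (B\<^sup>2)"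
          using ip_dist_Dlog(1)[OF v(1) w(1), of n] v w by (simp add: ennreal_leI)
        have "dlog_enorm2 (\<lambda>x. w x + (v n x - w x)) \<le> 2 * dlog_enorm2 w + 2 * dlog_enorm2 (\<lambda>x. v n x - w x)"
          by (rule dlog_enorm2_add_le) measurable
        also have "\<dots> \<le> 2 * ennreal (dlog_ip w w) + 2 * ennreal (B\<^sup>2)"
          unfolding dlog_enorm2_eq_ip(1)[OF w(1)] by (intro add_mono mult_left_mono 1) auto
        also have "\<dots> = ennreal M"
          using dlog_enorm2_eq_ip(2)[OF w(1)] by (simp add: M_def ennreal_mult)
        finally show ?thesis by simp
      qed
      then obtain i k where ik: "i < k" "l2_sq (\<lambda>x. v i x - v k x) < ennreal (e\<^sup>2)"
        using Dlog_bounded_close_pair[of v M "e\<^sup>2"] v M e by auto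
      have "(\<lambda>x. v i x - v k x) \<in> sq_integrable"
        using v by (intro dlog_fun_sq_integrable dlog_fun_diff)
      then have "dist (s i) (s k) < e"
        using ik(2) v e by (simp add: dist_norm abs_l2_diff dlog_fun_sq_integrable norm_abs_l2_less)
      then show False using sep[OF ik(1)] by simp
    qed
    have "\<exists>K. finite K \<and> closure S \<subseteq> (\<Union>x\<in>K. ball x e)" if e: "0 < e" for e
    proof -
      obtain K where K: "finite K" "S \<subseteq> (\<Union>x\<in>K. ball x (e / 2))" using tb[of "e / 2"] e by auto
      \<comment> \<open>Finitely many closed balls of half the radius form a closed set, which
        therefore contains the closure of S as well.\<close>
      have "S \<subseteq> (\<Union>x\<in>K. cball x (e / 2))"
        using K(2) by (rule order_trans) (intro UN_mono ball_subset_cball order_refl)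
      then have "closure S \<subseteq> (\<Union>x\<in>K. cball x (e / 2))"
        using K(1) by (intro closure_minimal closed_UN) auto
      also have "\<dots> \<subseteq> (\<Union>x\<in>K. ball x e)"
        using e by (intro UN_mono) (auto simp: dist_commute)
      finally show ?thesis using K by blast
    qed
    moreover have "complete (closure S)"
      using complete_Int_closed[OF complete_l2 closed_closure[of S]] by simp
    ultimately show ?thesis by (simp add: compact_eq_totally_bounded)
  qed
  ultimately show ?thesis by (simp add: compactly_embedded_def)
qed

section \<open>The interaction at distance at least one\<close>

lemma dyadic_ex:
  fixes t :: real
  assumes "1 \<le> t"
  obtains j :: nat where "2 ^ j \<le> t" "t < 2 ^ Suc j"
proof -
  obtain n :: nat where "t < 2 ^ n" using real_arch_pow[of 2 t] by auto
  define m where "m = (LEAST n::nat. t < 2 ^ n)"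
  have m: "t < 2 ^ m" unfolding m_def using \<open>t < 2 ^ n\<close> by (rule LeastI)
  have "m \<noteq> 0" using m assms by (cases m) auto
  then obtain j where j: "m = Suc j" by (cases m) auto
  have "\<not> t < 2 ^ j"
    using not_less_Least[of j "\<lambda>n. t < 2 ^ n"] j by (simp add: m_def)
  then show thesis using m j by (intro that[of j]) auto
qed

lemma emeasure_ball_vec:
  fixes c :: "real^'n"
  shows "0 \<le> r \<Longrightarrow> emeasure lborel (ball c r) = ennreal (unit_ball_vol (real CARD('n)) * r ^ CARD('n))"
  by (simp add: emeasure_ball)


text \<open>Replaces polar coordinates: the function is dominated by heights \<open>a j\<close> on
  balls of radius \<open>r j\<close>, whose volumes are known, and \<open>b\<close> is a summable
  majorant of the resulting series. The three kernel integrals below are instances.\<close>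

lemma nn_integral_dyadic_le:
  fixes f :: "real^'n \<Rightarrow> ennreal"
  assumes le: "\<And>z. f z \<le> (\<Sum>j. ennreal (a j) * indicator (ball 0 (r j)) z)"
    and nn: "\<And>j. 0 \<le> a j" "\<And>j. 0 \<le> r j"
    and b: "\<And>j. a j * r j ^ CARD('n) \<le> b j" "b sums B"
  shows "(\<integral>\<^sup>+z. f z \<partial>lborel) \<le> ennreal (unit_ball_vol (real CARD('n)) * B)"
proof -
  let ?V = "unit_ball_vol (real CARD('n))"
  have V: "0 \<le> ?V" by simp
  have "(\<integral>\<^sup>+z. f z \<partial>lborel) \<le> (\<integral>\<^sup>+z. (\<Sum>j. ennreal (a j) * indicator (ball (0::real^'n) (r j)) z) \<partial>lborel)"
    by (rule nn_integral_mono) (rule le)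
  also have "\<dots> = (\<Sum>j. \<integral>\<^sup>+z. ennreal (a j) * indicator (ball 0 (r j)) (z :: real^'n) \<partial>lborel)"
    by (intro nn_integral_suminf borel_measurable_times_ennreal borel_measurable_indicator) auto
  also have "\<dots> = (\<Sum>j. ennreal (a j) * emeasure lborel (ball (0::real^'n) (r j)))"
    by (simp add: nn_integral_cmult_indicator)
  also have "\<dots> = (\<Sum>j. ennreal (?V * (a j * r j ^ CARD('n))))"
  proof (intro arg_cong[where f = suminf] ext)
    fix j
    have "ennreal (a j) * emeasure lborel (ball (0::real^'n) (r j)) = ennreal (a j * (?V * r j ^ CARD('n)))"
      unfolding emeasure_ball_vec[OF nn(2)] using nn V by (intro ennreal_mult[symmetric]) auto
    then show "ennreal (a j) * emeasure lborel (ball (0::real^'n) (r j)) = ennreal (?V * (a j * r j ^ CARD('n)))"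
      by (simp only: mult.left_commute)
  qed
  also have "\<dots> \<le> (\<Sum>j. ennreal (?V * b j))"
    using V b by (intro suminf_le ennreal_leI mult_left_mono) auto
  also have "\<dots> = ennreal (\<Sum>j. ?V * b j)"
  proof (rule suminf_ennreal2)
    show "0 \<le> ?V * b j" for j
      using V nn b(1)[of j] by (intro mult_nonneg_nonneg) (auto intro: order_trans[rotated])
    show "summable (\<lambda>j. ?V * b j)"
      using b(2) by (intro summable_mult) (rule sums_summable)
  qed
  also have "(\<Sum>j. ?V * b j) = ?V * B"
    using b(2) by (simp add: suminf_mult sums_summable sums_unique[symmetric])
  finally show ?thesis .
qed

lemma le_suminf_indicator:
  fixes f :: ennreal
  assumes "f \<le> ennreal (a j)" "z \<in> S j"
  shows "f \<le> (\<Sum>j. ennreal (a j) * indicator (S j) z)"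
proof -
  define g :: "nat \<Rightarrow> ennreal" where "g i = ennreal (a i) * indicator (S i) z" for i
  have "f \<le> g j" using assms by (simp add: g_def)
  also have "\<dots> = (\<Sum>i\<in>{j}. g i)" by simp
  also have "\<dots> \<le> (\<Sum>i. g i)"
    by (rule sum_le_suminf) auto
  finally show ?thesis by (simp add: g_def)
qed

text \<open>Where |z| is about 2^(-j) the integrand is at most 4^(-j) 2^((j+1)N), against a volume
  of order 2^(-jN), so the series is geometric with ratio 1/4. The gain |z|^2 is what a Lipschitz
  function contributes to the energy.\<close>

lemma sing_kernel_sq_norm_integral:
  "(\<integral>\<^sup>+z. ennreal (sing_kernel z * (norm z)\<^sup>2) \<partial>(lborel :: (real^'n) measure)) < \<infinity>"
proof -
  let ?N = "CARD('n)"
  let ?a = "\<lambda>j::nat. (1/4::real) ^ j * (2 ^ Suc j) ^ ?N"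
  have "(\<integral>\<^sup>+z. ennreal (sing_kernel z * (norm z)\<^sup>2) \<partial>(lborel :: (real^'n) measure))
    \<le> ennreal (unit_ball_vol (real ?N) * (4 ^ ?N * (1 / (1 - 1/4))))"
  \<comment> \<open>The radius is doubled because the balls are open while |z| = 2^(-j) may
    occur.\<close>
  proof (rule nn_integral_dyadic_le[where a = ?a and r = "\<lambda>j. 2 * (1/2) ^ j" and b = "\<lambda>j. 4 ^ ?N * (1/4) ^ j"])
    fix z :: "real^'n"
    show "ennreal (sing_kernel z * (norm z)\<^sup>2) \<le> (\<Sum>j. ennreal (?a j) * indicator (ball 0 (2 * (1/2) ^ j)) z)"
    proof (cases "z = 0 \<or> 1 \<le> norm z")
      case True
      then show ?thesis by (auto simp: sing_kernel_def)
    next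
      case False
      then have z: "0 < norm z" "norm z < 1" by auto
      then obtain j where j: "2 ^ j \<le> 1 / norm z" "1 / norm z < 2 ^ Suc j"
        by (metis dyadic_ex less_eq_real_def less_divide_eq_1_pos)
      have 1: "norm z \<le> (1/2) ^ j"
        using j(1) z by (simp add: field_simps power_one_over)
      have 2: "1 / norm z ^ ?N \<le> (2 ^ Suc j) ^ ?N"
        using j(2) z power_mono[of "1 / norm z" "2 ^ Suc j" ?N] by (simp add: power_one_over less_imp_le)
      have "(norm z)\<^sup>2 \<le> ((1/2) ^ j)\<^sup>2"
        using 1 by (intro power_mono) auto
      also have "\<dots> = (1/4) ^ j"
        by (simp add: power_mult[symmetric] mult.commute[of j 2]) (simp add: power_mult power2_eq_square)
      finally have 3: "(norm z)\<^sup>2 \<le> (1/4) ^ j" .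
      have "sing_kernel z * (norm z)\<^sup>2 \<le> (2 ^ Suc j) ^ ?N * (1/4) ^ j"
        using z 2 3 by (intro mult_mono) (auto simp: sing_kernel_def)
      then show ?thesis
        using 1 by (intro le_suminf_indicator[where j = j] ennreal_leI)
          (auto simp: mult.commute intro: le_less_trans)
    qed
  next
    fix j :: nat
    have "?a j * (2 * (1/2) ^ j) ^ ?N = (1/4) ^ j * (2 ^ Suc j * (2 * (1/2) ^ j)) ^ ?N"
      by (simp only: power_mult_distrib mult.assoc)
    also have "(2::real) ^ Suc j * (2 * (1/2) ^ j) = 4"
      by (simp add: power_one_over)
    finally show "?a j * (2 * (1/2) ^ j) ^ ?N \<le> 4 ^ ?N * (1/4) ^ j"
      by simp
  next
    show "(\<lambda>j. 4 ^ ?N * (1/4) ^ j) sums (4 ^ ?N * (1 / (1 - 1/4 :: real)))"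
      by (intro sums_mult geometric_sums) simp
  qed auto
  then show ?thesis by (rule order.strict_trans1) simp
qed

text \<open>The exponent solves a balance: distributing r^(N/3) between two copies of r^(-N) leaves
  r^(-4N/3) and r^(-2N/3), and r > |x|^2 turns the second into decay |x|^(-4N/3). One exponent
  larger than N serves both. The maximum with 1 removes the singularity at 0.\<close>

definition far_decay :: "real^'n \<Rightarrow> real" where
  "far_decay z = max 1 (norm z) powr (- (4 * real CARD('n) / 3))"

lemma far_decay_nonneg [simp]: "0 \<le> far_decay z"
  by (simp add: far_decay_def)

lemma far_decay_measurable [measurable]: "far_decay \<in> borel_measurable borel"
  unfolding far_decay_def[abs_def] by measurable

lemma far_decay_integral:
  "(\<integral>\<^sup>+z. ennreal (far_decay z) \<partial>(lborel :: (real^'n) measure)) < \<infinity>"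
proof -
  let ?N = "CARD('n)"
  let ?p = "- (4 * real ?N / 3)"
  \<comment> \<open>Ratio of the series: 2^(-4N/3) from the decay times 2^N from the volume.\<close>
  let ?q = "2 powr (- real ?N / 3)"
  have q: "?q < 1" using powr_less_cancel_iff[of 2 "- real ?N / 3" 0] by simp
  have "(\<integral>\<^sup>+z. ennreal (far_decay z) \<partial>(lborel :: (real^'n) measure))
    \<le> ennreal (unit_ball_vol (real ?N) * (2 ^ ?N * (1 / (1 - ?q))))"
  proof (rule nn_integral_dyadic_le[where a = "\<lambda>j. (2 ^ j) powr ?p" and r = "\<lambda>j. 2 ^ Suc j" and b = "\<lambda>j. 2 ^ ?N * ?q ^ j"])
    fix z :: "real^'n"
    obtain j where j: "2 ^ j \<le> max 1 (norm z)" "max 1 (norm z) < 2 ^ Suc j"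
      using dyadic_ex[of "max 1 (norm z)"] by auto
    have "far_decay z \<le> (2 ^ j) powr ?p"
      unfolding far_decay_def using j by (intro powr_mono2') auto
    then show "ennreal (far_decay z) \<le> (\<Sum>j. ennreal ((2 ^ j) powr ?p) * indicator (ball 0 (2 ^ Suc j)) z)"
      using j by (intro le_suminf_indicator[where j = j] ennreal_leI) auto
  next
    fix j :: nat
    have "(2 ^ j) powr ?p * (2 ^ Suc j) ^ ?N = 2 powr (real j * ?p) * (2 powr (real (Suc j * ?N)))"
      by (simp add: powr_realpow[symmetric] powr_powr power_mult[symmetric] del: power_Suc of_nat_Suc mult_Suc)
    also have "\<dots> = 2 powr (real ?N) * 2 powr (- real ?N / 3 * real j)"
      by (simp add: powr_add[symmetric] algebra_simps)
    also have "\<dots> = 2 ^ ?N * ?q ^ j"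
      by (subst powr_powr[symmetric]) (simp add: powr_realpow)
    finally show "(2 ^ j) powr ?p * (2 ^ Suc j) ^ ?N \<le> 2 ^ ?N * ?q ^ j" by simp
  next
    show "(\<lambda>j. 2 ^ ?N * ?q ^ j) sums (2 ^ ?N * (1 / (1 - ?q)))"
      using q by (intro sums_mult geometric_sums) simp
  qed auto
  then show ?thesis by (rule order.strict_trans1) simp
qed

definition annulus_kernel :: "real \<Rightarrow> real^'n \<Rightarrow> real" where
  "annulus_kernel R z = (if 1 \<le> norm z \<and> norm z \<le> R then 1 / norm z ^ CARD('n) else 0)"

lemma annulus_kernel_nonneg [simp]: "0 \<le> annulus_kernel R z"
  by (simp add: annulus_kernel_def)

text \<open>Measurability is joint in radius and point because the radius will be |x|^2 and vary
  with x.\<close>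

lemma annulus_kernel_measurable [measurable]:
  "(\<lambda>p. annulus_kernel (fst p) (snd p)) \<in> borel_measurable (borel \<Otimes>\<^sub>M (borel :: (real^'n) measure))"
  unfolding annulus_kernel_def
  by (intro measurable_If borel_measurable_divide borel_measurable_power borel_measurable_const) measurable

text \<open>Each dyadic shell has the same bound for its share of the integral of |z|^(-N), and the
  number of shells below |x|^2 grows like log |x|^2. This is where the logarithmic weight is
  consumed.\<close>

lemma annulus_kernel_integral:
  fixes x :: "real^'n"
  shows "(\<integral>\<^sup>+z. ennreal (annulus_kernel ((norm x)\<^sup>2) z) \<partial>(lborel :: (real^'n) measure))
    \<le> ennreal (unit_ball_vol (real CARD('n)) * 2 ^ CARD('n) * 3 * log_weight x)"
proof (cases "1 \<le> (norm x)\<^sup>2")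
  case False
  then have "annulus_kernel ((norm x)\<^sup>2) z = 0" for z :: "real^'n"
    by (auto simp: annulus_kernel_def)
  then show ?thesis by simp
next
  case True
  let ?N = "CARD('n)"
  obtain J where J: "2 ^ J \<le> (norm x)\<^sup>2" "(norm x)\<^sup>2 < 2 ^ Suc J"
    using dyadic_ex[OF True] .
  let ?a = "\<lambda>j. if j \<le> J then 1 / (2 ^ j) ^ ?N else 0 :: real"
  have "(\<integral>\<^sup>+z. ennreal (annulus_kernel ((norm x)\<^sup>2) z) \<partial>(lborel :: (real^'n) measure))
    \<le> ennreal (unit_ball_vol (real ?N) * (\<Sum>j\<in>{..J}. 2 ^ ?N))"
  proof (rule nn_integral_dyadic_le[where a = ?a and r = "\<lambda>j. 2 ^ Suc j" and b = "\<lambda>j. if j \<in> {..J} then 2 ^ ?N else 0"])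
    fix z :: "real^'n"
    show "ennreal (annulus_kernel ((norm x)\<^sup>2) z) \<le> (\<Sum>j. ennreal (?a j) * indicator (ball 0 (2 ^ Suc j)) z)"
    proof (cases "1 \<le> norm z \<and> norm z \<le> (norm x)\<^sup>2")
      case False
      then show ?thesis by (auto simp: annulus_kernel_def)
    next
      case True
      then obtain j where j: "2 ^ j \<le> norm z" "norm z < 2 ^ Suc j"
        using dyadic_ex by blast
      have "(2::real) ^ j < 2 ^ Suc J" using j(1) True J(2) by linarith
      then have jJ: "j \<le> J" by (subst (asm) power_strict_increasing_iff) auto
      have "1 / norm z ^ ?N \<le> 1 / (2 ^ j) ^ ?N"
        using j(1) True by (intro divide_left_mono power_mono mult_pos_pos zero_less_power) (auto intro: less_le_trans[of 0 1])
      then show ?thesis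
        using j True jJ by (intro le_suminf_indicator[where j = j] ennreal_leI) (auto simp: annulus_kernel_def)
    qed
  next
    show "(\<lambda>j. if j \<in> {..J} then 2 ^ ?N else 0 :: real) sums (\<Sum>j\<in>{..J}. 2 ^ ?N)"
      by (rule sums_If_finite_set) simp
  qed (auto simp: power_mult_distrib)
  also have "\<dots> \<le> ennreal (unit_ball_vol (real ?N) * 2 ^ ?N * 3 * log_weight x)"
  proof (rule ennreal_leI)
    have "real J * ln 2 = ln (2 ^ J)" by (simp add: ln_realpow)
    also have "\<dots> \<le> log_weight x"
      unfolding log_weight_def using J True
      by (subst ln_le_cancel_iff) (auto intro: add_pos_nonneg order_trans[OF _ less_imp_le[OF less_add_same_cancel2[THEN iffD2, OF exp_gt_zero]]])
    finally have 1: "real J * ln 2 \<le> log_weight x" .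
    \<comment> \<open>ln 2 \<ge> 1/2 gives J \<le> 2 \<open>log_weight x\<close>; the additional
      shell, from counting 0 to J, is absorbed by \<open>log_weight x\<close> \<ge> 1, whence the
      3.\<close>
    have "1 / 2 \<le> ln (2::real)" using ln2_ge_two_thirds by simp
    then have "real J * (1 / 2) \<le> real J * ln 2" by (intro mult_left_mono) auto
    then have "real J \<le> 2 * log_weight x" using 1 by linarith
    then have "real (Suc J) \<le> 3 * log_weight x" using log_weight_ge_1[of x] by linarith
    then have "unit_ball_vol (real ?N) * 2 ^ ?N * real (Suc J) \<le> unit_ball_vol (real ?N) * 2 ^ ?N * (3 * log_weight x)"
      by (intro mult_left_mono) auto
    then show "unit_ball_vol (real ?N) * (\<Sum>j\<in>{..J}. 2 ^ ?N) \<le> unit_ball_vol (real ?N) * 2 ^ ?N * 3 * log_weight x"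
      by (simp add: algebra_simps)
  qed
  finally show ?thesis .
qed

section \<open>A majorant for the kernel at distance at least one\<close>

definition far_kernel :: "real^'n \<Rightarrow> real" where
  "far_kernel z = (if 1 \<le> norm z then 1 / norm z ^ CARD('n) else 0)"

lemma far_kernel_nonneg [simp]: "0 \<le> far_kernel z"
  by (simp add: far_kernel_def)

lemma far_kernel_measurable [measurable]: "far_kernel \<in> borel_measurable (borel :: (real^'n) measure)"
  unfolding far_kernel_def[abs_def]
  by (intro measurable_If borel_measurable_divide borel_measurable_power borel_measurable_const) measurable

lemma weighted_am_gm: "0 < s \<Longrightarrow> 2 * (\<bar>a\<bar> * \<bar>b\<bar>) \<le> s * a\<^sup>2 + (1 / s) * (b\<^sup>2 :: real)"
proof -
  assume s: "0 < s"
  have "0 \<le> (s * \<bar>a\<bar> - \<bar>b\<bar>)\<^sup>2 / s" using s by simp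
  also have "\<dots> = s * a\<^sup>2 + (1 / s) * b\<^sup>2 - 2 * (\<bar>a\<bar> * \<bar>b\<bar>)"
    using s by (simp add: field_simps power2_eq_square)
  finally show ?thesis by simp
qed

text \<open>With \<open>r = \<bar>x - y\<bar>\<close>: if \<open>\<bar>x\<bar>\<^sup>2 < r\<close>, the weight \<open>r powr (- N / 3)\<close> in the inequality between the
  means trades decay in \<open>r\<close> for decay in \<open>\<bar>x\<bar>\<close>, so that both factors become integrable.\<close>

lemma far_kernel_aux:
  fixes x y :: "real^'n"
  assumes "(norm x)\<^sup>2 < norm (x - y)"
  shows "2 * (\<bar>a\<bar> * \<bar>b\<bar>) * far_kernel (x - y) \<le> a\<^sup>2 * far_decay (x - y) + b\<^sup>2 * far_decay x"
proof (cases "1 \<le> norm (x - y)")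
  case False
  then show ?thesis by (simp add: far_kernel_def)
next
  case True
  let ?r = "norm (x - y)" and ?N = "real CARD('n)"
  have r: "0 < ?r" using True by linarith
  have k: "far_kernel (x - y) = ?r powr (- ?N)"
    using True r by (simp add: far_kernel_def powr_minus_divide powr_realpow)
  have s: "0 < ?r powr (- ?N / 3)" using r by simp
  have 1: "?r powr (- ?N / 3) * ?r powr (- ?N) = far_decay (x - y)"
    using True by (simp add: far_decay_def powr_add[symmetric] max_def)
  have 2: "(1 / ?r powr (- ?N / 3)) * ?r powr (- ?N) \<le> far_decay x"
  proof -
    have "(1 / ?r powr (- ?N / 3)) * ?r powr (- ?N) = ?r powr (- (2 * ?N / 3))"
      by (simp add: powr_minus_divide[symmetric] powr_add[symmetric])
    \<comment> \<open>Both 1 and |x|^2 are at most r, and the exponent is negative.\<close>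
    also have "\<dots> \<le> ((max 1 (norm x))\<^sup>2) powr (- (2 * ?N / 3))"
      using assms True by (intro powr_mono2') (auto simp: max_def)
    also have "\<dots> = far_decay x"
      by (subst powr_numeral[symmetric]) (auto simp: powr_powr far_decay_def simp del: powr_numeral)
    finally show ?thesis .
  qed
  have "2 * (\<bar>a\<bar> * \<bar>b\<bar>) * far_kernel (x - y)
      \<le> (?r powr (- ?N / 3) * a\<^sup>2 + (1 / ?r powr (- ?N / 3)) * b\<^sup>2) * far_kernel (x - y)"
    by (intro mult_right_mono weighted_am_gm s) auto
  also have "\<dots> = a\<^sup>2 * (?r powr (- ?N / 3) * ?r powr (- ?N)) + b\<^sup>2 * ((1 / ?r powr (- ?N / 3)) * ?r powr (- ?N))"
    by (simp add: k algebra_simps)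
  also have "\<dots> \<le> a\<^sup>2 * far_decay (x - y) + b\<^sup>2 * far_decay x"
    using 1 2 by (intro add_mono mult_left_mono) auto
  finally show ?thesis .
qed

lemma far_decay_minus: "far_decay (x - y) = far_decay (y - x)"
  by (simp add: far_decay_def norm_minus_commute)

lemma far_kernel_minus: "far_kernel (x - y) = far_kernel (y - x)"
  by (simp add: far_kernel_def norm_minus_commute)


text \<open>Adding the majorants of all regions avoids a case distinction, so measurability and the
  integral over \<open>y\<close> stay simple. As in Schur's test, integrating out \<open>y\<close>
  has to leave at most a multiple of \<open>log_weight x\<close>.\<close>

definition far_bound :: "real^'n \<Rightarrow> real^'n \<Rightarrow> real" where
  "far_bound x y = annulus_kernel ((norm x)\<^sup>2) (y - x) + far_decay (y - x) + far_decay y"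

lemma far_bound_nonneg [simp]: "0 \<le> far_bound x y"
  by (simp add: far_bound_def)

lemma far_bound_measurable [measurable]:
  assumes [measurable]: "f \<in> measurable M (borel :: (real^'n) measure)" "g \<in> measurable M borel"
  shows "(\<lambda>p. far_bound (f p) (g p)) \<in> borel_measurable M"
proof -
  have "(\<lambda>p. ((norm (f p))\<^sup>2, g p - f p)) \<in> measurable M (borel \<Otimes>\<^sub>M borel)"
    by measurable
  from measurable_compose[OF this annulus_kernel_measurable]
  have [measurable]: "(\<lambda>p. annulus_kernel ((norm (f p))\<^sup>2) (g p - f p)) \<in> borel_measurable M"
    by simp
  show ?thesis unfolding far_bound_def by measurable
qed

text \<open>With r = |x - y|, the cases r > |x|^2 and r > |y|^2 are mirror images. Otherwise a
  nonzero kernel value comes from the annulus as seen from either end, and the plain mean inequality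
  suffices because both annulus integrals are controlled.\<close>

lemma far_kernel_le:
  fixes x y :: "real^'n"
  shows "2 * (\<bar>a\<bar> * \<bar>b\<bar>) * far_kernel (x - y) \<le> a\<^sup>2 * far_bound x y + b\<^sup>2 * far_bound y x"
proof -
  consider "(norm x)\<^sup>2 < norm (x - y)" | "(norm y)\<^sup>2 < norm (x - y)"
    | "norm (x - y) \<le> (norm x)\<^sup>2" "norm (x - y) \<le> (norm y)\<^sup>2" by linarith
  then show ?thesis
  proof cases
    case 1
    have "2 * (\<bar>a\<bar> * \<bar>b\<bar>) * far_kernel (x - y) \<le> a\<^sup>2 * far_decay (x - y) + b\<^sup>2 * far_decay x"
      by (rule far_kernel_aux[OF 1])
    also have "\<dots> \<le> a\<^sup>2 * far_bound x y + b\<^sup>2 * far_bound y x"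
      by (intro add_mono mult_left_mono) (auto simp: far_bound_def far_decay_minus[of x y])
    finally show ?thesis .
  next
    case 2
    then have "2 * (\<bar>b\<bar> * \<bar>a\<bar>) * far_kernel (y - x) \<le> b\<^sup>2 * far_decay (y - x) + a\<^sup>2 * far_decay y"
      by (intro far_kernel_aux) (simp add: norm_minus_commute)
    also have "\<dots> \<le> b\<^sup>2 * far_bound y x + a\<^sup>2 * far_bound x y"
      by (intro add_mono mult_left_mono) (auto simp: far_bound_def far_decay_minus[of x y])
    finally show ?thesis by (simp add: mult.commute far_kernel_minus[of x y] add.commute)
  next
    case 3
    have k: "far_kernel (x - y) = annulus_kernel ((norm x)\<^sup>2) (y - x)"
        "far_kernel (x - y) = annulus_kernel ((norm y)\<^sup>2) (x - y)"
      using 3 by (auto simp: far_kernel_def annulus_kernel_def norm_minus_commute)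
    have "2 * (\<bar>a\<bar> * \<bar>b\<bar>) * far_kernel (x - y) \<le> (1 * a\<^sup>2 + (1 / 1) * b\<^sup>2) * far_kernel (x - y)"
      by (intro mult_right_mono weighted_am_gm) auto
    also have "\<dots> = a\<^sup>2 * annulus_kernel ((norm x)\<^sup>2) (y - x) + b\<^sup>2 * annulus_kernel ((norm y)\<^sup>2) (x - y)"
      by (simp add: k(1)[symmetric] k(2)[symmetric] algebra_simps)
    also have "\<dots> \<le> a\<^sup>2 * far_bound x y + b\<^sup>2 * far_bound y x"
      by (intro add_mono mult_left_mono) (auto simp: far_bound_def)
    finally show ?thesis .
  qed
qed

lemma far_bound_integral:
  obtains C where "0 < C"
    "\<And>x::real^'n. (\<integral>\<^sup>+y. ennreal (far_bound x y) \<partial>lborel) \<le> ennreal (C * log_weight x)"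
proof -
  define H where "H = enn2real (\<integral>\<^sup>+z. ennreal (far_decay z) \<partial>(lborel :: (real^'n) measure))"
  have H: "(\<integral>\<^sup>+z. ennreal (far_decay z) \<partial>(lborel :: (real^'n) measure)) = ennreal H"
    using far_decay_integral[where 'n='n] by (simp add: H_def)
  have H0: "0 \<le> H" by (simp add: H_def)
  define A where "A = unit_ball_vol (real CARD('n)) * 2 ^ CARD('n) * 3"
  have A: "0 < A" by (simp add: A_def)
  have "(\<integral>\<^sup>+y. ennreal (far_bound x y) \<partial>lborel) \<le> ennreal ((A + 2 * H) * log_weight x)" for x :: "real^'n"
  proof -
    have [measurable]: "(\<lambda>z::real^'n. annulus_kernel ((norm x)\<^sup>2) z) \<in> borel_measurable borel"
      using measurable_compose[OF _ annulus_kernel_measurable, of "\<lambda>z. ((norm x)\<^sup>2, z)" borel] by simp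
    have "(\<integral>\<^sup>+y. ennreal (far_bound x y) \<partial>lborel)
      = (\<integral>\<^sup>+y. ennreal (annulus_kernel ((norm x)\<^sup>2) (- x + y)) + ennreal (far_decay (- x + y)) + ennreal (far_decay y) \<partial>lborel)"
      by (simp add: far_bound_def)
    also have "\<dots> = (\<integral>\<^sup>+y. ennreal (annulus_kernel ((norm x)\<^sup>2) (- x + y)) \<partial>lborel)
       + (\<integral>\<^sup>+y. ennreal (far_decay (- x + y)) \<partial>lborel) + (\<integral>\<^sup>+y. ennreal (far_decay y) \<partial>(lborel :: (real^'n) measure))"
      by ((subst nn_integral_add, measurable)+)
    also have "\<dots> = (\<integral>\<^sup>+y. ennreal (annulus_kernel ((norm x)\<^sup>2) (y :: real^'n)) \<partial>lborel) + ennreal H + ennreal H"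
      by (subst (1 2) nn_integral_lborel_shift) (auto simp: H)
    also have "\<dots> \<le> ennreal (A * log_weight x) + ennreal H + ennreal H"
      unfolding A_def by (intro add_mono annulus_kernel_integral) auto
    also have "\<dots> = ennreal (A * log_weight x + H + H)"
      using A H0 by (simp add: ennreal_plus[symmetric] del: ennreal_plus)
    also have "\<dots> \<le> ennreal ((A + 2 * H) * log_weight x)"
      using mult_left_mono[OF log_weight_ge_1[of x] H0] by (intro ennreal_leI) (simp add: algebra_simps)
    finally show ?thesis .
  qed
  then show thesis using A H0 by (intro that[of "A + 2 * H"]) auto
qed

lemma far_energy_bound:
  obtains C where "0 < C"
    "\<And>u v :: real^'n \<Rightarrow> real. u \<in> borel_measurable borel \<Longrightarrow> v \<in> borel_measurable borel \<Longrightarrow>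
      (\<integral>\<^sup>+p. ennreal (\<bar>u (fst p)\<bar> * \<bar>v (snd p)\<bar> * far_kernel (fst p - snd p)) \<partial>(lborel \<Otimes>\<^sub>M lborel))
        \<le> ennreal C * (weight_sq u + weight_sq v)"
proof -
  obtain C where C: "0 < C"
    "\<And>x::real^'n. (\<integral>\<^sup>+y. ennreal (far_bound x y) \<partial>lborel) \<le> ennreal (C * log_weight x)"
    by (rule far_bound_integral) blast
  have *: "(\<integral>\<^sup>+x. \<integral>\<^sup>+y. ennreal ((u x)\<^sup>2 * far_bound x y) \<partial>lborel \<partial>lborel) \<le> ennreal C * weight_sq u"
    if [measurable]: "u \<in> borel_measurable borel" for u :: "real^'n \<Rightarrow> real"
  proof -
    have "(\<integral>\<^sup>+x. \<integral>\<^sup>+y. ennreal ((u x)\<^sup>2 * far_bound x y) \<partial>lborel \<partial>lborel)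
        = (\<integral>\<^sup>+x. ennreal ((u x)\<^sup>2) * (\<integral>\<^sup>+y. ennreal (far_bound x y) \<partial>lborel) \<partial>lborel)"
      by (intro nn_integral_cong) (simp add: ennreal_mult nn_integral_cmult)
    also have "\<dots> \<le> (\<integral>\<^sup>+x. ennreal ((u x)\<^sup>2) * ennreal (C * log_weight x) \<partial>lborel)"
      by (intro nn_integral_mono mult_left_mono C) auto
    also have "\<dots> = (\<integral>\<^sup>+x. ennreal C * ennreal ((u x)\<^sup>2 * log_weight x) \<partial>lborel)"
      using C(1) by (intro nn_integral_cong) (simp add: ennreal_mult[symmetric] algebra_simps)
    also have "\<dots> = ennreal C * weight_sq u"
      unfolding weight_sq_def by (rule nn_integral_cmult) measurable
    finally show ?thesis .
  qed
  have "(\<integral>\<^sup>+p. ennreal (\<bar>u (fst p)\<bar> * \<bar>v (snd p)\<bar> * far_kernel (fst p - snd p)) \<partial>(lborel \<Otimes>\<^sub>M lborel))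
      \<le> ennreal C * (weight_sq u + weight_sq v)"
    if [measurable]: "u \<in> borel_measurable borel" "v \<in> borel_measurable borel" for u v :: "real^'n \<Rightarrow> real"
  proof -
    let ?M = "(lborel :: (real^'n) measure) \<Otimes>\<^sub>M (lborel :: (real^'n) measure)"
    let ?F = "\<lambda>p. ennreal (\<bar>u (fst p)\<bar> * \<bar>v (snd p)\<bar> * far_kernel (fst p - snd p))"
    let ?U = "\<lambda>p. ennreal ((u (fst p))\<^sup>2 * far_bound (fst p) (snd p))"
    let ?V = "\<lambda>p. ennreal ((v (snd p))\<^sup>2 * far_bound (snd p) (fst p))"
    have "(\<integral>\<^sup>+p. ?F p \<partial>?M)
       \<le> (\<integral>\<^sup>+p. ?U p + ?V p \<partial>?M)"
    proof (rule nn_integral_mono)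
      fix p :: "(real^'n) \<times> (real^'n)"
      have "0 \<le> \<bar>u (fst p)\<bar> * \<bar>v (snd p)\<bar> * far_kernel (fst p - snd p)" by simp
      then have "\<bar>u (fst p)\<bar> * \<bar>v (snd p)\<bar> * far_kernel (fst p - snd p)
          \<le> (u (fst p))\<^sup>2 * far_bound (fst p) (snd p) + (v (snd p))\<^sup>2 * far_bound (snd p) (fst p)"
        using far_kernel_le[of "u (fst p)" "v (snd p)" "fst p" "snd p"] by linarith
      then have "?F p
          \<le> ennreal ((u (fst p))\<^sup>2 * far_bound (fst p) (snd p) + (v (snd p))\<^sup>2 * far_bound (snd p) (fst p))"
        by (rule ennreal_leI)
      then show "?F p
          \<le> ?U p + ?V p"
        by simp
    qed
    also have "\<dots> = (\<integral>\<^sup>+p. ?U p \<partial>?M)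
        + (\<integral>\<^sup>+p. ?V p \<partial>?M)"
      by (rule nn_integral_add) measurable
    \<comment> \<open>The two halves are integrated in opposite orders, each first over the variable
      that is absent from the squared function.\<close>
    also have "(\<integral>\<^sup>+p. ?U p \<partial>?M)
        = (\<integral>\<^sup>+x. \<integral>\<^sup>+y. ennreal ((u x)\<^sup>2 * far_bound x y) \<partial>lborel \<partial>lborel)"
      by (subst lborel.nn_integral_fst[symmetric]) auto
    also have "(\<integral>\<^sup>+p. ?V p \<partial>?M)
        = (\<integral>\<^sup>+y. \<integral>\<^sup>+x. ennreal ((v y)\<^sup>2 * far_bound y x) \<partial>lborel \<partial>lborel)"
      by (subst lborel_pair.nn_integral_snd[symmetric]) auto
    also have "(\<integral>\<^sup>+x. \<integral>\<^sup>+y. ennreal ((u x)\<^sup>2 * far_bound x y) \<partial>lborel \<partial>lborel)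
        + (\<integral>\<^sup>+y. \<integral>\<^sup>+x. ennreal ((v y)\<^sup>2 * far_bound y x) \<partial>lborel \<partial>lborel)
        \<le> ennreal C * weight_sq u + ennreal C * weight_sq v"
      by (intro add_mono *) measurable
    finally show ?thesis by (simp add: distrib_left)
  qed
  then show thesis using that C(1) by blast
qed

section \<open>The bilinear form with all its terms\<close>

lemma far_energy_eq:
  fixes u v :: "real^'n \<Rightarrow> real"
  shows "indicator {(x, y). 1 \<le> norm (x - y)} p *\<^sub>R (case p of (x, y) \<Rightarrow> u x * v y / norm (x - y) ^ CARD('n))
    = u (fst p) * v (snd p) * far_kernel (fst p - snd p)"
  by (auto simp: far_kernel_def indicator_def split: prod.splits)

lemma l2_inner_bound:
  fixes u v :: "real^'n \<Rightarrow> real"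
  assumes u: "u \<in> dlog_fun" and v: "v \<in> dlog_fun"
  shows "integrable lborel (\<lambda>x. u x * v x)"
    and "\<bar>\<integral>x. u x * v x \<partial>lborel\<bar> \<le> (dlog_ip u u + dlog_ip v v) / 2"
proof -
  have sq: "(\<integral>x. (w x)\<^sup>2 \<partial>lborel) \<le> dlog_ip w w" if "w \<in> dlog_fun" for w :: "real^'n \<Rightarrow> real"
  proof -
    have "integrable lborel (\<lambda>x. (w x)\<^sup>2)"
      using that by (simp add: dlog_fun_def sq_integrable_def)
    from nn_integral_eq_integral[OF this] have "ennreal (\<integral>x. (w x)\<^sup>2 \<partial>lborel) = l2_sq w"
      by (simp add: l2_sq_def)
    also have "\<dots> \<le> ennreal (dlog_ip w w)"
      using that by (simp add: dlog_enorm2_eq_ip(1)[symmetric] l2_sq_le_dlog_enorm2 dlog_fun_iff)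
    finally show ?thesis
      using dlog_enorm2_eq_ip(2)[OF that] by (simp add: ennreal_le_iff)
  qed
  have fin: "(\<integral>\<^sup>+x. ennreal (1 * (w x)\<^sup>2) \<partial>lborel) < \<infinity>" if "w \<in> dlog_fun" for w :: "real^'n \<Rightarrow> real"
    using that by (auto simp: dlog_fun_def sq_integrable_iff l2_sq_def)
  have meas: "u \<in> borel_measurable lborel" "v \<in> borel_measurable lborel"
    using u v by (auto simp: dlog_fun_iff)
  note * = integrable_weighted_prod[OF meas borel_measurable_const zero_le_one fin[OF u] fin[OF v]]
  show "integrable lborel (\<lambda>x. u x * v x)" using *(1) by simp
  show "\<bar>\<integral>x. u x * v x \<partial>lborel\<bar> \<le> (dlog_ip u u + dlog_ip v v) / 2"
    using *(2) sq[OF u] sq[OF v] by simp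
qed

lemma log_energy_bound:
  fixes u v :: "real^'n \<Rightarrow> real"
  assumes u: "u \<in> dlog_fun" and v: "v \<in> dlog_fun"
  shows "\<bar>log_energy u v\<bar> \<le> (dlog_ip u u + dlog_ip v v) / 2"
proof -
  let ?M = "(lborel :: (real^'n) measure) \<Otimes>\<^sub>M lborel"
  let ?E = "\<lambda>w :: real^'n \<Rightarrow> real. \<integral>p. kernel_pair p * (diff_pair w p)\<^sup>2 \<partial>?M"
  let ?c = "c_const CARD('n) / 2"
  have c: "0 \<le> ?c" using c_const_card_pos[where 'n='n] by linarith
  have meas: "diff_pair u \<in> borel_measurable ?M" "diff_pair v \<in> borel_measurable ?M"
    using u v by (auto simp: dlog_fun_iff)
  have fin: "(\<integral>\<^sup>+p. ennreal (kernel_pair p * (diff_pair w p)\<^sup>2) \<partial>?M) < \<infinity>" if "w \<in> dlog_fun" for w :: "real^'n \<Rightarrow> real"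
    using that by (auto simp: dlog_fun_iff gagliardo_eq_pair kernel_pair_def diff_pair_def)
  have 1: "?c * ?E w \<le> dlog_ip w w" if "w \<in> dlog_fun" for w :: "real^'n \<Rightarrow> real"
    using that by (auto simp: dlog_ip_eq power2_eq_square intro!: Bochner_Integration.integral_nonneg)
  have "\<bar>log_energy u v\<bar> = ?c * \<bar>\<integral>p. kernel_pair p * (diff_pair u p * diff_pair v p) \<partial>?M\<bar>"
    using c by (simp add: log_energy_eq[OF u v] abs_mult)
  also have "\<dots> \<le> ?c * (?E u / 2 + ?E v / 2)"
    by (intro mult_left_mono c integrable_weighted_prod(2) meas kernel_pair_measurable kernel_pair_nonneg fin u v)
  also have "\<dots> = (?c * ?E u + ?c * ?E v) / 2"
    by (simp only: distrib_left times_divide_eq_right add_divide_distrib)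
  also have "\<dots> \<le> (dlog_ip u u + dlog_ip v v) / 2"
    by (intro divide_right_mono add_mono 1 u v) simp
  finally show ?thesis .
qed

lemma weight_sq_le_dlog_ip: "u \<in> dlog_fun \<Longrightarrow> weight_sq u \<le> ennreal (dlog_ip u u)"
  by (simp add: dlog_enorm2_eq_ip(1)[symmetric] dlog_enorm2_eq dlog_fun_iff)

lemma log_energy_L_quadratic_bound:
  "\<exists>K>0. \<forall>u\<in>dlog_fun. \<forall>v\<in>dlog_fun.
      set_integrable (lborel \<Otimes>\<^sub>M lborel) {(x, y). norm (x - y) \<ge> 1}
          (\<lambda>(x, y). u x * (v :: real^'n \<Rightarrow> real) y / norm (x - y) ^ CARD('n)) \<and>
      \<bar>log_energy_L u v\<bar> \<le> K * (dlog_ip u u + dlog_ip v v)"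
proof -
  let ?M = "(lborel :: (real^'n) measure) \<Otimes>\<^sub>M lborel"
  obtain C where C: "0 < C" and Cb:
    "\<And>u v :: real^'n \<Rightarrow> real. u \<in> borel_measurable borel \<Longrightarrow> v \<in> borel_measurable borel \<Longrightarrow>
      (\<integral>\<^sup>+p. ennreal (\<bar>u (fst p)\<bar> * \<bar>v (snd p)\<bar> * far_kernel (fst p - snd p)) \<partial>?M)
        \<le> ennreal C * (weight_sq u + weight_sq v)"
    by (rule far_energy_bound) blast
  let ?F = "\<lambda>(u :: real^'n \<Rightarrow> real) v p. u (fst p) * v (snd p) * far_kernel (fst p - snd p)"
  have F: "integrable ?M (?F u v) \<and> \<bar>\<integral>p. ?F u v p \<partial>?M\<bar> \<le> C * (dlog_ip u u + dlog_ip v v)"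
    if u: "u \<in> dlog_fun" and v: "v \<in> dlog_fun" for u v :: "real^'n \<Rightarrow> real"
  proof -
    have [measurable]: "u \<in> borel_measurable borel" "v \<in> borel_measurable borel"
      using u v by (auto simp: dlog_fun_iff)
    note pos = dlog_enorm2_eq_ip(2)[OF u] dlog_enorm2_eq_ip(2)[OF v]
    have "(\<integral>\<^sup>+p. ennreal (norm (?F u v p)) \<partial>?M) \<le> ennreal C * (weight_sq u + weight_sq v)"
      using Cb[of u v] by (simp add: abs_mult)
    also have "\<dots> \<le> ennreal C * (ennreal (dlog_ip u u) + ennreal (dlog_ip v v))"
      by (intro mult_left_mono add_mono weight_sq_le_dlog_ip u v) auto
    also have "\<dots> = ennreal (C * (dlog_ip u u + dlog_ip v v))"
      using C pos by (simp add: ennreal_mult)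
    finally have le: "(\<integral>\<^sup>+p. ennreal (norm (?F u v p)) \<partial>?M) \<le> ennreal (C * (dlog_ip u u + dlog_ip v v))" .
    have int: "integrable ?M (?F u v)"
    proof (rule integrableI_bounded)
      show "(\<integral>\<^sup>+p. ennreal (norm (?F u v p)) \<partial>?M) < \<infinity>"
        using le by (rule order.strict_trans1) simp
    qed measurable
    have "ennreal \<bar>\<integral>p. ?F u v p \<partial>?M\<bar> \<le> (\<integral>\<^sup>+p. ennreal (norm (?F u v p)) \<partial>?M)"
      using integral_norm_bound_ennreal[OF int] by simp
    with le have "ennreal \<bar>\<integral>p. ?F u v p \<partial>?M\<bar> \<le> ennreal (C * (dlog_ip u u + dlog_ip v v))"
      by (rule order_trans[rotated])
    then show ?thesis
      using int C pos by (simp add: ennreal_le_iff)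
  qed
  let ?c = "c_const CARD('n)"
  have c: "0 < ?c" by simp
  \<comment> \<open>One summand for each of the three terms of the form.\<close>
  define K where "K = 1 / 2 + ?c * C + \<bar>rho_const CARD('n)\<bar> / 2"
  have bd: "\<bar>log_energy_L u v\<bar> \<le> K * (dlog_ip u u + dlog_ip v v)"
    if u: "u \<in> dlog_fun" and v: "v \<in> dlog_fun" for u v :: "real^'n \<Rightarrow> real"
  proof -
    let ?S = "dlog_ip u u + dlog_ip v v"
    have eq: "log_energy_L u v = log_energy u v - ?c * (\<integral>p. ?F u v p \<partial>?M) + rho_const CARD('n) * (\<integral>x. u x * v x \<partial>lborel)"
      unfolding log_energy_L_def set_lebesgue_integral_def by (simp only: far_energy_eq)
    have 1: "\<bar>?c * (\<integral>p. ?F u v p \<partial>?M)\<bar> \<le> ?c * (C * ?S)"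
      unfolding abs_mult using F[OF u v] c by (simp add: abs_of_pos)
    have 2: "\<bar>rho_const CARD('n) * (\<integral>x. u x * v x \<partial>lborel)\<bar> \<le> \<bar>rho_const CARD('n)\<bar> * (?S / 2)"
      unfolding abs_mult by (intro mult_left_mono l2_inner_bound u v) simp
    have "\<bar>log_energy_L u v\<bar> \<le> ?S / 2 + ?c * (C * ?S) + \<bar>rho_const CARD('n)\<bar> * (?S / 2)"
      using log_energy_bound[OF u v] 1 2 unfolding eq by linarith
    also have "\<dots> = K * ?S"
      by (simp add: K_def algebra_simps)
    finally show ?thesis .
  qed
  have K: "0 < K"
    unfolding K_def using c C by (intro add_pos_nonneg add_pos_pos mult_pos_pos) auto
  have "set_integrable (lborel \<Otimes>\<^sub>M lborel) {(x, y). norm (x - y) \<ge> 1}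
          (\<lambda>(x, y). u x * v y / norm (x - y) ^ CARD('n))"
    if u: "u \<in> dlog_fun" and v: "v \<in> dlog_fun" for u v :: "real^'n \<Rightarrow> real"
    unfolding set_integrable_def far_energy_eq using F[OF u v] by simp
  then show ?thesis using K bd by blast
qed

text \<open>The factors s and 1/s cancel inside each integrand, before any integration.\<close>

lemma log_energy_L_homogeneous:
  assumes "s \<noteq> 0"
  shows "log_energy_L (\<lambda>x. s * u x) (\<lambda>x. (1 / s) * v x) = log_energy_L u v"
proof -
  have 1: "(s * a - s * b) * ((1 / s) * c - (1 / s) * d) = (a - b) * (c - d)"
    "(s * a) * ((1 / s) * b) = a * b" for a b c d
    using assms by (simp_all add: field_simps)
  show ?thesis
    unfolding log_energy_L_def log_energy_def 1 ..
qed

lemma dlog_ip_scale_both: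
  assumes "u \<in> dlog_fun"
  shows "dlog_ip (\<lambda>x. c * u x) (\<lambda>x. c * u x) = c\<^sup>2 * dlog_ip u u"
  using assms dlog_ip_commute[OF assms dlog_fun_scale[OF assms]]
  by (simp add: dlog_ip_scale dlog_fun_scale power2_eq_square)

text \<open>The best choice is s^2 = b/a, which balances the two terms at a b each. If a or b
  vanishes, sending s to infinity or to 0 respectively gives t \<le> 0, except that for a = b = 0
  any s does.\<close>

lemma scaling_bound:
  fixes a b t :: real
  assumes "0 \<le> a" "0 \<le> b" "0 \<le> K" and t: "\<And>s. 0 < s \<Longrightarrow> t \<le> K * (s\<^sup>2 * a\<^sup>2 + (1 / s)\<^sup>2 * b\<^sup>2)"
  shows "t \<le> 2 * K * a * b"
proof (cases "a = 0 \<or> b = 0")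
  case False
  then have ab: "0 < a" "0 < b" using assms by auto
  have "(sqrt (b / a))\<^sup>2 * a\<^sup>2 = a * b" "(1 / sqrt (b / a))\<^sup>2 * b\<^sup>2 = a * b"
    using ab by (auto simp: power_divide power2_eq_square field_simps)
  with t[of "sqrt (b / a)"] ab show ?thesis by simp
next
  case True
  have "t \<le> 0"
  proof (rule field_le_epsilon)
    fix e :: real assume e: "0 < e"
    define m where "m = K * (a\<^sup>2 + b\<^sup>2)"
    have m: "0 \<le> m" using assms by (simp add: m_def)
    \<comment> \<open>Makes s^2 m \<le> e; it is used as it stands when b = 0 and inverted when a =
      0.\<close>
    define s where "s = sqrt (e / (m + 1))"
    have s: "0 < s" "s\<^sup>2 = e / (m + 1)" using e m by (auto simp: s_def)
    have me: "m * (e / (m + 1)) \<le> e" using e m by (simp add: field_simps)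
    from True show "t \<le> 0 + e"
    proof
      assume "a = 0"
      then show ?thesis
        using t[of "1 / s"] s me by (simp add: m_def power_divide algebra_simps)
    next
      assume "b = 0"
      then show ?thesis
        using t[of s] s me by (simp add: m_def algebra_simps)
    qed
  qed
  then show ?thesis using True by auto
qed

lemma log_energy_L_bound:
  "\<exists>C>0. \<forall>u\<in>dlog_fun. \<forall>v\<in>dlog_fun.
      log_energy_finite u (v :: real^'n \<Rightarrow> real) \<and>
      set_integrable (lborel \<Otimes>\<^sub>M lborel) {(x, y). norm (x - y) \<ge> 1}
          (\<lambda>(x, y). u x * v y / norm (x - y) ^ CARD('n)) \<and>
      integrable lborel (\<lambda>x. u x * v x) \<and>
      \<bar>log_energy_L u v\<bar> \<le> C * dlog_norm u * dlog_norm v"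
proof -
  have "\<exists>K. 0 < K \<and> (\<forall>u\<in>dlog_fun. \<forall>v\<in>dlog_fun.
      set_integrable (lborel \<Otimes>\<^sub>M lborel) {(x, y). norm (x - y) \<ge> 1}
          (\<lambda>(x, y). u x * (v :: real^'n \<Rightarrow> real) y / norm (x - y) ^ CARD('n)) \<and>
      \<bar>log_energy_L u v\<bar> \<le> K * (dlog_ip u u + dlog_ip v v))" (is "\<exists>K. ?P K")
    by (rule log_energy_L_quadratic_bound)
  then obtain K where *: "?P K" ..
  note K = conjunct1[OF *]
  note int = conjunct1[OF bspec[OF bspec[OF conjunct2[OF *]]]]
  note bd = conjunct2[OF bspec[OF bspec[OF conjunct2[OF *]]]]
  have 2: "\<bar>log_energy_L u v\<bar> \<le> (2 * K) * dlog_norm u * dlog_norm v"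
    if u: "u \<in> dlog_fun" and v: "v \<in> dlog_fun" for u v :: "real^'n \<Rightarrow> real"
  proof (rule scaling_bound)
    fix s :: real assume "0 < s"
    then have "s \<noteq> 0" by simp
    note h = log_energy_L_homogeneous[OF this, of u v]
    show "\<bar>log_energy_L u v\<bar> \<le> K * (s\<^sup>2 * (dlog_norm u)\<^sup>2 + (1 / s)\<^sup>2 * (dlog_norm v)\<^sup>2)"
      using bd[OF dlog_fun_scale[OF u, of s] dlog_fun_scale[OF v, of "1 / s"]]
      unfolding h dlog_ip_scale_both[OF u] dlog_ip_scale_both[OF v] dlog_norm_def
        real_sqrt_pow2[OF dlog_enorm2_eq_ip(2)[OF u]] real_sqrt_pow2[OF dlog_enorm2_eq_ip(2)[OF v]] .
  qed (use K dlog_enorm2_eq_ip(2) u v in \<open>auto simp: dlog_norm_def\<close>)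
  show ?thesis
  proof (intro exI[of _ "2 * K"] conjI ballI)
    show "0 < 2 * K" using K by simp
  qed (auto intro!: log_energy_finite int l2_inner_bound 2)
qed

section \<open>Density of test functions\<close>

lemma gagliardo_lipschitz_finite:
  fixes f :: "real^'n \<Rightarrow> real"
  assumes [measurable]: "f \<in> borel_measurable borel" and L: "\<And>x y. \<bar>f x - f y\<bar> \<le> L * norm (x - y)"
    and R: "\<And>x. R \<le> norm x \<Longrightarrow> f x = 0"
  shows "gagliardo f < \<infinity>"
proof -
  let ?v = "emeasure lborel (ball (0::real^'n) (R + 1))"
  have le: "ennreal (sing_kernel z) * shift_sq f z
      \<le> ennreal (L\<^sup>2) * ?v * ennreal (sing_kernel z * (norm z)\<^sup>2)" for z :: "real^'n"
  proof (cases "norm z < 1")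
    case False
    then show ?thesis by (simp add: sing_kernel_def)
  next
    case True
    \<comment> \<open>For |z| < 1 both f(x) and f(x + z) vanish unless |x| < R + 1, so the Lipschitz
      bound is integrated over a ball only.\<close>
    have "shift_sq f z \<le> (\<integral>\<^sup>+x. ennreal (L\<^sup>2 * (norm z)\<^sup>2) * indicator (ball (0::real^'n) (R + 1)) x \<partial>lborel)"
      unfolding shift_sq_def
    proof (rule nn_integral_mono)
      fix x
      show "ennreal ((f (x + z) - f x)\<^sup>2) \<le> ennreal (L\<^sup>2 * (norm z)\<^sup>2) * indicator (ball 0 (R + 1)) x"
      proof (cases "norm x < R + 1")
        case False
        then have "R \<le> norm (x + z)" using True norm_triangle_ineq2[of x "- z"] by simp
        then show ?thesis using False R[of x] R[of "x + z"] by simp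
      next
        case True
        have "\<bar>f (x + z) - f x\<bar>\<^sup>2 \<le> (L * norm z)\<^sup>2"
          using L[of "x + z" x] by (intro power_mono) auto
        then show ?thesis using True by (simp add: power_mult_distrib ennreal_leI)
      qed
    qed
    also have "\<dots> = ennreal (L\<^sup>2) * ennreal ((norm z)\<^sup>2) * ?v"
      by (simp add: nn_integral_cmult_indicator ennreal_mult)
    finally have "ennreal (sing_kernel z) * shift_sq f z \<le> ennreal (sing_kernel z) * (ennreal (L\<^sup>2) * ennreal ((norm z)\<^sup>2) * ?v)"
      by (rule mult_left_mono) simp
    also have "\<dots> = ennreal (L\<^sup>2) * ?v * ennreal (sing_kernel z * (norm z)\<^sup>2)"
      by (simp add: ennreal_mult mult.assoc mult.left_commute mult.commute)
    finally show ?thesis .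
  qed
  have "gagliardo f \<le> (\<integral>\<^sup>+z. ennreal (L\<^sup>2) * ?v * ennreal (sing_kernel z * (norm z)\<^sup>2) \<partial>(lborel :: (real^'n) measure))"
    unfolding gagliardo_def by (intro nn_integral_mono le)
  also have "\<dots> = ennreal (L\<^sup>2) * ?v * (\<integral>\<^sup>+z. ennreal (sing_kernel z * (norm z)\<^sup>2) \<partial>(lborel :: (real^'n) measure))"
    by (rule nn_integral_cmult) measurable
  also have "\<dots> < \<infinity>"
    using sing_kernel_sq_norm_integral[where 'n='n] emeasure_lborel_ball_finite[of "0::real^'n" "R + 1"]
    by (simp add: ennreal_mult_less_top)
  finally show ?thesis .
qed

lemma weight_sq_le_support:
  fixes f :: "real^'n \<Rightarrow> real"
  assumes [measurable]: "f \<in> borel_measurable borel" and R: "\<And>x. R \<le> norm x \<Longrightarrow> f x = 0"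
  shows "weight_sq f \<le> ennreal (ln (exp 1 + R\<^sup>2)) * l2_sq f"
proof -
  have "weight_sq f \<le> (\<integral>\<^sup>+x. ennreal (ln (exp 1 + R\<^sup>2)) * ennreal ((f x)\<^sup>2) \<partial>lborel)"
    unfolding weight_sq_def
  proof (rule nn_integral_mono)
    fix x
    show "ennreal ((f x)\<^sup>2 * log_weight x) \<le> ennreal (ln (exp 1 + R\<^sup>2)) * ennreal ((f x)\<^sup>2)"
    proof (cases "R \<le> norm x")
      case False
      then have "(norm x)\<^sup>2 \<le> R\<^sup>2" by (intro power_mono) auto
      then have "log_weight x \<le> ln (exp 1 + R\<^sup>2)"
        unfolding log_weight_def by (subst ln_le_cancel_iff) (auto intro: add_pos_nonneg)
      then have "(f x)\<^sup>2 * log_weight x \<le> ln (exp 1 + R\<^sup>2) * (f x)\<^sup>2"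
        by (subst mult.commute) (intro mult_right_mono, auto)
      then show ?thesis by (subst ennreal_mult''[symmetric]) (auto intro: ennreal_leI)
    qed (simp add: R)
  qed
  also have "\<dots> = ennreal (ln (exp 1 + R\<^sup>2)) * l2_sq f"
    unfolding l2_sq_def by (rule nn_integral_cmult) measurable
  finally show ?thesis .
qed

lemma Cc_infinity_dlog_fun:
  fixes f :: "real^'n \<Rightarrow> real"
  assumes f: "f \<in> Cc_infinity"
  shows "f \<in> dlog_fun"
proof -
  have m: "f \<in> borel_measurable borel" using f by (rule Cc_infinity_measurable)
  obtain R where R: "\<And>x. R \<le> norm x \<Longrightarrow> f x = 0" using f by (auto simp: Cc_infinity_iff)
  obtain L where L: "\<And>x y. \<bar>f x - f y\<bar> \<le> L * norm (x - y)" using Cc_infinity_lipschitz[OF f] by blast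
  have "weight_sq f \<le> ennreal (ln (exp 1 + R\<^sup>2)) * l2_sq f"
    by (rule weight_sq_le_support[OF m R])
  also have "\<dots> < \<infinity>"
    using Cc_infinity_sq_integrable[OF f] by (simp add: sq_integrable_iff ennreal_mult_less_top)
  finally show ?thesis
    using gagliardo_lipschitz_finite[OF m L R] m by (simp add: dlog_fun_iff)
qed

text \<open>Complement of a cutoff: multiplying by it gives exactly the error of truncating v.
  Lipschitz continuity is enough, since smoothness is supplied afterwards by mollification.\<close>

definition outer_cutoff :: "nat \<Rightarrow> real^'n \<Rightarrow> real" where
  "outer_cutoff n x = min 1 (max 0 (norm x - real n))"

lemma outer_cutoff_measurable [measurable]: "outer_cutoff n \<in> borel_measurable borel"
  unfolding outer_cutoff_def[abs_def] by measurable

lemma outer_cutoff_bounds: "0 \<le> outer_cutoff n x" "outer_cutoff n x \<le> 1"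
  by (auto simp: outer_cutoff_def)

lemma outer_cutoff_lipschitz: "\<bar>outer_cutoff n x - outer_cutoff n y\<bar> \<le> norm (x - y)"
proof -
  have "\<bar>outer_cutoff n x - outer_cutoff n y\<bar> \<le> \<bar>norm x - norm y\<bar>"
    by (auto simp: outer_cutoff_def min_def max_def)
  also have "\<dots> \<le> norm (x - y)" by (rule norm_triangle_ineq3)
  finally show ?thesis .
qed

lemma outer_cutoff_eventually_0: "\<forall>\<^sub>F n in sequentially. outer_cutoff n x = 0"
proof -
  obtain N :: nat where "norm x \<le> real N" using real_arch_simple by blast
  then have "outer_cutoff n x = 0" if "N \<le> n" for n
    using that of_nat_mono[of N n, where 'a=real] by (auto simp: outer_cutoff_def)
  then show ?thesis by (auto simp: eventually_sequentially)
qed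

text \<open>Dominated convergence over pairs. The difference of the product splits into increments
  of v and of the cutoff. The latter are at most |x - y|, and the kernel times |x - y|^2 is
  integrable in x, so v in L^2 makes the majorant finite. At each fixed pair the multiplier is
  eventually 0.\<close>

lemma outer_cutoff_enorm2_tendsto_0:
  fixes v :: "real^'n \<Rightarrow> real"
  assumes v: "v \<in> dlog_fun"
  shows "(\<lambda>n. dlog_enorm2 (\<lambda>x. outer_cutoff n x * v x)) \<longlonglongrightarrow> 0"
proof -
  have [measurable]: "v \<in> borel_measurable borel" using v by (simp add: dlog_fun_iff)
  let ?M = "(lborel :: (real^'n) measure) \<Otimes>\<^sub>M (lborel :: (real^'n) measure)"
  let ?g = "\<lambda>n x. outer_cutoff n x * v x"
  let ?w = "\<lambda>p :: (real^'n) \<times> (real^'n). 2 * ennreal (kernel_pair p * (diff_pair v p)\<^sup>2)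
      + 2 * (ennreal (kernel_pair p * (norm (fst p - snd p))\<^sup>2) * ennreal ((v (snd p))\<^sup>2))"
  have kappa: "(\<integral>\<^sup>+p. ennreal (kernel_pair p * (norm (fst p - snd p))\<^sup>2) * ennreal ((v (snd p))\<^sup>2) \<partial>?M) < \<infinity>"
  proof -
    let ?k = "\<lambda>z :: real^'n. ennreal (sing_kernel z * (norm z)\<^sup>2)"
    have "(\<integral>\<^sup>+p. ennreal (kernel_pair p * (norm (fst p - snd p))\<^sup>2) * ennreal ((v (snd p))\<^sup>2) \<partial>?M)
      = (\<integral>\<^sup>+y. \<integral>\<^sup>+x. ?k (x - y) * ennreal ((v y)\<^sup>2) \<partial>lborel \<partial>lborel)"
      unfolding kernel_pair_def by (subst lborel_pair.nn_integral_snd[symmetric]) auto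
    also have "\<dots> = (\<integral>\<^sup>+y. (\<integral>\<^sup>+x. ?k x \<partial>lborel) * ennreal ((v y)\<^sup>2) \<partial>lborel)"
    proof (rule nn_integral_cong)
      fix y
      have "(\<integral>\<^sup>+x. ?k (- y + x) \<partial>lborel) = (\<integral>\<^sup>+x. ?k x \<partial>lborel)"
        by (rule nn_integral_lborel_shift) measurable
      then show "(\<integral>\<^sup>+x. ?k (x - y) * ennreal ((v y)\<^sup>2) \<partial>lborel) = (\<integral>\<^sup>+x. ?k x \<partial>lborel) * ennreal ((v y)\<^sup>2)"
        by (simp add: nn_integral_multc)
    qed
    also have "\<dots> = (\<integral>\<^sup>+x. ?k x \<partial>lborel) * l2_sq v"
      unfolding l2_sq_def by (rule nn_integral_cmult) measurable
    also have "\<dots> < \<infinity>"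
      using sing_kernel_sq_norm_integral[where 'n='n] dlog_fun_sq_integrable[OF v]
      by (simp add: ennreal_mult_less_top sq_integrable_iff)
    finally show ?thesis .
  qed
  have "(\<integral>\<^sup>+p. ?w p \<partial>?M) = 2 * gagliardo v
      + 2 * (\<integral>\<^sup>+p. ennreal (kernel_pair p * (norm (fst p - snd p))\<^sup>2) * ennreal ((v (snd p))\<^sup>2) \<partial>?M)"
    by (simp add: nn_integral_add nn_integral_cmult gagliardo_eq_pair kernel_pair_def diff_pair_def)
  then have wfin: "(\<integral>\<^sup>+p. ?w p \<partial>?M) < \<infinity>"
    using v kappa by (simp add: dlog_fun_iff ennreal_mult_less_top)
  have "(\<lambda>n. \<integral>\<^sup>+p. ennreal (kernel_pair p * (diff_pair (?g n) p)\<^sup>2) \<partial>?M) \<longlonglongrightarrow> (\<integral>\<^sup>+p. 0 \<partial>?M)"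
  proof (rule nn_integral_dominated_convergence[where w = ?w])
    show "(\<integral>\<^sup>+p. ?w p \<partial>?M) < \<infinity>" by (rule wfin)
  next
    fix n
    show "AE p in ?M. ennreal (kernel_pair p * (diff_pair (?g n) p)\<^sup>2) \<le> ?w p"
    proof (rule AE_I2)
      fix p :: "(real^'n) \<times> (real^'n)"
      let ?x = "fst p" and ?y = "snd p"
      let ?a = "outer_cutoff n ?x" and ?b = "outer_cutoff n ?y"
      have "diff_pair (?g n) p = ?a * (v ?x - v ?y) + v ?y * (?a - ?b)"
        by (simp add: diff_pair_def algebra_simps)
      then have "(diff_pair (?g n) p)\<^sup>2 \<le> 2 * (?a * (v ?x - v ?y))\<^sup>2 + 2 * (v ?y * (?a - ?b))\<^sup>2"
        using sq_sum_le by simp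
      moreover have "(?a * (v ?x - v ?y))\<^sup>2 \<le> (diff_pair v p)\<^sup>2"
        using outer_cutoff_bounds[of n ?x]
        by (auto simp: diff_pair_def power_mult_distrib intro!: mult_left_le_one_le power_le_one)
      moreover have "(v ?y * (?a - ?b))\<^sup>2 \<le> (norm (?x - ?y))\<^sup>2 * (v ?y)\<^sup>2"
        using power_mono[OF outer_cutoff_lipschitz[of n ?x ?y], of 2]
        by (subst power_mult_distrib, subst mult.commute) (intro mult_right_mono, auto)
      ultimately have "(diff_pair (?g n) p)\<^sup>2 \<le> 2 * (diff_pair v p)\<^sup>2 + 2 * ((norm (?x - ?y))\<^sup>2 * (v ?y)\<^sup>2)"
        by linarith
      then have "kernel_pair p * (diff_pair (?g n) p)\<^sup>2 \<le> kernel_pair p * (2 * (diff_pair v p)\<^sup>2 + 2 * ((norm (?x - ?y))\<^sup>2 * (v ?y)\<^sup>2))"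
        by (rule mult_left_mono) simp
      then have "ennreal (kernel_pair p * (diff_pair (?g n) p)\<^sup>2)
        \<le> ennreal (2 * (kernel_pair p * (diff_pair v p)\<^sup>2) + 2 * (kernel_pair p * (norm (?x - ?y))\<^sup>2 * (v ?y)\<^sup>2))"
        by (intro ennreal_leI) (simp add: algebra_simps)
      also have "\<dots> = ?w p"
        by (simp add: ennreal_mult)
      finally show "ennreal (kernel_pair p * (diff_pair (?g n) p)\<^sup>2) \<le> ?w p" .
    qed
  next
    show "AE p in ?M. (\<lambda>n. ennreal (kernel_pair p * (diff_pair (?g n) p)\<^sup>2)) \<longlonglongrightarrow> 0"
    proof (rule AE_I2)
      fix p :: "(real^'n) \<times> (real^'n)"
      have "\<forall>\<^sub>F n in sequentially. 0 = ennreal (kernel_pair p * (diff_pair (?g n) p)\<^sup>2)"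
        using outer_cutoff_eventually_0[of "fst p"] outer_cutoff_eventually_0[of "snd p"]
        by eventually_elim (simp add: diff_pair_def)
      then show "(\<lambda>n. ennreal (kernel_pair p * (diff_pair (?g n) p)\<^sup>2)) \<longlonglongrightarrow> 0"
        by (rule Lim_transform_eventually[OF tendsto_const])
    qed
  qed measurable
  then have 1: "(\<lambda>n. gagliardo (?g n)) \<longlonglongrightarrow> 0"
    by (simp add: gagliardo_eq_pair kernel_pair_def diff_pair_def)
  have "(\<lambda>n. \<integral>\<^sup>+x. ennreal ((?g n x)\<^sup>2 * log_weight x) \<partial>lborel) \<longlonglongrightarrow> (\<integral>\<^sup>+x. 0 \<partial>(lborel :: (real^'n) measure))"
  proof (rule nn_integral_dominated_convergence)
    show "(\<integral>\<^sup>+x. ennreal ((v x)\<^sup>2 * log_weight x) \<partial>lborel) < \<infinity>"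
      using v by (simp add: dlog_fun_iff weight_sq_def)
    show "AE x in lborel. ennreal ((?g n x)\<^sup>2 * log_weight x) \<le> ennreal ((v x)\<^sup>2 * log_weight x)" for n
      using outer_cutoff_bounds
      by (intro AE_I2 ennreal_leI mult_right_mono)
        (auto simp: power_mult_distrib intro!: mult_left_le_one_le power_le_one)
    show "AE x in lborel. (\<lambda>n. ennreal ((?g n x)\<^sup>2 * log_weight x)) \<longlonglongrightarrow> 0"
    proof (rule AE_I2)
      fix x :: "real^'n"
      have "\<forall>\<^sub>F n in sequentially. 0 = ennreal ((?g n x)\<^sup>2 * log_weight x)"
        using outer_cutoff_eventually_0[of x] by eventually_elim simp
      then show "(\<lambda>n. ennreal ((?g n x)\<^sup>2 * log_weight x)) \<longlonglongrightarrow> 0"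
        by (rule Lim_transform_eventually[OF tendsto_const])
    qed
  qed measurable
  then have 2: "(\<lambda>n. weight_sq (?g n)) \<longlonglongrightarrow> 0"
    by (simp add: weight_sq_def)
  have "(\<lambda>n. ennreal (c_const CARD('n) / 2) * gagliardo (?g n) + weight_sq (?g n)) \<longlonglongrightarrow> ennreal (c_const CARD('n) / 2) * 0 + 0"
    by (intro tendsto_add ennreal_tendsto_cmult 1 2) simp
  then show ?thesis by (simp add: dlog_enorm2_eq)
qed

lemma dlog_fun_enorm2_finite:
  assumes "v \<in> borel_measurable borel" "dlog_enorm2 v < \<infinity>"
  shows "v \<in> dlog_fun"
  using assms l2_sq_le_dlog_enorm2[OF assms(1)] by (auto simp: dlog_fun_def sq_integrable_iff intro: order.strict_trans1)

lemma dlog_fun_cutoff_approx: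
  fixes v :: "real^'n \<Rightarrow> real"
  assumes v: "v \<in> dlog_fun" and e: "0 < e"
  shows "\<exists>u\<in>dlog_fun. (\<exists>R. \<forall>x. R \<le> norm x \<longrightarrow> u x = 0) \<and> dlog_enorm2 (\<lambda>x. v x - u x) < ennreal e"
proof -
  have [measurable]: "v \<in> borel_measurable borel" using v by (simp add: dlog_fun_iff)
  have "\<forall>\<^sub>F n in sequentially. dlog_enorm2 (\<lambda>x. outer_cutoff n x * v x) < ennreal e"
    using e by (intro order_tendstoD(2)[OF outer_cutoff_enorm2_tendsto_0[OF v]]) simp
  then obtain n where n: "dlog_enorm2 (\<lambda>x. outer_cutoff n x * v x) < ennreal e"
    by (auto simp: eventually_sequentially)
  have "(\<lambda>x. outer_cutoff n x * v x) \<in> dlog_fun"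
    using n by (intro dlog_fun_enorm2_finite) (auto intro: order.strict_trans)
  from dlog_fun_diff[OF v this] have u: "(\<lambda>x. v x - outer_cutoff n x * v x) \<in> dlog_fun" .
  have "v x - outer_cutoff n x * v x = 0" if "real n + 1 \<le> norm x" for x
    using that by (simp add: outer_cutoff_def)
  with u n show ?thesis
    by (intro bexI[of _ "\<lambda>x. v x - outer_cutoff n x * v x"]) auto
qed

section \<open>Mollification in the energy norm\<close>

lemma dlog_enorm2_minus:
  assumes "v \<in> borel_measurable borel"
  shows "dlog_enorm2 (\<lambda>x. - v x) = dlog_enorm2 v"
  using gagliardo_scale[OF assms, of "-1"] weight_sq_scale[OF assms, of "-1"] assms
  by (simp add: dlog_enorm2_eq)

lemma sq_integrable_support_integrable:
  assumes u: "u \<in> sq_integrable" and R: "\<And>x. R \<le> norm x \<Longrightarrow> u x = 0"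
  shows "integrable lborel (u :: real^'n \<Rightarrow> real)"
proof (rule Bochner_Integration.integrable_bound)
  have "integrable lborel (indicator (ball 0 R) :: real^'n \<Rightarrow> real)"
    using emeasure_lborel_ball_finite[of "0::real^'n" R] by (intro integrable_real_indicator) (auto simp: less_top)
  then show "integrable lborel (\<lambda>x. indicator (ball 0 R) x + (u x)\<^sup>2)"
    using u by (simp add: sq_integrable_def)
  show "u \<in> borel_measurable lborel" using u by (simp add: sq_integrable_def)
  show "AE x in lborel. norm (u x) \<le> norm (indicator (ball 0 R) x + (u x)\<^sup>2)"
  proof (rule AE_I2)
    fix x
    show "norm (u x) \<le> norm (indicator (ball 0 R) x + (u x)\<^sup>2)"
      using R[of x] abs_le_1_plus_sq[of "u x"] by (cases "R \<le> norm x") auto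
  qed
qed

lemma correlate_shift_left:
  fixes u j :: "real^'n \<Rightarrow> real"
  assumes [measurable]: "u \<in> borel_measurable borel" "j \<in> borel_measurable borel"
  shows "correlate (\<lambda>y. u (y + z)) j x = correlate u j (x + z)"
  by (simp add: correlate_shift add.assoc add.left_commute add.commute)

text \<open>Applying the \<open>L\<^sup>2\<close> rate of convergence to every difference \<open>u(x + z) - u(x)\<close>, which again has
  finite energy, gives convergence in the energy without any density argument in \<open>L\<^sup>2\<close>.\<close>

lemma shift_sq_correlate_le:
  fixes u j :: "real^'n \<Rightarrow> real"
  assumes j: "mollifier j" and u: "u \<in> dlog_fun"
    and le: "\<And>z. z \<noteq> 0 \<Longrightarrow> j z \<le> d * sing_kernel z" and d: "0 \<le> d"
  shows "shift_sq (\<lambda>x. correlate u j x - u x) z \<le> 4 * shift_sq u z"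
    and "shift_sq (\<lambda>x. correlate u j x - u x) z \<le> ennreal d * (4 * gagliardo u)"
proof -
  have [measurable]: "u \<in> borel_measurable borel" "j \<in> borel_measurable borel"
    using u mollifierD(4)[OF j] by (auto simp: dlog_fun_iff)
  note us = dlog_fun_sq_integrable[OF u]
  \<comment> \<open>The increment is written as a sum with a multiple to match the closure and
    subadditivity lemmas.\<close>
  let ?w = "\<lambda>x. u (x + z) + (- 1) * u x"
  have sh: "(\<lambda>x. u (x + z)) \<in> sq_integrable"
    using sq_integrable_shift[OF us, of z] by (simp add: add.commute)
  have ws: "?w \<in> sq_integrable"
    by (intro sq_integrable_add sq_integrable_scale us sh)
  note js = Cc_infinity_sq_integrable[OF mollifierD(1)[OF j]]
  have corr: "correlate ?w j x = correlate u j (x + z) - correlate u j x" for x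
  proof -
    have js': "(\<lambda>y. j (y - x)) \<in> sq_integrable"
      using sq_integrable_shift[OF js, of "- x"] by simp
    have "correlate ?w j x = correlate (\<lambda>y. u (y + z)) j x - correlate u j x"
      unfolding correlate_def
      using sq_integrable_mult[OF sh js'] sq_integrable_mult[OF us js']
      by (simp add: left_diff_distrib)
    then show ?thesis by (simp add: correlate_shift_left)
  qed
  \<comment> \<open>Correlation commutes with translation, so the increment of the error is the
    error for the increment.\<close>
  have eq: "shift_sq (\<lambda>x. correlate u j x - u x) z = l2_sq (\<lambda>x. correlate ?w j x - ?w x)"
    unfolding shift_sq_def l2_sq_def corr by (simp add: algebra_simps)
  have lw: "l2_sq ?w = shift_sq u z"
    by (simp add: l2_sq_def shift_sq_def)
  have cm: "correlate ?w j \<in> borel_measurable borel" by (rule correlate_measurable) measurable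
  have "l2_sq (\<lambda>x. correlate ?w j x + (- ?w x)) \<le> 2 * l2_sq (correlate ?w j) + 2 * l2_sq (\<lambda>x. - ?w x)"
    by (intro l2_sq_add_le cm) measurable
  also have "\<dots> \<le> 2 * l2_sq ?w + 2 * l2_sq ?w"
    by (intro add_mono mult_left_mono l2_sq_correlate_le[OF j ws]) (auto simp: l2_sq_def power2_commute)
  also have "\<dots> = 4 * shift_sq u z"
    unfolding lw by (metis mult_2 numeral_Bit0 distrib_right)
  finally show "shift_sq (\<lambda>x. correlate u j x - u x) z \<le> 4 * shift_sq u z"
    unfolding eq by (simp only: diff_conv_add_uminus)
  have shz: "gagliardo (\<lambda>x. u (x + z)) = gagliardo u"
  proof -
    have "shift_sq (\<lambda>x. u (x + z)) h = shift_sq u h" for h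
    proof -
      have "(\<integral>\<^sup>+x. ennreal ((u (z + x + h) - u (z + x))\<^sup>2) \<partial>lborel) = shift_sq u h"
        unfolding shift_sq_def
        by (rule nn_integral_lborel_shift[where f = "\<lambda>x. ennreal ((u (x + h) - u x)\<^sup>2)"]) measurable
      then show ?thesis
        unfolding shift_sq_def by (simp add: add.commute add.left_commute)
    qed
    then show ?thesis by (simp add: gagliardo_def)
  qed
  have "gagliardo ?w \<le> 2 * gagliardo (\<lambda>x. u (x + z)) + 2 * gagliardo (\<lambda>x. (- 1) * u x)"
    by (intro gagliardo_add_le) measurable
  also have "gagliardo (\<lambda>x. (- 1) * u x) = gagliardo u"
    by (subst gagliardo_scale) auto
  also have "2 * gagliardo (\<lambda>x. u (x + z)) + 2 * gagliardo u = 4 * gagliardo u"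
    unfolding shz by (metis mult_2 numeral_Bit0 distrib_right)
  finally have gw: "gagliardo ?w \<le> 4 * gagliardo u" .
  have "l2_sq (\<lambda>x. correlate ?w j x - ?w x) \<le> ennreal d * gagliardo ?w"
    by (rule l2_sq_correlate_diff_le_gagliardo[OF j ws le d])
  also have "\<dots> \<le> ennreal d * (4 * gagliardo u)"
    by (intro mult_left_mono gw) simp
  finally show "shift_sq (\<lambda>x. correlate u j x - u x) z \<le> ennreal d * (4 * gagliardo u)"
    unfolding eq .
qed

lemma tendsto_ennreal_const_div:
  fixes B :: ennreal
  assumes "B < top"
  shows "(\<lambda>m. ennreal (A / real (Suc m)) * B) \<longlonglongrightarrow> 0"
proof -
  have "(\<lambda>m. A * inverse (real (Suc m))) \<longlonglongrightarrow> A * 0"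
    by (intro tendsto_mult tendsto_const LIMSEQ_inverse_real_of_nat)
  then have "(\<lambda>m. ennreal (A / real (Suc m))) \<longlonglongrightarrow> ennreal 0"
    by (intro tendsto_ennrealI) (simp add: divide_inverse)
  then have "(\<lambda>m. B * ennreal (A / real (Suc m))) \<longlonglongrightarrow> B * ennreal 0"
    by (rule ennreal_tendsto_cmult[OF assms])
  then show ?thesis by (simp add: mult.commute)
qed

lemma dlog_fun_mollify_approx:
  fixes u :: "real^'n \<Rightarrow> real"
  assumes u: "u \<in> dlog_fun" and R: "\<And>x. R \<le> norm x \<Longrightarrow> u x = 0" and e: "0 < e"
  shows "\<exists>f\<in>Cc_infinity. dlog_enorm2 (\<lambda>x. f x - u x) < ennreal e"
proof -
  have um [measurable]: "u \<in> borel_measurable borel" and gu: "gagliardo u < \<infinity>"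
    using u by (auto simp: dlog_fun_iff)
  note us = dlog_fun_sq_integrable[OF u]
  have ui: "integrable lborel u" by (rule sq_integrable_support_integrable[OF us R])
  obtain A where A: "0 < A"
    "\<forall>m>0. \<exists>j :: real^'n \<Rightarrow> real. mollifier j \<and> (\<forall>z. z \<noteq> 0 \<longrightarrow> j z \<le> A / real m * sing_kernel z)"
    using mollifier_exists[where 'n='n] by blast
  then have "\<forall>m. \<exists>j :: real^'n \<Rightarrow> real. mollifier j \<and> (\<forall>z. z \<noteq> 0 \<longrightarrow> j z \<le> A / real (Suc m) * sing_kernel z)"
    by blast
  then obtain j :: "nat \<Rightarrow> real^'n \<Rightarrow> real" where
    j': "\<forall>m. mollifier (j m) \<and> (\<forall>z. z \<noteq> 0 \<longrightarrow> j m z \<le> A / real (Suc m) * sing_kernel z)"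
    by (rule choice[THEN exE])
  then have j: "mollifier (j m)" and jle: "z \<noteq> 0 \<Longrightarrow> j m z \<le> A / real (Suc m) * sing_kernel z" for m z
    by auto
  note [measurable] = mollifierD(4)[OF j]
  have Am: "0 \<le> A / real (Suc m)" for m using A by simp
  define w where "w m x = correlate u (j m) x - u x" for m x
  have wm [measurable]: "w m \<in> borel_measurable borel" for m
    unfolding w_def[abs_def] by measurable
  \<comment> \<open>The majorant comes from the first estimate of
    \<open>shift_sq_correlate_le\<close>, the pointwise limit from the second.\<close>
  have "(\<lambda>m. \<integral>\<^sup>+z. ennreal (sing_kernel z) * shift_sq (w m) z \<partial>lborel) \<longlonglongrightarrow> (\<integral>\<^sup>+z. 0 \<partial>(lborel :: (real^'n) measure))"
  proof (rule nn_integral_dominated_convergence)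
    have "(\<integral>\<^sup>+z. 4 * (ennreal (sing_kernel z) * shift_sq u z) \<partial>lborel) = 4 * gagliardo u"
      unfolding gagliardo_def by (rule nn_integral_cmult) measurable
    then show "(\<integral>\<^sup>+z. 4 * (ennreal (sing_kernel z) * shift_sq u z) \<partial>lborel) < \<infinity>"
      using gu by (simp add: ennreal_mult_less_top)
    show "AE z in lborel. ennreal (sing_kernel z) * shift_sq (w m) z \<le> 4 * (ennreal (sing_kernel z) * shift_sq u z)" for m
    proof (rule AE_I2)
      fix z :: "real^'n"
      have "ennreal (sing_kernel z) * shift_sq (w m) z \<le> ennreal (sing_kernel z) * (4 * shift_sq u z)"
        unfolding w_def by (intro mult_left_mono shift_sq_correlate_le(1)[OF j u jle Am]) auto
      then show "ennreal (sing_kernel z) * shift_sq (w m) z \<le> 4 * (ennreal (sing_kernel z) * shift_sq u z)"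
        by (simp add: mult.left_commute)
    qed
    show "AE z in lborel. (\<lambda>m. ennreal (sing_kernel z) * shift_sq (w m) z) \<longlonglongrightarrow> 0"
    proof (rule AE_I2)
      fix z :: "real^'n"
      have "(\<lambda>m. shift_sq (w m) z) \<longlonglongrightarrow> 0"
      proof (rule tendsto_sandwich[where f = "\<lambda>_. 0"])
        show "\<forall>\<^sub>F m in sequentially. shift_sq (w m) z \<le> ennreal (A / real (Suc m)) * (4 * gagliardo u)"
          unfolding w_def by (intro always_eventually allI shift_sq_correlate_le(2)[OF j u jle Am])
        show "(\<lambda>m. ennreal (A / real (Suc m)) * (4 * gagliardo u)) \<longlonglongrightarrow> 0"
          using gu by (intro tendsto_ennreal_const_div) (simp add: ennreal_mult_less_top)
      qed auto
      then have "(\<lambda>m. ennreal (sing_kernel z) * shift_sq (w m) z) \<longlonglongrightarrow> ennreal (sing_kernel z) * 0"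
        by (intro ennreal_tendsto_cmult) auto
      then show "(\<lambda>m. ennreal (sing_kernel z) * shift_sq (w m) z) \<longlonglongrightarrow> 0" by simp
    qed
  qed measurable
  then have 1: "(\<lambda>m. gagliardo (w m)) \<longlonglongrightarrow> 0"
    by (simp add: gagliardo_def)
  let ?W = "ennreal (ln (exp 1 + (R + 1)\<^sup>2))"
  \<comment> \<open>The mollifiers vanish outside the open unit ball, being dominated by
    \<open>sing_kernel\<close>; so all errors live in one ball, where the weight is at most
    \<open>?W\<close>.\<close>
  have supp: "w m x = 0" if x: "R + 1 \<le> norm x" for m x
  proof -
    have jz: "j m z = 0" if "1 \<le> norm z" for z
    proof -
      have "sing_kernel z = 0" "z \<noteq> 0" using that by (auto simp: sing_kernel_def)
      then show ?thesis using jle[of z m] mollifierD(2)[OF j, of m z] by simp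
    qed
    have "correlate u (j m) x = 0" by (rule correlate_eq_0[OF R jz x])
    then show ?thesis using x R[of x] by (simp add: w_def)
  qed
  have 2: "(\<lambda>m. weight_sq (w m)) \<longlonglongrightarrow> 0"
  proof (rule tendsto_sandwich[where f = "\<lambda>_. 0"])
    show "\<forall>\<^sub>F m in sequentially. weight_sq (w m) \<le> ennreal (A / real (Suc m)) * (?W * gagliardo u)"
    proof (intro always_eventually allI)
      fix m
      have "weight_sq (w m) \<le> ?W * l2_sq (w m)"
        by (rule weight_sq_le_support[OF wm supp])
      also have "\<dots> \<le> ?W * (ennreal (A / real (Suc m)) * gagliardo u)"
        unfolding w_def by (intro mult_left_mono l2_sq_correlate_diff_le_gagliardo j us jle Am) auto
      finally show "weight_sq (w m) \<le> ennreal (A / real (Suc m)) * (?W * gagliardo u)"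
        by (simp add: mult.left_commute)
    qed
    show "(\<lambda>m. ennreal (A / real (Suc m)) * (?W * gagliardo u)) \<longlonglongrightarrow> 0"
      using gu by (intro tendsto_ennreal_const_div) (simp add: ennreal_mult_less_top)
  qed auto
  have "(\<lambda>m. ennreal (c_const CARD('n) / 2) * gagliardo (w m) + weight_sq (w m)) \<longlonglongrightarrow> ennreal (c_const CARD('n) / 2) * 0 + 0"
    by (intro tendsto_add ennreal_tendsto_cmult 1 2) simp
  then have "(\<lambda>m. dlog_enorm2 (w m)) \<longlonglongrightarrow> 0"
    by (simp add: dlog_enorm2_eq)
  then have "\<forall>\<^sub>F m in sequentially. dlog_enorm2 (w m) < ennreal e"
    using e by (intro order_tendstoD(2)) auto
  then obtain m where "dlog_enorm2 (w m) < ennreal e"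
    by (auto simp: eventually_sequentially)
  moreover have "correlate u (j m) \<in> Cc_infinity"
    by (rule correlate_Cc_infinity[OF ui R mollifierD(1)[OF j]])
  ultimately show ?thesis by (auto simp: w_def[abs_def])
qed

lemma Cc_infinity_dense_dlog_fun:
  fixes v :: "real^'n \<Rightarrow> real"
  assumes v: "v \<in> dlog_fun" and e: "0 < e"
  shows "\<exists>f\<in>Cc_infinity. dlog_enorm2 (\<lambda>x. v x - f x) < ennreal e"
proof -
  \<comment> \<open>With the constant 2 in the quadratic triangle inequality, two errors below e/4
    add up to less than e.\<close>
  obtain u R where u: "u \<in> dlog_fun" and R: "\<And>x. R \<le> norm x \<Longrightarrow> u x = 0"
    and vu: "dlog_enorm2 (\<lambda>x. v x - u x) < ennreal (e / 4)"
    using dlog_fun_cutoff_approx[OF v, of "e / 4"] e by auto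
  obtain f where f: "f \<in> Cc_infinity" and fu: "dlog_enorm2 (\<lambda>x. f x - u x) < ennreal (e / 4)"
    using dlog_fun_mollify_approx[OF u R, where e = "e / 4"] e by auto
  have [measurable]: "u \<in> borel_measurable borel" "v \<in> borel_measurable borel" "f \<in> borel_measurable borel"
    using u v f by (auto simp: dlog_fun_iff Cc_infinity_measurable)
  have uf: "dlog_enorm2 (\<lambda>x. u x - f x) < ennreal (e / 4)"
    using fu dlog_enorm2_minus[of "\<lambda>x. f x - u x"] by simp
  have "dlog_enorm2 (\<lambda>x. (v x - u x) + (u x - f x)) \<le> 2 * dlog_enorm2 (\<lambda>x. v x - u x) + 2 * dlog_enorm2 (\<lambda>x. u x - f x)"
    by (rule dlog_enorm2_add_le) measurable
  also have "\<dots> < 2 * ennreal (e / 4) + 2 * ennreal (e / 4)"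
    using vu uf by (intro add_strict_mono ennreal_mult_strict_left_mono) auto
  also have "\<dots> = ennreal e"
  proof -
    have "2 * ennreal (e / 4) = ennreal (2 * (e / 4))"
      using e by (subst ennreal_mult) auto
    then show ?thesis
      using e by (simp only:) (subst ennreal_plus[symmetric], auto)
  qed
  finally show ?thesis using f by auto
qed

lemma Cc_infinity_subset_Dlog: "abs_l2 ` Cc_infinity \<subseteq> (Dlog :: 'n::finite l2 set)"
  by (auto simp: Dlog_def Cc_infinity_dlog_fun)

lemma Cc_infinity_dense_Dlog:
  "ip_topology Dlog dlog_inner closure_of (abs_l2 ` Cc_infinity) = (Dlog :: 'n::finite l2 set)"
proof -
  interpret Metric_space "Dlog :: 'n l2 set" "ip_dist Dlog dlog_inner"
    by (rule Metric_space_Dlog)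
  have "\<exists>b\<in>abs_l2 ` Cc_infinity. b \<in> mball a r" if a: "a \<in> Dlog" and r: "0 < r" for a :: "'n l2" and r
  proof -
    obtain v where v: "v \<in> dlog_fun" "a = abs_l2 v" using a by (rule Dlog_cases)
    obtain f where f: "f \<in> Cc_infinity" "dlog_enorm2 (\<lambda>x. v x - f x) < ennreal (r\<^sup>2)"
      using Cc_infinity_dense_dlog_fun[OF v(1), of "r\<^sup>2"] r by auto
    then have fd: "f \<in> dlog_fun" by (intro Cc_infinity_dlog_fun)
    have "ip_dist Dlog dlog_inner a (abs_l2 f) < r"
      using f(2) v ip_dist_Dlog_less[OF v(1) fd r] by simp
    moreover have "abs_l2 f \<in> Dlog" using fd by (simp add: Dlog_def)
    ultimately have "abs_l2 f \<in> mball a r"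
      using a by simp
    then show ?thesis using f(1) by blast
  qed
  then show ?thesis
    by (auto simp: metric_closure_of)
qed

theorem theorem1p5:
  shows
    "(\<forall>v1\<in>dlog_fun. \<forall>v2\<in>dlog_fun.
        log_energy_finite v1 (v2 :: real^'n::finite \<Rightarrow> real) \<and>
        integrable lborel (\<lambda>x. v1 x * v2 x * log_weight x)) \<and>
     hilbert_space_on (Dlog :: 'n l2 set) dlog_inner \<and>
     (abs_l2 ` Cc_infinity \<subseteq> (Dlog :: 'n l2 set) \<and>
      ip_topology Dlog dlog_inner closure_of (abs_l2 ` Cc_infinity) = (Dlog :: 'n l2 set)) \<and>
     compactly_embedded (Dlog :: 'n l2 set) dlog_inner \<and>
     (\<exists>C>0. \<forall>v1\<in>dlog_fun. \<forall>v2\<in>dlog_fun.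
        log_energy_finite v1 (v2 :: real^'n \<Rightarrow> real) \<and>
        set_integrable (lborel \<Otimes>\<^sub>M lborel) {(x, y). norm (x - y) \<ge> 1}
          (\<lambda>(x, y). v1 x * v2 y / norm (x - y) ^ CARD('n)) \<and>
        integrable lborel (\<lambda>x. v1 x * v2 x) \<and>
        \<bar>log_energy_L v1 v2\<bar> \<le> C * dlog_norm v1 * dlog_norm v2)"
proof (intro conjI)
  show "\<forall>v1\<in>dlog_fun. \<forall>v2\<in>dlog_fun.
      log_energy_finite v1 (v2 :: real^'n \<Rightarrow> real) \<and> integrable lborel (\<lambda>x. v1 x * v2 x * log_weight x)"
    by (intro ballI conjI log_energy_finite weight_integrable')
  show "hilbert_space_on (Dlog :: 'n l2 set) dlog_inner"
    by (simp add: hilbert_space_on_def subspace_Dlog inner_product_on_Dlog mcomplete_Dlog)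
qed (rule Cc_infinity_subset_Dlog Cc_infinity_dense_Dlog compactly_embedded_Dlog log_energy_L_bound)+

end
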